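(* Let $p>0$ be the characteristic of $\mathbb{F}_q$ and let $r=p^e$ for any integer $e>0$. If $n>6r$, then $\mathrm{UT}_n(q)$ has an irreducible (complex) character of degree $q^{5r^2-2r}$ whose set of values is contained in $\mathbb{Q}(\zeta_{pr})$ but not in $\mathbb{Q}(\zeta_r)$. Such a character in fact occurs as an irreducible constituent of each supercharacter of $\mathrm{UT}_n(q)$ whose shape is the set partition of $[n]$ whose parts are the $n-4r-1$ sets $$\{1,\,2r+1,\,3r+1,\,4r+1,\,6r+1\},$$ $$\{i,\,2r+i,\,3r+i,\,5r+i\}\ \text{ for } 1<i\le r,$$ $$\{i,\,3r+1+i\}\ \text{ for } r+1\le i\le 2r,$$ $$\{i\}\ \text{ for } 6r+1<i\le n.$$
   Context: $\mathbb{F}_q$ is a finite field with $q$ elements. $\mathfrak{u}_n(q)$ is the $\mathbb{F}_q$-algebra of strictly upper triangular $n\times n$ matrices over $\mathbb{F}_q$, and $G=\mathrm{UT}_n(q)=1+\mathfrak{u}_n(q)$ is the group of upper triangular $n\times n$ matrices with all diagonal entries equal to $1$. $\zeta_m=e^{2\pi i/m}$ and $\mathbb{Q}(\zeta_m)$ is the $m$th cyclotomic field. $[n]=\{1,\dots,n\}$. Fix a nontrivial homomorphism $\theta:\mathbb{F}_q^+\to\mathbb{C}^\times$ from the additive group of $\mathbb{F}_q$. For $\lambda$ in the dual space $\mathfrak{u}_n(q)^*$ let $\theta_\lambda:G\to\mathbb{C}$, $\theta_\lambda(g)=\theta(\lambda(g-1))$. The group $G$ acts on the left and right of $\mathfrak{u}_n(q)^*$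 by $(g\lambda)(X)=\lambda(g^{-1}X)$ and $(\lambda g)(X)=\lambda(Xg^{-1})$; these actions commute. The supercharacter indexed by $\lambda$ is $$\chi_\lambda=\frac{|G\lambda|}{|G\lambda G|}\sum_{\mu\in G\lambda G}\theta_\mu,$$ which is a (possibly reducible) character of $G$. Let $e_{ij}$ ($i<j$) be the elementary matrix with $1$ in position $(i,j)$ and $0$ elsewhere, and write $\lambda_{ij}=\lambda(e_{ij})$ for $i<j$ and $\lambda_{ij}=0$ otherwise. A map $\lambda\in\mathfrak{u}_n(q)^*$ is quasi-monomial if the matrix $(\lambda_{ij})$ has at most one nonzero entry in each row and each column. The assignment $\lambda\mapsto\chi_\lambda$ is a bijection from quasi-monomial maps in $\mathfrak{u}_n(q)^*$ to supercharacters of $\mathrm{UT}_n(q)$. The shape of a quasi-monomial $\lambda$ is the finest set partition of $[n]$ in which $i,j$ belong to the same part whenever $\lambda_{ij}\neq0$; the shape of a supercharacter $\chi$ is the shape of the unique quasi-monomial $\lambda$ with $\chi=\chi_\lambda$. *)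

theory Defs
  imports
    "HOL-Algebra.Generated_Fields"
    "HOL-Library.Disjoint_Sets"
    "HOL-Library.FuncSet"
    "HOL-Library.Cardinality"
    "Jordan_Normal_Form.VS_Connect"
begin

section \<open>Cyclotomic fields\<close>

definition zeta :: "nat \<Rightarrow> complex" where
  "zeta m = exp (2 * of_real pi * \<i> / of_nat m)"

text \<open>The subfield of the complex numbers generated by \<open>zeta m\<close>; it automatically
  contains the prime field.\<close>

definition cyclotomic_field :: "nat \<Rightarrow> complex set" where
  "cyclotomic_field m = generate_field (class_ring :: complex ring) {zeta m}"


section \<open>Complex characters of a group\<close>

text \<open>A representation of degree \<open>d\<close> is a homomorphism into the group of invertible complex
  \<open>d \<times> d\<close> matrices. Class functions are taken to be extensional (equal to \<open>undefined\<close> off the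
  carrier), so that equality of characters is equality of functions.\<close>

definition general_linear :: "nat \<Rightarrow> complex mat monoid" where
  "general_linear d = units_of (ring_mat TYPE(complex) d ())"

definition representation ::
  "('g, 'b) monoid_scheme \<Rightarrow> nat \<Rightarrow> ('g \<Rightarrow> complex mat) \<Rightarrow> bool" where
  "representation G d \<rho> \<longleftrightarrow> \<rho> \<in> hom G (general_linear d)"

definition irreducible_representation ::
  "('g, 'b) monoid_scheme \<Rightarrow> nat \<Rightarrow> ('g \<Rightarrow> complex mat) \<Rightarrow> bool" where
  "irreducible_representation G d \<rho> \<longleftrightarrow>
     representation G d \<rho> \<and> d > 0 \<and>
     (\<forall>W. subspace class_ring W (module_vec TYPE(complex) d) \<longrightarrow>
          (\<forall>g\<in>carrier G. \<forall>w\<in>W. \<rho> g *\<^sub>v w \<in> W) \<longrightarrow>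
          W = {0\<^sub>v d} \<or> W = carrier_vec d)"

definition mat_trace :: "'a::comm_monoid_add mat \<Rightarrow> 'a" where
  "mat_trace A = (\<Sum>i<dim_row A. A $$ (i, i))"

definition irreducible_character ::
  "('g, 'b) monoid_scheme \<Rightarrow> ('g \<Rightarrow> complex) \<Rightarrow> bool" where
  "irreducible_character G \<psi> \<longleftrightarrow>
     (\<exists>d \<rho>. irreducible_representation G d \<rho> \<and> \<psi> = (\<lambda>g\<in>carrier G. mat_trace (\<rho> g)))"

definition character_degree :: "('g, 'b) monoid_scheme \<Rightarrow> ('g \<Rightarrow> complex) \<Rightarrow> complex" where
  "character_degree G \<psi> = \<psi> \<one>\<^bsub>G\<^esub>"

definition character_inner ::
  "('g, 'b) monoid_scheme \<Rightarrow> ('g \<Rightarrow> complex) \<Rightarrow> ('g \<Rightarrow> complex) \<Rightarrow> complex" where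
  "character_inner G \<chi> \<psi> = (\<Sum>g\<in>carrier G. \<chi> g * cnj (\<psi> g)) / of_nat (card (carrier G))"

definition irreducible_constituent ::
  "('g, 'b) monoid_scheme \<Rightarrow> ('g \<Rightarrow> complex) \<Rightarrow> ('g \<Rightarrow> complex) \<Rightarrow> bool" where
  "irreducible_constituent G \<chi> \<psi> \<longleftrightarrow>
     irreducible_character G \<psi> \<and> character_inner G \<chi> \<psi> \<noteq> 0"


section \<open>The unitriangular group and its supercharacters\<close>

definition strictly_upper :: "nat \<Rightarrow> 'a::field mat set" where
  "strictly_upper n = {X \<in> carrier_mat n n. \<forall>i<n. \<forall>j\<le>i. X $$ (i, j) = 0}"

definition UT :: "nat \<Rightarrow> 'a::field mat monoid" where
  "UT n = \<lparr>carrier = {1\<^sub>m n + X | X. X \<in> strictly_upper n}, mult = (*), one = 1\<^sub>m n\<rparr>"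

text \<open>Linear forms on the strictly upper triangular matrices, again extensional.\<close>

definition dual :: "nat \<Rightarrow> ('a::field mat \<Rightarrow> 'a) set" where
  "dual n = {\<phi> \<in> extensional (strictly_upper n).
     (\<forall>X\<in>strictly_upper n. \<forall>Y\<in>strictly_upper n. \<phi> (X + Y) = \<phi> X + \<phi> Y) \<and>
     (\<forall>c. \<forall>X\<in>strictly_upper n. \<phi> (c \<cdot>\<^sub>m X) = c * \<phi> X)}"

definition left_act :: "nat \<Rightarrow> 'a::field mat \<Rightarrow> ('a mat \<Rightarrow> 'a) \<Rightarrow> 'a mat \<Rightarrow> 'a" where
  "left_act n g \<phi> = (\<lambda>X\<in>strictly_upper n. \<phi> (inv\<^bsub>UT n\<^esub> g * X))"

definition right_act :: "nat \<Rightarrow> ('a::field mat \<Rightarrow> 'a) \<Rightarrow> 'a mat \<Rightarrow> 'a mat \<Rightarrow> 'a" where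
  "right_act n \<phi> g = (\<lambda>X\<in>strictly_upper n. \<phi> (X * inv\<^bsub>UT n\<^esub> g))"

definition left_orbit :: "nat \<Rightarrow> ('a::field mat \<Rightarrow> 'a) \<Rightarrow> ('a mat \<Rightarrow> 'a) set" where
  "left_orbit n \<phi> = {left_act n g \<phi> | g. g \<in> carrier (UT n)}"

definition two_sided_orbit :: "nat \<Rightarrow> ('a::field mat \<Rightarrow> 'a) \<Rightarrow> ('a mat \<Rightarrow> 'a) set" where
  "two_sided_orbit n \<phi> =
     {right_act n (left_act n g \<phi>) h | g h. g \<in> carrier (UT n) \<and> h \<in> carrier (UT n)}"

definition nontrivial_additive_hom :: "('a::field \<Rightarrow> complex) \<Rightarrow> bool" where
  "nontrivial_additive_hom \<theta> \<longleftrightarrow>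
     (\<forall>x. \<theta> x \<noteq> 0) \<and> (\<forall>x y. \<theta> (x + y) = \<theta> x * \<theta> y) \<and> (\<exists>x. \<theta> x \<noteq> 1)"

definition supercharacter ::
  "('a::{field,finite} \<Rightarrow> complex) \<Rightarrow> nat \<Rightarrow> ('a mat \<Rightarrow> 'a) \<Rightarrow> 'a mat \<Rightarrow> complex" where
  "supercharacter \<theta> n \<phi> = (\<lambda>g\<in>carrier (UT n).
     of_nat (card (left_orbit n \<phi>)) / of_nat (card (two_sided_orbit n \<phi>)) *
     (\<Sum>\<mu>\<in>two_sided_orbit n \<phi>. \<theta> (\<mu> (g - 1\<^sub>m n))))"

text \<open>Rows and columns are numbered from 1 here, as in \<open>[n] = {1..n}\<close>, whereas the matrix
  library numbers them from 0.\<close>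

definition elementary_mat :: "nat \<Rightarrow> nat \<Rightarrow> nat \<Rightarrow> 'a::field mat" where
  "elementary_mat n i j = mat n n (\<lambda>(a, b). if Suc a = i \<and> Suc b = j then 1 else 0)"

definition coeff_of :: "nat \<Rightarrow> ('a::field mat \<Rightarrow> 'a) \<Rightarrow> nat \<Rightarrow> nat \<Rightarrow> 'a" where
  "coeff_of n \<phi> i j = (if i < j then \<phi> (elementary_mat n i j) else 0)"

definition quasi_monomial :: "nat \<Rightarrow> ('a::field mat \<Rightarrow> 'a) \<Rightarrow> bool" where
  "quasi_monomial n \<phi> \<longleftrightarrow> \<phi> \<in> dual n \<and>
     (\<forall>i\<in>{1..n}. card {j \<in> {1..n}. coeff_of n \<phi> i j \<noteq> 0} \<le> 1) \<and>
     (\<forall>j\<in>{1..n}. card {i \<in> {1..n}. coeff_of n \<phi> i j \<noteq> 0} \<le> 1)"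

definition joins_support :: "nat \<Rightarrow> ('a::field mat \<Rightarrow> 'a) \<Rightarrow> nat set set \<Rightarrow> bool" where
  "joins_support n \<phi> P \<longleftrightarrow>
     (\<forall>i\<in>{1..n}. \<forall>j\<in>{1..n}. coeff_of n \<phi> i j \<noteq> 0 \<longrightarrow> (\<exists>B\<in>P. i \<in> B \<and> j \<in> B))"

definition is_shape :: "nat \<Rightarrow> ('a::field mat \<Rightarrow> 'a) \<Rightarrow> nat set set \<Rightarrow> bool" where
  "is_shape n \<phi> P \<longleftrightarrow>
     partition_on {1..n} P \<and> joins_support n \<phi> P \<and>
     (\<forall>Q. partition_on {1..n} Q \<and> joins_support n \<phi> Q \<longrightarrow> refines {1..n} P Q)"

text \<open>Every supercharacter is \<open>supercharacter \<theta> n \<phi>\<close> for exactly one quasi-monomial \<open>\<phi>\<close>, so the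
  existential quantifier below ranges over a single form.\<close>

definition supercharacter_of_shape ::
  "('a::{field,finite} \<Rightarrow> complex) \<Rightarrow> nat \<Rightarrow> ('a mat \<Rightarrow> complex) \<Rightarrow> nat set set \<Rightarrow> bool" where
  "supercharacter_of_shape \<theta> n \<chi> P \<longleftrightarrow>
     (\<exists>\<phi>. quasi_monomial n \<phi> \<and> \<chi> = supercharacter \<theta> n \<phi> \<and> is_shape n \<phi> P)"

definition exotic_partition :: "nat \<Rightarrow> nat \<Rightarrow> nat set set" where
  "exotic_partition r n =
     {{1, 2*r + 1, 3*r + 1, 4*r + 1, 6*r + 1}}
     \<union> {{i, 2*r + i, 3*r + i, 5*r + i} | i. 1 < i \<and> i \<le> r}
     \<union> {{i, 3*r + 1 + i} | i. r + 1 \<le> i \<and> i \<le> 2*r}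
     \<union> {{i} | i. 6*r + 1 < i \<and> i \<le> n}"

end

theory Submission
  imports Defs "Jordan_Normal_Form.Char_Poly" "HOL-Computational_Algebra.Field_as_Ring"
    "HOL-Computational_Algebra.Formal_Power_Series" "HOL-Number_Theory.Cong"
begin

text \<open>The character is induced from a linear character \<open>\<tau>\<close> of a subgroup \<open>P\<close>.
  Rescaling rows and columns makes all nonzero coefficients of the quasi-monomial form \<open>\<lambda>\<close> equal to 1.
  Number the rows from 0 and put \<open>A = [0, r)\<close>, \<open>M = [r, 2r)\<close>, \<open>B = [2r, 3r)\<close>, \<open>C = [3r, 4r]\<close>.
  The elements of \<open>P\<close> have equal unitriangular diagonal blocks on \<open>A\<close>, \<open>M\<close>, \<open>B\<close>, on the first \<open>r\<close> rows of
  \<open>C\<close> and on the last \<open>r\<close> rows of \<open>C\<close>. The overlap inside \<open>C\<close> forces these blocks to be Toeplitz, so \<open>P\<close>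
  maps onto the truncated unit group \<open>1 + t F[t]/(t^(r+1))\<close>, the coefficient of \<open>t^r\<close> being the entry
  at the arc from \<open>3r\<close> to \<open>4r\<close>. In that group \<open>(1 + x t)^r = 1 + x^r t^r\<close>, because \<open>r\<close> is a power of \<open>p\<close>; hence a
  character extending \<open>\<theta>\<close> from \<open>1 + F t^r\<close> takes a primitive \<open>pr\<close>-th root of unity as a value.

  Irreducibility is Mackey's criterion, tested on the subgroup \<open>N\<close> of \<open>P\<close> on which the above
  blocks are trivial and \<open>\<tau>\<close> is \<open>\<theta>\<close> composed with a linear form \<open>F\<close>: if \<open>g \<notin> P\<close>, then some elementary
  matrix \<open>y\<close> satisfies \<open>F (g y) \<noteq> F (y g)\<close> with \<open>1 + y g\<close> and \<open>1 + g y\<close> in \<open>N\<close>. The same test shows that the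
  projection onto the \<open>\<tau>\<close>-isotypic part for \<open>N\<close> has rank one, whence
  \<open>\<Sum>h\<in>N. \<psi> (h x) / \<tau> h = |N| \<tau> x\<close> for \<open>x \<in> P\<close>. Since \<open>\<tau>\<close> takes \<open>p\<close>-th roots of unity as values on \<open>N\<close>, the
  field generated by \<open>\<zeta>\<^sub>r\<close> and the values of \<open>\<psi>\<close> contains \<open>\<tau> x\<close>, which may be a primitive \<open>pr\<close>-th root of unity.\<close>

section \<open>Extending characters of finite abelian groups\<close>

text \<open>The arcs of \<lambda> link the diagonal block on \<open>A\<close> to the one on
  \<open>B\<close>, and the one on \<open>B\<close> to the first \<open>r\<close> rows of
  \<open>C\<close>; nothing in them compares the two overlapping blocks of \<open>C\<close>. The
  linear form \<open>F\<close> therefore has two terms beyond \<lambda>: the main diagonals of the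
  block with rows \<open>A\<close> and columns \<open>M\<close>, and of the block with rows
  \<open>M\<close> and columns in the last \<open>r\<close> indices of \<open>C\<close>. They close
  the chain from the last rows of \<open>C\<close> through \<open>M\<close>, \<open>A\<close> and
  \<open>B\<close> to the first rows of \<open>C\<close>, so that a block of \<open>C\<close> agrees
  with its own shift by one. For the supercharacter these terms are harmless: their positions lie
  strictly inside arcs, where elements of the left annihilator of \<lambda> vanish, so on that
  subgroup \<open>F\<close> reduces to \<lambda>. In general \<open>F\<close> is not additive on
  \<open>P\<close>, since a product mixes the diagonals of an off-diagonal block with the Toeplitz
  coefficients. This is why \<open>tau\<close> involves a quotient of power series that reduces to a
  plain diagonal sum on \<open>N\<close>.\<close>

lemma (in group) finite_closed_subgroup:
  assumes "finite H" "H \<subseteq> carrier G" "H \<noteq> {}"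
    and closed: "\<And>x y. x \<in> H \<Longrightarrow> y \<in> H \<Longrightarrow> x \<otimes> y \<in> H"
  shows "subgroup H G"
proof -
  \<comment> \<open>Left translation by \<open>x\<close> permutes the finite set, so the identity
    and the inverses arise as solutions of equations inside it.\<close>
  have surj: "\<exists>y\<in>H. x \<otimes> y = z" if x: "x \<in> H" and z: "z \<in> H" for x z
  proof -
    have inj: "inj_on (\<lambda>y. x \<otimes> y) H"
      using x assms(2) by (intro inj_onI) (auto simp: subset_iff)
    have "(\<lambda>y. x \<otimes> y) ` H = H"
      using x closed by (intro card_subset_eq) (auto simp: assms(1) card_image inj)
    then show ?thesis using z by (metis imageE)
  qed
  have one: "\<one> \<in> H"
  proof -
    obtain x where x: "x \<in> H" using assms(3) by auto
    then obtain y where y: "y \<in> H" "x \<otimes> y = x" using surj by blast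
    then have "y = \<one>" using x assms(2) by (metis l_cancel_one subsetD)
    then show ?thesis using y by simp
  qed
  show ?thesis
  proof (rule subgroupI[OF assms(2,3)])
    fix a assume a: "a \<in> H"
    then obtain y where y: "y \<in> H" "a \<otimes> y = \<one>" using surj one by blast
    then have "inv a = y" using a assms(2) by (intro inv_equality inv_comm[of a y]) auto
    then show "inv a \<in> H" using y by simp
  qed (rule closed)
qed

lemma complex_nth_root_exists:
  fixes z :: complex
  assumes "m > 0"
  shows "\<exists>c. c ^ m = z"
proof -
  have "(rcis (root m (cmod z)) (Arg z / real m)) ^ m = rcis (cmod z) (Arg z)"
    using assms by (simp add: DeMoivre2)
  then show ?thesis by (auto simp: rcis_cmod_Arg)
qed

definition group_character_on :: "('g, 'b) monoid_scheme \<Rightarrow> 'g set \<Rightarrow> ('g \<Rightarrow> complex) \<Rightarrow> bool" where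
  "group_character_on K H \<chi> \<longleftrightarrow>
    (\<forall>x\<in>H. \<chi> x \<noteq> 0) \<and> (\<forall>x\<in>H. \<forall>y\<in>H. \<chi> (x \<otimes>\<^bsub>K\<^esub> y) = \<chi> x * \<chi> y)"

context comm_group
begin

lemma group_character_on_one:
  assumes "subgroup H G" "group_character_on G H \<chi>"
  shows "\<chi> \<one> = 1"
proof -
  have "\<one> \<in> H" using assms by (simp add: subgroup.one_closed)
  then have "\<chi> (\<one> \<otimes> \<one>) = \<chi> \<one> * \<chi> \<one>" "\<chi> \<one> \<noteq> 0"
    using assms(2) unfolding group_character_on_def by blast+
  then show ?thesis by simp
qed

lemma group_character_on_pow:
  assumes "subgroup H G" "group_character_on G H \<chi>" "x \<in> H"
  shows "x [^] (k::nat) \<in> H \<and> \<chi> (x [^] k) = \<chi> x ^ k"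
proof (induction k)
  case 0
  then show ?case using assms group_character_on_one subgroup.one_closed by auto
next
  case (Suc k)
  then show ?case
    using assms subgroup.m_closed[OF assms(1)] unfolding group_character_on_def by simp
qed

text \<open>Since \<open>x [^] m\<close> is the first power of \<open>x\<close> back in
  \<open>H\<close>, the only constraint on the value at \<open>x\<close> is that its
  \<open>m\<close>-th power be the value already prescribed. Leaving the root \<open>c\<close> open
  allows a value different from 1 at a chosen element.\<close>

lemma extend_character_step:
  assumes fin: "finite (carrier G)" and H: "subgroup H G" and chi: "group_character_on G H \<chi>"
    and x: "x \<in> carrier G" and m: "m > 0" "x [^] m \<in> H"
    and m_min: "\<And>k::nat. 0 < k \<Longrightarrow> k < m \<Longrightarrow> x [^] k \<notin> H"
    and c: "c ^ m = \<chi> (x [^] m)"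
  shows "\<exists>H' \<chi>'. subgroup H' G \<and> group_character_on G H' \<chi>' \<and> H \<subseteq> H' \<and> x \<in> H' \<and>
    (\<forall>h\<in>H. \<chi>' h = \<chi> h) \<and> \<chi>' x = c"
proof -
  \<comment> \<open>\<open>R\<close> is the graph of the extension. Natural exponents suffice
    because a finite set closed under products is a subgroup.\<close>
  define R where "R y v \<longleftrightarrow> (\<exists>h\<in>H. \<exists>k::nat. y = h \<otimes> x [^] k \<and> v = \<chi> h * c ^ k)" for y v
  have Hc: "h \<in> carrier G" if "h \<in> H" for h using that H by (rule subgroup.mem_carrier[rotated])
  have c0: "c \<noteq> 0"
    using c chi m by (auto simp: group_character_on_def power_0_left)
  \<comment> \<open>Well-definedness: two expressions for one element differ by a power of
    \<open>x\<close> lying in \<open>H\<close>. By minimality its exponent is a multiple of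
    \<open>m\<close>, where \<open>c\<close> and \<open>\<chi>\<close> are compatible.\<close>
  have key: "\<chi> h * c ^ k = \<chi> h' * c ^ l"
    if h: "h \<in> H" "h' \<in> H" "h \<otimes> x [^] k = h' \<otimes> x [^] l" "k \<le> l" for h h' and k l :: nat
  proof -
    define d where "d = l - k"
    have l: "l = d + k" using h by (simp add: d_def)
    have "h \<otimes> x [^] k = (h' \<otimes> x [^] d) \<otimes> x [^] k"
      using h x Hc by (simp add: l nat_pow_mult[symmetric] m_assoc)
    then have hd: "h = h' \<otimes> x [^] d" using h x Hc by simp
    then have xd: "x [^] d = inv h' \<otimes> h"
      using h x Hc by (simp add: m_assoc[symmetric])
    then have dH: "x [^] d \<in> H"
      using h subgroup.m_closed[OF H] subgroup.m_inv_closed[OF H] by simp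
    have "x [^] (m * (d div m)) \<in> H"
      using group_character_on_pow[OF H chi m(2), of "d div m"] x by (simp add: nat_pow_pow)
    moreover have "x [^] d = x [^] (m * (d div m)) \<otimes> x [^] (d mod m)"
      using x by (simp add: nat_pow_mult)
    ultimately have "x [^] (d mod m) = inv (x [^] (m * (d div m))) \<otimes> x [^] d"
      using x by (simp add: m_assoc[symmetric])
    then have "x [^] (d mod m) \<in> H"
      using dH \<open>x [^] (m * (d div m)) \<in> H\<close> subgroup.m_closed[OF H] subgroup.m_inv_closed[OF H] by simp
    then have "d mod m = 0" using m_min[of "d mod m"] m by (metis gr0I mod_less_divisor)
    then obtain j where j: "d = m * j" by auto
    have "\<chi> (x [^] d) = \<chi> (x [^] m) ^ j"
      using group_character_on_pow[OF H chi m(2), of j] x by (simp add: j nat_pow_pow)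
    also have "\<dots> = c ^ d" using c by (simp add: j power_mult)
    finally have "\<chi> h = \<chi> h' * c ^ d"
      using chi h dH unfolding hd group_character_on_def by simp
    then show ?thesis by (simp add: l power_add)
  qed
  have uniq: "v = w" if vw: "R y v" "R y w" for y v w
  proof -
    obtain h k h' l where hk: "h \<in> H" "y = h \<otimes> x [^] (k::nat)" "v = \<chi> h * c ^ k"
      "h' \<in> H" "y = h' \<otimes> x [^] (l::nat)" "w = \<chi> h' * c ^ l"
      using vw unfolding R_def by blast
    show ?thesis
      using key[of h h' k l] key[of h' h l k] hk by (cases "k \<le> l") auto
  qed
  define H' where "H' = {y. \<exists>v. R y v}"
  define \<chi>' where "\<chi>' y = (THE v. R y v)" for y
  have val: "\<chi>' y = v" if "R y v" for y v
    unfolding \<chi>'_def using that uniq by blast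
  have Rmult: "R (y \<otimes> z) (v * w)" if yz: "R y v" "R z w" for y z v w
  proof -
    obtain h k h' l where hk: "h \<in> H" "y = h \<otimes> x [^] (k::nat)" "v = \<chi> h * c ^ k"
      "h' \<in> H" "z = h' \<otimes> x [^] (l::nat)" "w = \<chi> h' * c ^ l"
      using yz unfolding R_def by blast
    have "y \<otimes> z = (h \<otimes> h') \<otimes> x [^] (k + l)"
      using hk x Hc by (simp add: nat_pow_mult[symmetric] m_ac)
    moreover have "v * w = \<chi> (h \<otimes> h') * c ^ (k + l)"
      using hk chi by (simp add: group_character_on_def power_add)
    moreover have "h \<otimes> h' \<in> H" using hk subgroup.m_closed[OF H] by simp
    ultimately show ?thesis unfolding R_def by blast
  qed
  have RH: "R h (\<chi> h)" if "h \<in> H" for h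
    unfolding R_def using that Hc by (intro bexI[of _ h] exI[of _ "0::nat"]) auto
  have Rx: "R x c"
    unfolding R_def using x subgroup.one_closed[OF H] group_character_on_one[OF H chi]
    by (intro bexI[of _ \<one>] exI[of _ "1::nat"]) auto
  have H'c: "H' \<subseteq> carrier G" using x Hc by (auto simp: H'_def R_def)
  have "subgroup H' G"
  proof (rule finite_closed_subgroup)
    show "finite H'" using H'c fin by (rule finite_subset)
    show "H' \<noteq> {}" using Rx by (auto simp: H'_def)
    show "\<And>y z. y \<in> H' \<Longrightarrow> z \<in> H' \<Longrightarrow> y \<otimes> z \<in> H'" unfolding H'_def using Rmult by blast
  qed (rule H'c)
  moreover have "group_character_on G H' \<chi>'"
    unfolding group_character_on_def
  proof (intro conjI ballI)
    fix y assume "y \<in> H'"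
    then obtain v where v: "R y v" by (auto simp: H'_def)
    then have "v \<noteq> 0" using c0 chi by (auto simp: R_def group_character_on_def)
    then show "\<chi>' y \<noteq> 0" using val[OF v] by simp
    fix z assume "z \<in> H'"
    then obtain w where w: "R z w" by (auto simp: H'_def)
    show "\<chi>' (y \<otimes> z) = \<chi>' y * \<chi>' z"
      using val[OF v] val[OF w] val[OF Rmult[OF v w]] by simp
  qed
  moreover have "H \<subseteq> H'" "x \<in> H'" "\<forall>h\<in>H. \<chi>' h = \<chi> h" "\<chi>' x = c"
    using RH Rx val by (auto simp: H'_def)
  ultimately show ?thesis by blast
qed

text \<open>Some positive power of any element lies in \<open>H\<close>, so an element outside can
  be adjoined; the induction is on the number of elements still missing.\<close>

lemma extend_character:
  assumes "finite (carrier G)" "subgroup H G" "group_character_on G H \<chi>"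
  shows "\<exists>\<chi>'. group_character_on G (carrier G) \<chi>' \<and> (\<forall>h\<in>H. \<chi>' h = \<chi> h)"
  using assms(2,3)
proof (induction "card (carrier G) - card H" arbitrary: H \<chi> rule: less_induct)
  case less
  show ?case
  proof (cases "H = carrier G")
    case False
    have Hc: "H \<subseteq> carrier G" using less.prems subgroup.subset by blast
    then obtain x where x: "x \<in> carrier G" "x \<notin> H" using False by auto
    define m where "m = (LEAST m::nat. 0 < m \<and> x [^] m \<in> H)"
    have ex: "0 < Coset.order G \<and> x [^] Coset.order G \<in> H"
      using x pow_order_eq_1[OF x(1)] subgroup.one_closed[OF less.prems(1)] assms(1)
      by (simp add: order_gt_0_iff_finite)
    have m: "0 < m \<and> x [^] m \<in> H"
      unfolding m_def by (rule LeastI[of _ "Coset.order G"]) (rule ex)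
    have m_min: "x [^] k \<notin> H" if "0 < k" "k < m" for k :: nat
      using not_less_Least[of k "\<lambda>m. 0 < m \<and> x [^] m \<in> H"] that by (auto simp: m_def)
    obtain c where c: "c ^ m = \<chi> (x [^] m)" using complex_nth_root_exists m by blast
    obtain H' \<chi>' where H': "subgroup H' G" "group_character_on G H' \<chi>'" "H \<subseteq> H'" "x \<in> H'"
      "\<forall>h\<in>H. \<chi>' h = \<chi> h"
      using extend_character_step[OF assms(1) less.prems x(1) _ _ m_min c] m by blast
    have "H' \<subseteq> carrier G" using H' subgroup.subset by blast
    then have "card H < card H'" "card H' \<le> card (carrier G)"
      using H' x assms(1) by (auto intro!: psubset_card_mono card_mono finite_subset[of H' "carrier G"])
    then have "card (carrier G) - card H' < card (carrier G) - card H" by simp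
    from less.hyps[OF this H'(1,2)] show ?thesis using H' by fastforce
  qed (use less.prems in auto)
qed

end

text \<open>The existence half of the theorem comes without a character of the field. The element 1
  has additive order \<open>p\<close>, so it may be sent to a primitive \<open>p\<close>-th root of
  unity, and the resulting character extends to the whole additive group.\<close>

lemma nontrivial_additive_hom_exists:
  "\<exists>\<theta> :: 'a::{field,finite} \<Rightarrow> complex. nontrivial_additive_hom \<theta>"
proof -
  define K :: "'a monoid" where "K = \<lparr>carrier = UNIV, monoid.mult = (+), one = 0\<rparr>"
  have K: "carrier K = UNIV" "monoid.mult K = (+)" "one K = 0" by (simp_all add: K_def)
  interpret comm_group K
  proof (rule comm_groupI)
    fix x show "\<exists>y\<in>carrier K. y \<otimes>\<^bsub>K\<^esub> x = \<one>\<^bsub>K\<^esub>"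
      by (intro bexI[of _ "-x"]) (auto simp: K)
  qed (auto simp: K algebra_simps)
  have pow: "x [^]\<^bsub>K\<^esub> (k::nat) = of_nat k * x" for x k
    by (induction k) (auto simp: K nat_pow_def algebra_simps)
  define p where "p = CHAR('a)"
  have p: "prime p" unfolding p_def by (intro prime_CHAR_semidom finite_imp_CHAR_pos) simp
  define c where "c = cis (2 * pi / real p)"
  have c: "c ^ p = 1" "c \<noteq> 1"
  proof -
    show "c ^ p = 1" using prime_gt_0_nat[OF p] by (simp add: c_def DeMoivre)
    have b: "bij_betw (\<lambda>k. cis (2 * pi * real k / real p)) {..<p} {z. z ^ p = 1}"
      by (rule bij_betw_roots_unity) (use p in \<open>simp add: prime_gt_0_nat\<close>)
    have "cis (2 * pi * real 1 / real p) \<noteq> cis (2 * pi * real 0 / real p)"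
      using inj_onD[OF bij_betw_imp_inj_on[OF b], of 1 0] prime_gt_1_nat[OF p] by auto
    then show "c \<noteq> 1" by (simp add: c_def)
  qed
  have H: "subgroup {0} K" using triv_subgroup by (simp add: K)
  have chi: "group_character_on K {0} (\<lambda>_. 1)" by (simp add: group_character_on_def)
  have "\<exists>H' \<chi>'. subgroup H' K \<and> group_character_on K H' \<chi>' \<and> {0} \<subseteq> H' \<and> 1 \<in> H' \<and>
    (\<forall>h\<in>{0}. \<chi>' h = 1) \<and> \<chi>' 1 = c"
  proof (rule extend_character_step[OF _ H chi, where m = p])
    show "1 [^]\<^bsub>K\<^esub> p \<in> {0}" by (simp add: pow p_def)
    show "1 [^]\<^bsub>K\<^esub> k \<notin> {0}" if "0 < k" "k < p" for k
      using that by (auto simp: pow of_nat_eq_0_iff_char_dvd p_def dest: dvd_imp_le)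
  qed (use c p in \<open>auto simp: K prime_gt_0_nat\<close>)
  then obtain H' \<chi>' where H': "subgroup H' K" "group_character_on K H' \<chi>'" "1 \<in> H'" "\<chi>' 1 = c"
    by blast
  obtain \<theta> where \<theta>: "group_character_on K (carrier K) \<theta>" "\<forall>h\<in>H'. \<theta> h = \<chi>' h"
    using extend_character[OF _ H'(1,2)] by (auto simp: K)
  have "\<theta> 1 \<noteq> 1" using \<theta>(2) H' c by simp
  moreover have "\<forall>x. \<theta> x \<noteq> 0" "\<forall>x y. \<theta> (x + y) = \<theta> x * \<theta> y"
    using \<theta>(1) unfolding group_character_on_def K by auto
  ultimately have "nontrivial_additive_hom \<theta>"
    unfolding nontrivial_additive_hom_def by blast
  then show ?thesis by blast
qed

section \<open>Truncated power series\<close>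

text \<open>Congruence modulo \<open>fps_X ^ (r + 1)\<close>, kept as a relation on full power
  series so that inverses of series remain available.\<close>

definition fps_agree :: "nat \<Rightarrow> 'a::comm_ring_1 fps \<Rightarrow> 'a fps \<Rightarrow> bool" where
  "fps_agree r f g \<longleftrightarrow> (\<forall>k\<le>r. fps_nth f k = fps_nth g k)"

lemma fps_agree_refl[simp]: "fps_agree r f f"
  and fps_agree_sym: "fps_agree r f g \<Longrightarrow> fps_agree r g f"
  and fps_agree_trans: "fps_agree r f g \<Longrightarrow> fps_agree r g h \<Longrightarrow> fps_agree r f h"
  by (auto simp: fps_agree_def)

lemma fps_agree_mult: "fps_agree r f f' \<Longrightarrow> fps_agree r g g' \<Longrightarrow> fps_agree r (f * g) (f' * g')"
  by (auto simp: fps_agree_def fps_mult_nth intro!: sum.cong)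

lemma fps_agree_inverse:
  fixes f g :: "'a::field fps"
  assumes "fps_agree r f g" "fps_nth f 0 \<noteq> 0" "fps_nth g 0 \<noteq> 0"
  shows "fps_agree r (inverse f) (inverse g)"
proof -
  have "fps_agree r (inverse f * (g * inverse g)) (inverse f * (f * inverse g))"
    using assms by (intro fps_agree_mult fps_agree_refl) (auto intro: fps_agree_sym)
  moreover have "inverse f * (g * inverse g) = inverse f"
    using assms(3) by (simp add: inverse_mult_eq_1')
  moreover have "inverse f * (f * inverse g) = inverse g"
    using inverse_mult_eq_1[OF assms(2)] by (simp add: mult.assoc[symmetric])
  ultimately show ?thesis by simp
qed

definition fps_trunc :: "nat \<Rightarrow> 'a::comm_ring_1 fps \<Rightarrow> 'a fps" where
  "fps_trunc r f = Abs_fps (\<lambda>k. if k \<le> r then fps_nth f k else 0)"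

lemma fps_trunc_nth[simp]: "fps_nth (fps_trunc r f) k = (if k \<le> r then fps_nth f k else 0)"
  by (simp add: fps_trunc_def)

lemma fps_trunc_eq_iff: "fps_trunc r f = fps_trunc r g \<longleftrightarrow> fps_agree r f g"
  by (auto simp: fps_eq_iff fps_agree_def)

lemma fps_agree_trunc: "fps_agree r (fps_trunc r f) f"
  by (simp add: fps_agree_def)

text \<open>Truncated series with constant term 1 form a finite abelian group, in which the series
  \<open>1 + c * fps_X ^ r\<close> are a copy of the additive group of the field; \<theta> is
  carried over to them and extended. Composition with truncation yields a function of arbitrary
  series.\<close>

lemma unit_fps_character_exists:
  fixes \<theta> :: "'a::{field,finite} \<Rightarrow> complex"
  assumes \<theta>: "nontrivial_additive_hom \<theta>" and r: "r > 0"
  obtains \<omega> :: "'a fps \<Rightarrow> complex" where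
    "\<And>f g. fps_nth f 0 = 1 \<Longrightarrow> fps_nth g 0 = 1 \<Longrightarrow> \<omega> (f * g) = \<omega> f * \<omega> g"
    "\<And>f. fps_nth f 0 = 1 \<Longrightarrow> \<omega> f \<noteq> 0"
    "\<And>f g. fps_agree r f g \<Longrightarrow> \<omega> f = \<omega> g"
    "\<And>c. \<omega> (1 + fps_const c * fps_X ^ r) = \<theta> c"
proof -
  define K :: "'a fps monoid" where
    "K = \<lparr>carrier = {f. fps_nth f 0 = 1 \<and> (\<forall>k>r. fps_nth f k = 0)}, monoid.mult = (\<lambda>f g. fps_trunc r (f * g)), one = 1\<rparr>"
  have K: "carrier K = {f. fps_nth f 0 = 1 \<and> (\<forall>k>r. fps_nth f k = 0)}"
    "monoid.mult K = (\<lambda>f g. fps_trunc r (f * g))" "one K = 1" by (simp_all add: K_def)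
  have trunc_id: "fps_trunc r f = f" if "f \<in> carrier K" for f
    using that by (auto simp: K fps_eq_iff)
  have trunc_K: "fps_trunc r f \<in> carrier K" if "fps_nth f 0 = 1" for f
    using that by (auto simp: K)
  have eqI: "f = g" if "f \<in> carrier K" "g \<in> carrier K" "fps_agree r f g" for f g
    using that trunc_id fps_trunc_eq_iff by metis
  interpret K: comm_group K
  proof (rule comm_groupI)
    fix f g h assume fgh: "f \<in> carrier K" "g \<in> carrier K" "h \<in> carrier K"
    have "fps_agree r (fps_trunc r (f * g) * h) (f * g * h)"
      by (intro fps_agree_mult fps_agree_trunc fps_agree_refl)
    moreover have "fps_agree r (f * (g * h)) (f * fps_trunc r (g * h))"
      by (intro fps_agree_mult fps_agree_refl fps_agree_sym[OF fps_agree_trunc])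
    ultimately have "fps_agree r (fps_trunc r (f * g) * h) (f * fps_trunc r (g * h))"
      by (metis fps_agree_trans mult.assoc)
    then show "f \<otimes>\<^bsub>K\<^esub> g \<otimes>\<^bsub>K\<^esub> h = f \<otimes>\<^bsub>K\<^esub> (g \<otimes>\<^bsub>K\<^esub> h)"
      by (simp add: K fps_trunc_eq_iff)
  next
    fix f assume f: "f \<in> carrier K"
    then have f0: "fps_nth f 0 = 1" by (simp add: K)
    have "fps_agree r (fps_trunc r (inverse f) * f) (inverse f * f)"
      by (intro fps_agree_mult fps_agree_trunc fps_agree_refl)
    then have "fps_trunc r (fps_trunc r (inverse f) * f) = fps_trunc r 1"
      using f0 by (simp add: fps_trunc_eq_iff inverse_mult_eq_1)
    also have "fps_trunc r 1 = (1 :: 'a fps)" by (auto simp: fps_eq_iff)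
    finally show "\<exists>g\<in>carrier K. g \<otimes>\<^bsub>K\<^esub> f = \<one>\<^bsub>K\<^esub>"
      using trunc_K[of "inverse f"] f0 by (intro bexI[of _ "fps_trunc r (inverse f)"]) (auto simp: K)
  qed (auto simp: K mult.commute fps_eq_iff)
  have finK: "finite (carrier K)"
  proof (rule finite_imageD)
    let ?F = "\<lambda>f :: 'a fps. \<lambda>k\<in>{..r}. fps_nth f k"
    show "finite (?F ` carrier K)"
    proof (rule finite_subset)
      show "?F ` carrier K \<subseteq> {..r} \<rightarrow>\<^sub>E UNIV" by (intro image_subsetI) (simp add: restrict_PiE_iff)
    qed (simp add: finite_PiE)
    show "inj_on ?F (carrier K)"
    proof (rule inj_onI)
      fix f g assume fg: "f \<in> carrier K" "g \<in> carrier K" "?F f = ?F g"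
      have "fps_agree r f g"
        unfolding fps_agree_def using fun_cong[OF fg(3)] by (auto dest: spec) (metis atMost_iff restrict_apply')
      then show "f = g" using eqI fg by blast
    qed
  qed
  define z where "z c = 1 + fps_const c * fps_X ^ r" for c :: 'a
  have zn: "fps_nth (z c) k = (if k = 0 then 1 else if k = r then c else 0)" for c k
    using r by (auto simp: z_def)
  have zK: "z c \<in> carrier K" for c using r by (auto simp: K zn)
  have zz: "z c \<otimes>\<^bsub>K\<^esub> z d = z (c + d)" for c d
  proof -
    have "fps_nth (z c * z d) k = (if k = 0 then 1 else if k = r then c + d else 0)" if k: "k \<le> r" for k
    proof -
      \<comment> \<open>The cross term has degree \<open>r + r\<close>, beyond the
        truncation.\<close>
      have "z c * z d = z (c + d) + fps_const (c * d) * fps_X ^ (r + r)"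
        by (simp add: z_def algebra_simps power_add flip: fps_const_mult fps_const_add)
      then show ?thesis using k r by (simp add: zn)
    qed
    then show ?thesis by (auto simp: K fps_eq_iff zn)
  qed
  have \<theta>a: "\<theta> (c + d) = \<theta> c * \<theta> d" "\<theta> c \<noteq> 0" for c d
    using \<theta> by (simp_all add: nontrivial_additive_hom_def)
  define \<chi> where "\<chi> f = \<theta> (fps_nth f r)" for f :: "'a fps"
  have \<chi>z: "\<chi> (z c) = \<theta> c" for c using r by (simp add: \<chi>_def zn)
  have sub: "subgroup (range z) K"
    by (rule K.finite_closed_subgroup) (auto simp: zK zz image_subset_iff)
  have ch: "group_character_on K (range z) \<chi>"
    by (auto simp: group_character_on_def \<chi>z zz \<theta>a)
  obtain \<chi>' where \<chi>': "group_character_on K (carrier K) \<chi>'" "\<forall>h\<in>range z. \<chi>' h = \<chi> h"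
    using K.extend_character[OF finK sub ch] by blast
  define \<omega> where "\<omega> f = \<chi>' (fps_trunc r f)" for f
  show ?thesis
  proof (rule that[of \<omega>])
    fix f g :: "'a fps" assume fg: "fps_nth f 0 = 1" "fps_nth g 0 = 1"
    have "fps_trunc r (f * g) = fps_trunc r f \<otimes>\<^bsub>K\<^esub> fps_trunc r g"
      unfolding K fps_trunc_eq_iff
      by (rule fps_agree_sym) (intro fps_agree_mult fps_agree_trunc)
    then show "\<omega> (f * g) = \<omega> f * \<omega> g"
      using \<chi>'(1) trunc_K fg unfolding \<omega>_def group_character_on_def by simp
  next
    fix f :: "'a fps" assume "fps_nth f 0 = 1"
    then show "\<omega> f \<noteq> 0" using \<chi>'(1) trunc_K unfolding \<omega>_def group_character_on_def by simp
  next
    fix f g :: "'a fps" assume "fps_agree r f g"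
    then show "\<omega> f = \<omega> g" by (simp add: \<omega>_def fps_trunc_eq_iff[symmetric])
  next
    fix c show "\<omega> (1 + fps_const c * fps_X ^ r) = \<theta> c"
      using \<chi>'(2) \<chi>z trunc_id[OF zK] unfolding \<omega>_def z_def[symmetric] by simp
  qed
qed

section \<open>Frobenius powers in finite fields and in power series\<close>

lemma prime_CHAR_finite: "prime CHAR('a::{field,finite})"
  by (intro prime_CHAR_semidom finite_imp_CHAR_pos) simp

lemma CHAR_power_ge_2: "e > 0 \<Longrightarrow> 2 \<le> CHAR('a::{field,finite}) ^ e"
proof -
  assume e: "e > 0"
  note p = prime_CHAR_finite[where 'a = 'a]
  have "CHAR('a) ^ 1 \<le> CHAR('a) ^ e"
    using e prime_gt_0_nat[OF p] by (intro power_increasing) auto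
  then show ?thesis using prime_ge_2_nat[OF p] by simp
qed

text \<open>Additivity makes the Frobenius power injective, hence onto on a finite field. It serves
  to write an element on which \<theta> is nontrivial as an \<open>r\<close>-th power.\<close>

lemma CHAR_power_surj:
  fixes x :: "'a::{field,finite}"
  shows "\<exists>y. y ^ (CHAR('a) ^ e) = x"
proof -
  have "inj (\<lambda>y :: 'a. y ^ (CHAR('a) ^ e))"
  proof (rule injI)
    fix y z :: 'a assume yz: "y ^ (CHAR('a) ^ e) = z ^ (CHAR('a) ^ e)"
    have "((y - z) + z) ^ (CHAR('a) ^ e) = (y - z) ^ (CHAR('a) ^ e) + z ^ (CHAR('a) ^ e)"
      by (rule freshmans_dream'[OF prime_CHAR_finite refl])
    then have "(y - z) ^ (CHAR('a) ^ e) = 0" using yz by simp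
    then show "y = z" by simp
  qed
  then have "surj (\<lambda>y :: 'a. y ^ (CHAR('a) ^ e))" by (rule finite_UNIV_inj_surj[OF finite])
  then show ?thesis by (metis surjD)
qed

lemma fps_CHAR_power:
  fixes u :: "'a::{field,finite} fps"
  shows "(1 + u) ^ (CHAR('a) ^ e) = 1 + u ^ (CHAR('a) ^ e)"
proof -
  have "prime CHAR('a fps)" by (simp add: prime_CHAR_finite)
  from freshmans_dream'[OF this refl, of 1 u e] show ?thesis by simp
qed

section \<open>Cyclotomic fields\<close>

lemma zeta_cis: "zeta m = cis (2 * pi / real m)"
  by (simp add: zeta_def cis_conv_exp mult_ac)

lemma zeta_power_eq_1: "m > 0 \<Longrightarrow> zeta m ^ m = 1"
  by (simp add: zeta_cis DeMoivre)

lemma root_of_unity_is_zeta_power: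
  assumes "m > 0" "z ^ m = 1"
  shows "\<exists>k<m. z = zeta m ^ k"
proof -
  have "z \<in> (\<lambda>k. cis (2 * pi * real k / real m)) ` {..<m}"
    using bij_betw_imp_surj_on[OF bij_betw_roots_unity[OF assms(1)]] assms by auto
  then show ?thesis by (auto simp: zeta_cis DeMoivre mult_ac)
qed

lemma zeta_mult_power: "k > 0 \<Longrightarrow> zeta (k * m) ^ k = zeta m"
  by (simp add: zeta_cis DeMoivre field_simps)

lemma zeta_neq_1:
  assumes "m > 1"
  shows "zeta m \<noteq> 1"
proof -
  have "inj_on (\<lambda>k. cis (2 * pi * real k / real m)) {..<m}"
    using bij_betw_imp_inj_on[OF bij_betw_roots_unity[of m]] assms by simp
  from inj_onD[OF this, of 1 0] show ?thesis using assms by (auto simp: zeta_cis)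
qed

lemma cyclotomic_field_add: "x \<in> cyclotomic_field m \<Longrightarrow> y \<in> cyclotomic_field m \<Longrightarrow> x + y \<in> cyclotomic_field m"
  using generate_field.eng_add[of x class_ring "{zeta m}" y] by (simp add: cyclotomic_field_def)

lemma cyclotomic_field_mult: "x \<in> cyclotomic_field m \<Longrightarrow> y \<in> cyclotomic_field m \<Longrightarrow> x * y \<in> cyclotomic_field m"
  using generate_field.eng_mult[of x class_ring "{zeta m}" y] by (simp add: cyclotomic_field_def)

lemma cyclotomic_field_uminus: "x \<in> cyclotomic_field m \<Longrightarrow> - x \<in> cyclotomic_field m"
  using generate_field.a_inv[of x class_ring "{zeta m}"]
  by (simp add: cyclotomic_field_def class_ring_simps)

lemma class_ring_inv: "x \<noteq> 0 \<Longrightarrow> m_inv (class_ring :: 'b::field ring) x = inverse x"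
  by (rule comm_monoid.comm_inv_char[OF cring.axioms(2)[OF class_cring.is_cring]]) (auto simp: class_ring_simps)

lemma cyclotomic_field_inverse: "x \<in> cyclotomic_field m \<Longrightarrow> x \<noteq> 0 \<Longrightarrow> inverse x \<in> cyclotomic_field m"
  using generate_field.m_inv[of x class_ring "{zeta m}"]
  by (simp add: cyclotomic_field_def class_ring_inv)

lemma cyclotomic_field_1: "1 \<in> cyclotomic_field m"
  using generate_field.one[of class_ring "{zeta m}"] by (simp add: cyclotomic_field_def)

lemma cyclotomic_field_0: "0 \<in> cyclotomic_field m"
  using cyclotomic_field_add[OF cyclotomic_field_1 cyclotomic_field_uminus[OF cyclotomic_field_1]] by simp

lemma cyclotomic_field_zeta: "zeta m \<in> cyclotomic_field m"
  using generate_field.incl[of "zeta m" "{zeta m}" class_ring] by (simp add: cyclotomic_field_def)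

lemma cyclotomic_field_power: "x \<in> cyclotomic_field m \<Longrightarrow> x ^ k \<in> cyclotomic_field m"
  by (induction k) (auto intro: cyclotomic_field_1 cyclotomic_field_mult)

lemma cyclotomic_field_of_nat: "of_nat k \<in> cyclotomic_field m"
  by (induction k) (auto intro: cyclotomic_field_0 cyclotomic_field_1 cyclotomic_field_add)

lemma cyclotomic_field_sum: "(\<And>x. x \<in> A \<Longrightarrow> f x \<in> cyclotomic_field m) \<Longrightarrow> sum f A \<in> cyclotomic_field m"
  by (induction A rule: infinite_finite_induct) (auto intro: cyclotomic_field_0 cyclotomic_field_add)

lemma root_of_unity_in_cyclotomic_field:
  assumes "m > 0" "z ^ m = 1"
  shows "z \<in> cyclotomic_field m"
  using root_of_unity_is_zeta_power[OF assms] cyclotomic_field_power[OF cyclotomic_field_zeta] by auto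

section \<open>Rational polynomial expressions in an algebraic number\<close>

definition eval_rat :: "complex \<Rightarrow> rat poly \<Rightarrow> complex" where
  "eval_rat u h = poly (map_poly of_rat h) u"

interpretation rat_poly_hom: map_poly_idom_hom "of_rat :: rat \<Rightarrow> complex" ..

lemma eval_rat_add: "eval_rat u (f + g) = eval_rat u f + eval_rat u g"
  by (simp add: eval_rat_def hom_distribs)

lemma eval_rat_mult: "eval_rat u (f * g) = eval_rat u f * eval_rat u g"
  by (simp add: eval_rat_def hom_distribs)

lemma eval_rat_uminus: "eval_rat u (- f) = - eval_rat u f"
  by (simp add: eval_rat_def hom_distribs)

lemma eval_rat_const: "eval_rat u [:c:] = of_rat c"
  by (cases "c = 0") (simp_all add: eval_rat_def map_poly_def)

lemma eval_rat_0: "eval_rat u 0 = 0"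
  by (simp add: eval_rat_def)

lemma eval_rat_pCons: "eval_rat u (pCons a f) = of_rat a + u * eval_rat u f"
  by (simp add: eval_rat_def hom_distribs)

text \<open>Take an annihilating polynomial \<open>m\<close> of least degree. Its gcd with
  \<open>h\<close> does not vanish at \<open>u\<close>, so the cofactor in \<open>m\<close> does,
  and minimality makes the gcd constant; Bezout then exhibits the inverse.\<close>

lemma eval_rat_inverse:
  assumes m0: "m0 \<noteq> 0" "eval_rat u m0 = 0" and h: "eval_rat u h \<noteq> 0"
  shows "\<exists>k. eval_rat u k = inverse (eval_rat u h)"
proof -
  obtain m where m: "m \<noteq> 0" "eval_rat u m = 0"
    and m_min: "\<And>f. f \<noteq> 0 \<Longrightarrow> eval_rat u f = 0 \<Longrightarrow> degree m \<le> degree f"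
    using ex_has_least_nat[of "\<lambda>f. f \<noteq> 0 \<and> eval_rat u f = 0" m0 degree] m0 by auto
  define g where "g = gcd h m"
  obtain k where k: "m = g * k" unfolding g_def by (metis dvdE gcd_dvd2)
  have "g dvd h" by (simp add: g_def)
  then have g0: "eval_rat u g \<noteq> 0" using h by (auto simp: eval_rat_mult elim!: dvdE)
  then have "eval_rat u k = 0" using m(2) by (simp add: k eval_rat_mult)
  then have "degree m \<le> degree k" using m_min m k by auto
  then have "degree g = 0" using m k by (auto simp: degree_mult_eq)
  then obtain c where c: "g = [:c:]" by (metis degree_eq_zeroE)
  have c0: "c \<noteq> 0" using m k c by auto
  obtain a b where ab: "a * h + b * m = g"
    unfolding g_def using bezout_coefficients_fst_snd[of h m] by blast
  have "eval_rat u a * eval_rat u h = of_rat c"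
    using arg_cong[OF ab, of "eval_rat u"] m(2) by (simp add: eval_rat_add eval_rat_mult c eval_rat_const)
  then have "eval_rat u ([:1/c:] * a) * eval_rat u h = 1"
    using c0 unfolding eval_rat_mult eval_rat_const by (simp add: of_rat_divide)
  then show ?thesis using h by (metis inverse_unique mult.commute)
qed

text \<open>Among the closure rules of a generated field only inversion needs an argument; it is
  available because \<open>zeta m\<close> is a root of \<open>X ^ m - 1\<close>.\<close>

lemma cyclotomic_field_eval_rat:
  assumes "m > 0" "x \<in> cyclotomic_field m"
  shows "\<exists>h. x = eval_rat (zeta m) h"
  using assms(2) unfolding cyclotomic_field_def
proof (induction rule: generate_field.induct)
  case one
  show ?case using eval_rat_const[of _ 1] by (intro exI[of _ "[:1:]"]) simp
next
  case (incl h)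
  then show ?case by (intro exI[of _ "[:0, 1:]"]) (simp add: eval_rat_pCons eval_rat_const eval_rat_0)
next
  case (a_inv h)
  then show ?case using eval_rat_uminus by (metis class_ring_simps(8))
next
  case (m_inv h)
  then obtain f where f: "h = eval_rat (zeta m) f" "eval_rat (zeta m) f \<noteq> 0" by auto
  define m0 :: "rat poly" where "m0 = monom 1 m - 1"
  have "m0 \<noteq> 0" using assms(1) by (auto simp: m0_def poly_eq_iff intro!: exI[of _ m])
  moreover have "eval_rat (zeta m) m0 = 0"
    using zeta_power_eq_1[OF assms(1)] by (simp add: m0_def eval_rat_def hom_distribs poly_monom)
  ultimately obtain k where "eval_rat (zeta m) k = inverse (eval_rat (zeta m) f)"
    using eval_rat_inverse f(2) by blast
  then show ?case using f by (metis class_ring_inv)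
next
  case (eng_add h1 h2)
  then show ?case using eval_rat_add by (metis class_ring_simps(3))
next
  case (eng_mult h1 h2)
  then show ?case using eval_rat_mult by (metis class_ring_simps(2))
qed

text \<open>\<open>Phi p r\<close> is the \<open>p r\<close>-th cyclotomic polynomial when \<open>r\<close> is a power of the prime \<open>p\<close>.\<close>

definition Phi :: "nat \<Rightarrow> nat \<Rightarrow> 'b::comm_ring_1 poly" where
  "Phi p r = (\<Sum>k<p. monom 1 (r * k))"

lemma Phi_mult: "(Phi p r :: 'b::comm_ring_1 poly) * (monom 1 r - 1) = monom 1 (r * p) - 1"
proof -
  have "(Phi p r :: 'b poly) = (\<Sum>k<p. monom 1 r ^ k)"
    unfolding Phi_def by (intro sum.cong refl) (simp add: monom_power)
  then have "(monom 1 r - 1) * Phi p r = monom 1 r ^ p - (1 :: 'b poly)"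
    by (simp add: power_diff_1_eq)
  then show ?thesis by (simp add: monom_power mult.commute)
qed

lemma coeff_Phi: "r > 0 \<Longrightarrow> poly.coeff (Phi p r :: 'b::comm_ring_1 poly) n = (if r dvd n \<and> n div r < p then 1 else 0)"
proof -
  assume r: "r > 0"
  have "poly.coeff (Phi p r :: 'b poly) n = (\<Sum>k<p. if k = n div r \<and> r dvd n then 1 else 0)"
    unfolding Phi_def coeff_sum using r by (intro sum.cong refl) (auto simp: coeff_monom)
  also have "\<dots> = (if r dvd n \<and> n div r < p then 1 else 0)" by (auto simp: sum.delta)
  finally show ?thesis .
qed

lemma degree_Phi:
  assumes "r > 0" "p > 0"
  shows "degree (Phi p r :: 'b::comm_ring_1 poly) = r * (p - 1)" "lead_coeff (Phi p r :: 'b poly) = 1"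
proof -
  have c: "poly.coeff (Phi p r :: 'b poly) (r * (p - 1)) = 1" using assms by (simp add: coeff_Phi)
  have "degree (Phi p r :: 'b poly) \<le> r * (p - 1)"
  proof (rule degree_le, intro allI impI)
    fix i assume i: "r * (p - 1) < i"
    have "\<not> (r dvd i \<and> i div r < p)"
    proof
      assume *: "r dvd i \<and> i div r < p"
      then obtain k where "i = r * k" by auto
      then show False using * i assms by auto
    qed
    then show "poly.coeff (Phi p r :: 'b poly) i = 0" using assms by (simp add: coeff_Phi)
  qed
  moreover have "r * (p - 1) \<le> degree (Phi p r :: 'b poly)" using c by (intro le_degree) simp
  ultimately show d: "degree (Phi p r :: 'b poly) = r * (p - 1)" by simp
  show "lead_coeff (Phi p r :: 'b poly) = 1" unfolding d by (rule c)
qed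

lemma poly_Phi_1: "poly (Phi p r) 1 = of_nat p"
  by (simp add: Phi_def poly_sum poly_monom)

text \<open>In characteristic \<open>p\<close> both \<open>X ^ r - 1\<close> and
  \<open>X ^ (r * p) - 1\<close> are powers of \<open>X - 1\<close>; the first is cancelled from the
  product formula for \<open>Phi\<close>.\<close>

lemma Phi_prime_char:
  assumes p: "p = CHAR('b::idom)" "prime p" and r: "r = p ^ e"
  shows "(Phi p r :: 'b poly) = [:-1, 1:] ^ (r * (p - 1))"
proof -
  have ch: "CHAR('b poly) = p" using p by simp
  have r0: "r > 0" using p r by (simp add: prime_gt_0_nat)
  have frob: "monom 1 (p ^ k) - 1 = ([:-1, 1:] :: 'b poly) ^ (p ^ k)" for k
  proof -
    have "([:-1, 1:] + 1 :: 'b poly) ^ (p ^ k) = [:-1, 1:] ^ (p ^ k) + 1 ^ (p ^ k)"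
      by (rule freshmans_dream') (use p ch in auto)
    moreover have "([:-1, 1:] + 1 :: 'b poly) = monom 1 1" by (simp add: monom_Suc one_pCons)
    ultimately show ?thesis by (simp add: monom_power algebra_simps)
  qed
  have "Phi p r * [:-1, 1:] ^ r = (monom 1 (r * p) - 1 :: 'b poly)"
    unfolding r frob[symmetric] Phi_mult by simp
  also have "\<dots> = [:-1, 1:] ^ (r * p)" using frob[of "Suc e"] by (simp add: r mult.commute)
  also have "r * p = r * (p - 1) + r"
    using prime_gt_0_nat[OF p(2)] by (metis Suc_pred' add.commute mult_Suc_right)
  finally show ?thesis by (simp add: power_add del: mult_pCons_left mult_pCons_right)
qed

lemma map_poly_Phi: "map_poly of_int (Phi p r) = (Phi p r :: 'b::comm_ring_1 poly)"
  by (simp add: Phi_def hom_distribs)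

text \<open>If \<open>A\<close> did not vanish at \<open>c\<close>, one linear factor would divide
  the cofactor and could be cancelled, lowering the exponent.\<close>

lemma degree_pos_dvd_linear_power:
  fixes A :: "'b::field poly"
  assumes "A dvd [:-c, 1:] ^ m" "degree A > 0"
  shows "poly A c = 0"
  using assms
proof (induction m arbitrary: A)
  case 0
  then have "degree A = 0" using is_unit_iff_degree[of A] by (metis dvd_0_left_iff power_0 zero_neq_one)
  with 0 show ?case by simp
next
  case (Suc m)
  show ?case
  proof (rule ccontr)
    assume nz: "poly A c \<noteq> 0"
    obtain B where B: "[:-c, 1:] * [:-c, 1:] ^ m = A * B" using Suc.prems(1) by (auto elim!: dvdE)
    then have "poly (A * B) c = 0" by (metis mult_eq_0_iff poly_mult poly_eq_0_iff_dvd dvd_refl)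
    then have "[:-c, 1:] dvd B" using nz by (simp add: poly_eq_0_iff_dvd)
    then obtain C where C: "B = [:-c, 1:] * C" by (rule dvdE)
    have "[:-c, 1:] * [:-c, 1:] ^ m = [:-c, 1:] * (A * C)"
      unfolding B C by (rule mult.left_commute)
    moreover have "[:-c, 1:] \<noteq> 0" by simp
    ultimately have "[:-c, 1:] ^ m = A * C" using mult_left_cancel by blast
    then have "A dvd [:-c, 1:] ^ m" by simp
    then show False using Suc.IH Suc.prems(2) nz by blast
  qed
qed

lemma of_int_unit_neq_0: "c dvd 1 \<Longrightarrow> of_int c \<noteq> (0 :: 'b::ring_1_no_zero_divisors)"
  by (metis dvdE mult_zero_left of_int_1 of_int_mult zero_neq_one)

text \<open>This is irreducibility of \<open>Phi p r\<close> in the style of Eisenstein, put as a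
  degree bound. A primitive integer polynomial \<open>A\<close> of least degree vanishing at
  \<open>z\<close> divides \<open>Phi p r\<close>. Modulo \<open>p\<close> both factors divide a
  power of \<open>X - 1\<close>; if both had positive degree, both values at 1 would be divisible by
  \<open>p\<close>, whereas the product of these values is \<open>p\<close>. The type
  \<open>'a\<close> supplies the field of characteristic \<open>p\<close> in which to
  reduce.\<close>

lemma degree_ge_of_Phi_root:
  fixes F :: "int poly" and z :: complex
  assumes p: "p = CHAR('a::field)" "prime p" and r: "r = p ^ e"
    and z: "poly (Phi p r) z = 0"
    and F: "F \<noteq> 0" "poly (map_poly of_int F) z = 0"
  shows "r * (p - 1) \<le> degree F"
proof -
  have r0: "r > 0" and p0: "p > 0" using p r by (auto simp: prime_gt_0_nat)
  obtain A0 where A0: "A0 \<noteq> 0" "poly (map_poly of_int A0) z = 0"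
    and min: "\<And>f :: int poly. f \<noteq> 0 \<Longrightarrow> poly (map_poly of_int f) z = 0 \<Longrightarrow> degree A0 \<le> degree f"
    using ex_has_least_nat[of "\<lambda>f :: int poly. f \<noteq> 0 \<and> poly (map_poly of_int f) z = 0" F degree] F
    by auto
  define A where "A = primitive_part A0"
  have A0A: "A0 = Polynomial.smult (content A0) A" by (simp add: A_def)
  have cA: "content A = 1" using A0 by (simp add: A_def)
  have A: "A \<noteq> 0" "degree A = degree A0" "poly (map_poly of_int A) z = 0"
  proof -
    show "A \<noteq> 0" "degree A = degree A0" using A0 by (simp_all add: A_def)
    have "poly (map_poly of_int A0) z = of_int (content A0) * poly (map_poly of_int A) z"
      by (subst A0A) (simp add: hom_distribs)
    then show "poly (map_poly of_int A) z = 0" using A0 by simp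
  qed
  let ?\<Phi> = "Phi p r :: int poly"
  \<comment> \<open>Over the integers there is only pseudo-division; the factor \<open>a\<close> is
    removed afterwards by comparing contents, which is Gauss's lemma.\<close>
  obtain a q where aq: "a \<noteq> 0" "Polynomial.smult a ?\<Phi> = A * q + pseudo_mod ?\<Phi> A"
    using pseudo_mod(1)[OF A(1)] by blast
  have "pseudo_mod ?\<Phi> A = 0"
  proof (rule ccontr)
    assume nz: "pseudo_mod ?\<Phi> A \<noteq> 0"
    have "poly (map_poly of_int (pseudo_mod ?\<Phi> A)) z = 0"
      using arg_cong[OF aq(2), of "\<lambda>f. poly (map_poly of_int f) z"] A(3) z
      by (simp add: hom_distribs map_poly_Phi)
    then have "degree A0 \<le> degree (pseudo_mod ?\<Phi> A)" using min nz by blast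
    then show False using pseudo_mod(2)[OF A(1), of ?\<Phi>] nz A(2) by simp
  qed
  then have aq': "Polynomial.smult a ?\<Phi> = A * q" using aq by simp
  have c\<Phi>: "content ?\<Phi> = 1"
  proof -
    have "content ?\<Phi> dvd lead_coeff ?\<Phi>" by (rule content_dvd_coeff)
    then have "content ?\<Phi> dvd 1" using degree_Phi(2)[OF r0 p0, where 'b = int] by simp
    then show ?thesis by (metis is_unit_content_iff)
  qed
  have "content q = \<bar>a\<bar>"
    using arg_cong[OF aq', of content] cA c\<Phi> by (simp add: content_mult)
  then have q: "Polynomial.smult \<bar>a\<bar> (primitive_part q) = q" by (metis content_times_primitive_part)
  have "Polynomial.smult a (A * Polynomial.smult (sgn a) (primitive_part q)) =
      A * Polynomial.smult \<bar>a\<bar> (primitive_part q)"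
    by (simp add: abs_sgn)
  also have "\<dots> = Polynomial.smult a ?\<Phi>" unfolding q aq' ..
  finally have "?\<Phi> = A * Polynomial.smult (sgn a) (primitive_part q)"
    using aq(1) by (auto simp: poly_eq_iff simp del: mult_smult_right)
  then obtain B where B: "?\<Phi> = A * B" by blast
  have lead: "lead_coeff A * lead_coeff B = 1"
    using degree_Phi(2)[OF r0 p0, where 'b = int] by (simp add: B lead_coeff_mult)
  have pAB: "poly A 1 * poly B 1 = int p"
    using poly_Phi_1[of p r, where 'a = int] by (simp add: B)
  \<comment> \<open>Reduction modulo \<open>p\<close>. The leading coefficients of \<open>A\<close>
    and \<open>B\<close> are units, so degrees survive it.\<close>
  define h :: "int poly \<Rightarrow> 'a poly" where "h = map_poly of_int"
  have "h A * h B = h ?\<Phi>" unfolding B h_def by (simp only: hom_distribs)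
  then have hAB: "h A * h B = [:-1, 1:] ^ (r * (p - 1))"
    unfolding h_def map_poly_Phi Phi_prime_char[OF p r] .
  have dvd: "int p dvd poly C 1"
    if C: "h C dvd [:-1, 1:] ^ (r * (p - 1))" "lead_coeff C dvd 1" "degree C > 0" for C
  proof -
    have "of_int (lead_coeff C) \<noteq> (0::'a)" using C(2) by (rule of_int_unit_neq_0)
    then have "degree (h C) = degree C"
      unfolding h_def by (intro degree_map_poly) auto
    then have "poly (h C) 1 = 0" using degree_pos_dvd_linear_power[OF C(1)] C(3) by simp
    then have "of_int (poly C 1) = (0 :: 'a)"
      unfolding h_def by (metis of_int_hom.poly_map_poly of_int_1)
    then show ?thesis using p(1) by (simp add: of_int_eq_0_iff_char_dvd)
  qed
  have dA: "degree A > 0"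
  proof (rule ccontr)
    assume "\<not> degree A > 0"
    then obtain c where "A = [:c:]" by (metis degree_eq_zeroE gr0I)
    then show False using A by (simp add: map_poly_pCons)
  qed
  have "degree B = 0"
  proof (rule ccontr)
    assume "degree B \<noteq> 0"
    moreover have "h A dvd [:-1, 1:] ^ (r * (p - 1))" "h B dvd [:-1, 1:] ^ (r * (p - 1))"
      unfolding hAB[symmetric] by simp_all
    moreover have "lead_coeff A dvd 1" "lead_coeff B dvd 1" unfolding lead[symmetric] by simp_all
    ultimately have "int p dvd poly A 1" "int p dvd poly B 1"
      using dvd[of A] dvd[of B] dA by blast+
    then have "int p * int p dvd int p" using pAB by (metis mult_dvd_mono)
    then have "p * p dvd p" by (metis of_nat_dvd_iff of_nat_mult)
    then have "p * p \<le> p" using p0 by (rule dvd_imp_le)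
    then show False using prime_gt_1_nat[OF p(2)] by simp
  qed
  moreover have "B \<noteq> 0" using lead by auto
  ultimately have "degree A = r * (p - 1)"
    using degree_Phi(1)[OF r0 p0, where 'b = int] A(1) unfolding B by (simp add: degree_mult_eq)
  then show ?thesis using min[OF F] A(2) by simp
qed

lemma rat_poly_clear_denominators: "\<exists>N F. N \<noteq> 0 \<and> Polynomial.smult (of_int N) f = (map_poly of_int F :: rat poly)"
proof (induction f)
  case 0
  show ?case by (intro exI[of _ 1] exI[of _ 0]) simp
next
  case (pCons a f)
  then obtain N F where NF: "N \<noteq> 0" "Polynomial.smult (of_int N) f = (map_poly of_int F :: rat poly)" by auto
  obtain u v where a: "a = of_int u / of_int v" "v > 0" by (metis quotient_of_div quotient_of_denom_pos surj_pair)
  have "Polynomial.smult (of_int (N * v)) (pCons a f) =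
      pCons (of_int (N * u)) (Polynomial.smult (of_int v) (Polynomial.smult (of_int N) f))"
    using a by (simp add: mult.commute)
  also have "\<dots> = map_poly of_int (pCons (N * u) (Polynomial.smult v F))"
    by (simp add: NF(2) hom_distribs)
  finally show ?case using NF(1) a(2) by (intro exI[of _ "N * v"]) auto
qed

lemma degree_ge_of_Phi_root_rat:
  assumes "p = CHAR('a::field)" "prime p" "r = p ^ e" "poly (Phi p r) z = 0"
    and f: "f \<noteq> 0" "eval_rat z f = 0"
  shows "r * (p - 1) \<le> degree f"
proof -
  obtain N F where NF: "N \<noteq> 0" "Polynomial.smult (of_int N) f = (map_poly of_int F :: rat poly)"
    using rat_poly_clear_denominators by blast
  have deg: "degree F = degree f"
    using arg_cong[OF NF(2), of degree] NF(1) by simp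
  have "F \<noteq> 0" using NF f(1) by auto
  moreover have "poly (map_poly of_int F) z = 0"
  proof -
    have "poly (map_poly of_int F) z = eval_rat z (map_poly of_int F)"
      unfolding eval_rat_def by (subst map_poly_map_poly) (auto simp: o_def)
    also have "\<dots> = 0"
      unfolding NF(2)[symmetric] using f(2) by (simp add: eval_rat_def hom_distribs)
    finally show ?thesis .
  qed
  ultimately show ?thesis using degree_ge_of_Phi_root[OF assms(1-4)] deg by metis
qed

text \<open>With \<open>z = zeta (p * r)\<close> one has \<open>z ^ p = zeta r\<close>, so
  membership would give \<open>z = h (z ^ p)\<close> for a rational polynomial \<open>h\<close>.
  Reduced modulo \<open>Phi p s\<close>, where \<open>r = p * s\<close>, it has degree below
  \<open>s * (p - 1)\<close>; then \<open>X - h (X ^ p)\<close> is a nonzero annihilator of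
  \<open>z\<close> of degree below \<open>r * (p - 1)\<close>, which is too small.\<close>

lemma zeta_prime_power_notin:
  assumes p: "p = CHAR('a::field)" "prime p" and r: "r = p ^ e" "e > 0"
  shows "zeta (p * r) \<notin> cyclotomic_field r"
proof
  assume mem: "zeta (p * r) \<in> cyclotomic_field r"
  let ?z = "zeta (p * r)"
  define s where "s = p ^ (e - 1)"
  have rs: "r = p * s" using r by (cases e) (auto simp: s_def)
  have p1: "p > 1" and r0: "r > 0" and s0: "s > 0"
    using prime_gt_1_nat[OF p(2)] prime_gt_0_nat[OF p(2)] by (auto simp: r s_def)
  obtain h0 where h0: "?z = eval_rat (zeta r) h0"
    using cyclotomic_field_eval_rat[OF r0 mem] by blast
  have zp: "?z ^ p = zeta r" using p1 by (simp add: zeta_mult_power)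
  have Phi_zero: "poly (Phi p t) (zeta (p * t)) = 0" if "t > 0" for t
  proof -
    have "poly (Phi p t * (monom 1 t - 1)) (zeta (p * t)) = 0"
      using zeta_power_eq_1[of "p * t"] that p1 unfolding Phi_mult by (simp add: poly_monom mult.commute)
    moreover have "zeta (p * t) ^ t \<noteq> 1"
      using zeta_mult_power[of t p] zeta_neq_1[OF p1] that by (simp add: mult.commute)
    ultimately show ?thesis by (simp add: poly_monom)
  qed
  define h where "h = h0 mod Phi p s"
  have Phis: "eval_rat (zeta r) (Phi p s) = 0"
  proof -
    have "map_poly of_rat (Phi p s) = (Phi p s :: complex poly)"
      by (simp add: Phi_def hom_distribs)
    then show ?thesis using Phi_zero[OF s0] by (simp add: eval_rat_def rs)
  qed
  have "eval_rat (zeta r) h0 = eval_rat (zeta r) (h0 div Phi p s * Phi p s + h)"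
    by (simp only: h_def div_mult_mod_eq)
  also have "\<dots> = eval_rat (zeta r) h" by (simp only: eval_rat_add eval_rat_mult Phis) simp
  finally have h: "?z = eval_rat (zeta r) h" using h0 by simp
  have Phi_ne: "(Phi p s :: rat poly) \<noteq> 0" "degree (Phi p s :: rat poly) = s * (p - 1)"
    using degree_Phi[of s p, where 'b = rat] s0 p1 by auto
  have deg_h: "degree h < s * (p - 1)"
    using degree_mod_less'[of "Phi p s" h0] Phi_ne s0 p1 unfolding h_def
    by (cases "h0 mod Phi p s = 0") auto
  define f where "f = [:0, 1:] - pcompose h (monom 1 p)"
  have "eval_rat ?z f = 0"
    using h[symmetric] unfolding f_def
    by (simp add: eval_rat_def hom_distribs map_poly_pCons poly_pcompose poly_monom zp)
  moreover have "f \<noteq> 0"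
  proof -
    \<comment> \<open>Only exponents divisible by \<open>p\<close> occur in
      \<open>h (X ^ p)\<close>, so nothing cancels the linear term of \<open>f\<close>.\<close>
    have "\<not> p dvd i \<Longrightarrow> poly.coeff (pcompose h (monom 1 p)) i = 0" for i
    proof (induction h arbitrary: i)
      case (pCons a h)
      then have "\<not> p dvd i - p" if "\<not> i < p" using that by (simp add: dvd_minus_self)
      with pCons show ?case
        by (cases i) (auto simp: pcompose_pCons coeff_monom_mult)
    qed simp
    then have "poly.coeff (pcompose h (monom 1 p)) 1 = 0" using p1 by simp
    then have "poly.coeff f 1 = 1" by (simp add: f_def)
    then show ?thesis by auto
  qed
  ultimately have "r * (p - 1) \<le> degree f"
    using degree_ge_of_Phi_root_rat[OF p r(1) Phi_zero[OF r0]] by blast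
  moreover have "degree f < r * (p - 1)"
  proof -
    have "degree (pcompose h (monom 1 p)) = degree h * p"
      by (simp add: degree_pcompose degree_monom_eq)
    also have "\<dots> < s * (p - 1) * p" using deg_h p1 by simp
    finally have "degree (pcompose h (monom 1 p)) < r * (p - 1)" by (simp add: rs mult_ac)
    moreover have "1 < r * (p - 1)"
    proof -
      have "1 < p * s" using less_le_trans[OF p1, of "p * s"] s0 by simp
      also have "p * s \<le> r * (p - 1)" using p1 s0 by (simp add: rs)
      finally show ?thesis .
    qed
    ultimately show ?thesis
      unfolding f_def by (intro degree_diff_less) auto
  qed
  ultimately show False by simp
qed

section \<open>Monomial representations\<close>

text \<open>If some value differs from 1, translation by that element multiplies the sum by that
  value, so the sum vanishes; otherwise it is the number of elements.\<close>

lemma sum_multiplicative_nonneg: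
  fixes f :: "'g \<Rightarrow> complex"
  assumes G: "group G" and H: "H \<subseteq> carrier G" "finite H"
    and closed: "\<And>x y. x \<in> H \<Longrightarrow> y \<in> H \<Longrightarrow> x \<otimes>\<^bsub>G\<^esub> y \<in> H"
    and mult: "\<And>x y. x \<in> H \<Longrightarrow> y \<in> H \<Longrightarrow> f (x \<otimes>\<^bsub>G\<^esub> y) = f x * f y"
  shows "0 \<le> Re (sum f H)"
proof (cases "\<exists>a\<in>H. f a \<noteq> 1")
  case True
  then obtain a where a: "a \<in> H" "f a \<noteq> 1" by auto
  interpret group G by (rule G)
  have inj: "inj_on (\<lambda>x. a \<otimes>\<^bsub>G\<^esub> x) H"
    using a H by (intro inj_onI) (auto simp: subset_iff)
  have "(\<lambda>x. a \<otimes>\<^bsub>G\<^esub> x) ` H = H"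
    using a closed by (intro card_subset_eq) (auto simp: H card_image inj)
  then have "sum f H = (\<Sum>x\<in>H. f (a \<otimes>\<^bsub>G\<^esub> x))"
    using sum.reindex[OF inj, of f] by simp
  also have "\<dots> = f a * sum f H"
    using a mult by (simp add: sum_distrib_left)
  finally show ?thesis using a by simp
next
  case False
  then have "sum f H = of_nat (card H)" by simp
  then show ?thesis by simp
qed

text \<open>In a character sum over \<open>N\<close>, an element \<open>g \<notin> P\<close> is killed by the \<open>h \<in> N\<close> of the last assumption. Unlike in
  the general form of Mackey's criterion the elements \<open>h\<close> have to be in \<open>N\<close>.\<close>

locale mackey_pair = group G for G :: "('g, 'b) monoid_scheme" (structure) +
  fixes P N :: "'g set" and tau :: "'g \<Rightarrow> complex"
  assumes fin: "finite (carrier G)"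
    and P: "subgroup P G" and N: "subgroup N G" and NP: "N \<subseteq> P"
    and tau_mult: "x \<in> P \<Longrightarrow> y \<in> P \<Longrightarrow> tau (x \<otimes> y) = tau x * tau y"
    and tau_nz: "x \<in> P \<Longrightarrow> tau x \<noteq> 0"
    and mackey: "g \<in> carrier G \<Longrightarrow> g \<notin> P \<Longrightarrow>
      \<exists>h\<in>N. g \<otimes> h \<otimes> inv g \<in> P \<and> tau (g \<otimes> h \<otimes> inv g) \<noteq> tau h"
begin

section \<open>The representation induced from \<open>tau\<close>\<close>

definition tau0 :: "'g \<Rightarrow> complex" where
  "tau0 x = (if x \<in> P then tau x else 0)"

definition deg :: nat where "deg = card (rcosets P)"

definition rep :: "nat \<Rightarrow> 'g" where
  "rep = (SOME t. (\<forall>i<deg. t i \<in> carrier G) \<and>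
     (\<forall>g\<in>carrier G. \<exists>!i. i < deg \<and> g \<otimes> inv (t i) \<in> P))"

lemma P_sub: "x \<in> P \<Longrightarrow> x \<in> carrier G"
  using subgroup.mem_carrier[OF P] .

lemma P_mult: "x \<in> P \<Longrightarrow> y \<in> P \<Longrightarrow> x \<otimes> y \<in> P"
  using subgroup.m_closed[OF P] .

lemma P_inv: "x \<in> P \<Longrightarrow> inv x \<in> P"
  using subgroup.m_inv_closed[OF P] .

lemma P_one: "\<one> \<in> P"
  using subgroup.one_closed[OF P] .

lemma conj_mult:
  assumes "x \<in> carrier G" "y \<in> carrier G" "k \<in> carrier G" "g \<in> carrier G" "h \<in> carrier G"
  shows "(x \<otimes> g \<otimes> inv k) \<otimes> (k \<otimes> h \<otimes> inv y) = x \<otimes> (g \<otimes> h) \<otimes> inv y"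
proof -
  have "inv k \<otimes> (k \<otimes> z) = z" if "z \<in> carrier G" for z
    using that assms by (simp add: m_assoc[symmetric])
  then show ?thesis using assms by (simp add: m_assoc)
qed

lemma tau_one: "tau \<one> = 1"
  using tau_mult[OF P_one P_one] tau_nz[OF P_one] by simp

lemma P_mult_left_iff: "x \<in> P \<Longrightarrow> y \<in> carrier G \<Longrightarrow> x \<otimes> y \<in> P \<longleftrightarrow> y \<in> P"
  by (metis P_inv P_mult P_sub inv_closed inv_solve_left m_closed)

lemma P_mult_right_iff: "x \<in> P \<Longrightarrow> y \<in> carrier G \<Longrightarrow> y \<otimes> x \<in> P \<longleftrightarrow> y \<in> P"
  by (metis P_inv P_mult P_sub inv_closed inv_solve_right m_closed)

lemma tau0_mult_left: "x \<in> P \<Longrightarrow> y \<in> carrier G \<Longrightarrow> tau0 (x \<otimes> y) = tau x * tau0 y"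
  using P_mult_left_iff tau_mult by (auto simp: tau0_def)

lemma tau0_mult_right: "x \<in> P \<Longrightarrow> y \<in> carrier G \<Longrightarrow> tau0 (y \<otimes> x) = tau0 y * tau x"
  using P_mult_right_iff tau_mult by (auto simp: tau0_def)

lemma finite_rcosets: "finite (rcosets P)"
proof -
  have "rcosets P = (\<lambda>x. P #> x) ` carrier G" by (auto simp: RCOSETS_def)
  then show ?thesis using fin by simp
qed

lemma rep_exists:
  "\<exists>t. (\<forall>i<deg. t i \<in> carrier G) \<and> (\<forall>g\<in>carrier G. \<exists>!i. i < deg \<and> g \<otimes> inv (t i) \<in> P)"
proof -
  obtain h where h: "bij_betw h {0..<deg} (rcosets P)"
    using ex_bij_betw_nat_finite[OF finite_rcosets] unfolding deg_def by blast
  have "\<exists>x. x \<in> carrier G \<and> h i = P #> x" if "i < deg" for i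
  proof -
    have "h i \<in> rcosets P" using h that by (auto simp: bij_betw_def)
    then show ?thesis by (auto simp: RCOSETS_def)
  qed
  then obtain t where t: "\<And>i. i < deg \<Longrightarrow> t i \<in> carrier G \<and> h i = P #> t i" by metis
  have iff: "g \<otimes> inv (t i) \<in> P \<longleftrightarrow> h i = P #> g" if "g \<in> carrier G" "i < deg" for g i
    using that t[of i] subgroup.rcos_module[OF P, of "t i" g] repr_independence[of g P "t i"]
      rcos_self[of g P] P is_group by auto
  have "\<exists>!i. i < deg \<and> g \<otimes> inv (t i) \<in> P" if g: "g \<in> carrier G" for g
  proof -
    have "P #> g \<in> rcosets P" using g P_sub by (intro rcosetsI) auto
    then obtain i where i: "i < deg" "h i = P #> g"
      using h unfolding bij_betw_def by (metis atLeastLessThan_iff imageE)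
    have "k = i" if "k < deg" "h k = P #> g" for k
      using h i that inj_onD[of h "{0..<deg}" k i] by (simp add: bij_betw_def)
    with i show ?thesis using iff[OF g] by (intro ex1I[of _ i]) blast+
  qed
  then show ?thesis using t by (intro exI[of _ t] conjI allI ballI impI) blast+
qed

lemma rep_closed: "i < deg \<Longrightarrow> rep i \<in> carrier G"
  and rep_unique: "g \<in> carrier G \<Longrightarrow> \<exists>!i. i < deg \<and> g \<otimes> inv (rep i) \<in> P"
  using someI_ex[OF rep_exists] unfolding rep_def[symmetric] by auto

text \<open>The index of the coset \<open>P\<close> itself. Its representative is known to lie in
  \<open>P\<close> but not to be the identity, which is the source of the factors
  \<open>tau (rep base)\<close> below.\<close>

definition base :: nat where "base = (THE i. i < deg \<and> \<one> \<otimes> inv (rep i) \<in> P)"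

lemma base: "base < deg" "rep base \<in> P"
proof -
  have *: "base < deg \<and> \<one> \<otimes> inv (rep base) \<in> P"
    unfolding base_def by (rule theI') (rule rep_unique, simp)
  then show "base < deg" by simp
  have "inv (rep base) \<in> P" using * l_one[of "inv (rep base)"] rep_closed[of base] by simp
  then have "inv (inv (rep base)) \<in> P" by (rule P_inv)
  then show "rep base \<in> P" using * rep_closed[of base] by simp
qed

lemma rep_in_P_iff: "i < deg \<Longrightarrow> rep i \<in> P \<longleftrightarrow> i = base"
proof
  assume i: "i < deg" "rep i \<in> P"
  then have "\<one> \<otimes> inv (rep i) \<in> P" "\<one> \<otimes> inv (rep base) \<in> P"
    using P_inv rep_closed base by auto
  then show "i = base" using rep_unique[OF one_closed] i base by blast
qed (use base in auto)

text \<open>The element \<open>rep i \<otimes> g\<close> lies in exactly one right coset of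
  \<open>P\<close>, so a single \<open>k\<close> contributes. The identity gives the
  multiplicativity of \<open>rho\<close> and also splits the values of \<open>psi\<close> at
  products.\<close>

lemma tau0_compose:
  assumes "i < deg" "j < deg" "g \<in> carrier G" "h \<in> carrier G"
  shows "(\<Sum>k<deg. tau0 (rep i \<otimes> g \<otimes> inv (rep k)) * tau0 (rep k \<otimes> h \<otimes> inv (rep j)))
    = tau0 (rep i \<otimes> (g \<otimes> h) \<otimes> inv (rep j))"
proof -
  have c: "rep i \<otimes> g \<in> carrier G" using assms rep_closed by simp
  obtain k where k: "k < deg" "rep i \<otimes> g \<otimes> inv (rep k) \<in> P"
    and u: "\<And>l. l < deg \<Longrightarrow> rep i \<otimes> g \<otimes> inv (rep l) \<in> P \<Longrightarrow> l = k"
    using rep_unique[OF c] by blast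
  have "(\<Sum>k<deg. tau0 (rep i \<otimes> g \<otimes> inv (rep k)) * tau0 (rep k \<otimes> h \<otimes> inv (rep j)))
    = (\<Sum>l\<in>{k}. tau0 (rep i \<otimes> g \<otimes> inv (rep l)) * tau0 (rep l \<otimes> h \<otimes> inv (rep j)))"
    using k(1) by (intro sum.mono_neutral_right) (auto simp: tau0_def dest: u)
  also have "\<dots> = tau0 ((rep i \<otimes> g \<otimes> inv (rep k)) \<otimes> (rep k \<otimes> h \<otimes> inv (rep j)))"
    using k assms rep_closed by (subst tau0_mult_left) (auto simp: tau0_def)
  also have "(rep i \<otimes> g \<otimes> inv (rep k)) \<otimes> (rep k \<otimes> h \<otimes> inv (rep j))
      = rep i \<otimes> (g \<otimes> h) \<otimes> inv (rep j)"
    using k assms rep_closed by (simp add: conj_mult)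
  finally show ?thesis .
qed

definition rho :: "'g \<Rightarrow> complex mat" where
  "rho g = mat deg deg (\<lambda>(i, j). tau0 (rep i \<otimes> g \<otimes> inv (rep j)))"

definition psi :: "'g \<Rightarrow> complex" where
  "psi = (\<lambda>g\<in>carrier G. \<Sum>i<deg. tau0 (rep i \<otimes> g \<otimes> inv (rep i)))"

lemma rho_carrier[simp]: "rho g \<in> carrier_mat deg deg"
  by (simp add: rho_def)

lemma rho_mult: "g \<in> carrier G \<Longrightarrow> h \<in> carrier G \<Longrightarrow> rho (g \<otimes> h) = rho g * rho h"
  unfolding rho_def
  by (intro eq_matI) (auto simp: scalar_prod_def tau0_compose atLeast0LessThan)

lemma tau0_rep_one: "i < deg \<Longrightarrow> j < deg \<Longrightarrow> tau0 (rep i \<otimes> \<one> \<otimes> inv (rep j)) = (if i = j then 1 else 0)"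
proof -
  assume ij: "i < deg" "j < deg"
  have "rep i \<otimes> inv (rep i) \<in> P" using ij rep_closed P_one by simp
  then have "rep i \<otimes> inv (rep j) \<in> P \<longleftrightarrow> i = j"
    using rep_unique[OF rep_closed[OF ij(1)]] ij by blast
  then show ?thesis using ij rep_closed tau_one by (auto simp: tau0_def)
qed

lemma rho_one: "rho \<one> = 1\<^sub>m deg"
  unfolding rho_def by (rule eq_matI) (use tau0_rep_one in auto)

lemma representation_rho: "representation G deg rho"
proof -
  have "rho g \<in> Units (ring_mat TYPE(complex) deg ())" if "g \<in> carrier G" for g
    using that rho_mult[of g "inv g"] rho_mult[of "inv g" g]
    by (auto simp: Units_def ring_mat_simps rho_one intro!: bexI[of _ "rho (inv g)"])
  then show ?thesis
    by (auto simp: representation_def general_linear_def hom_def units_of_def ring_mat_simps rho_mult)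
qed

text \<open>The matrix of the (unnormalised) projection onto the \<open>tau\<close>-isotypic part for \<open>N\<close>; it has rank one.\<close>

definition ecoef :: "nat \<Rightarrow> nat \<Rightarrow> complex" where
  "ecoef i j = (\<Sum>h\<in>N. inverse (tau h) * tau0 (rep i \<otimes> h \<otimes> inv (rep j)))"

lemma N_sub: "x \<in> N \<Longrightarrow> x \<in> carrier G"
  using NP P_sub by auto

lemma N_fin: "finite N"
  using fin N_sub by (meson finite_subset subsetI)

lemma N_card: "card N \<noteq> 0"
  using N_fin subgroup.one_closed[OF N] by auto

text \<open>In a column \<open>j\<close> other than \<open>base\<close>, the Mackey condition at
  \<open>rep j\<close> provides an \<open>h0\<close> in \<open>N\<close>; replacing \<open>h\<close>
  by \<open>h \<otimes> h0\<close> multiplies the sum by a factor different from 1, so it vanishes.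
  In column \<open>base\<close> all terms vanish unless the row is \<open>base\<close> as well, and
  there each of them equals 1.\<close>

lemma ecoef_eq:
  assumes "i < deg" "j < deg"
  shows "ecoef i j = (if i = base \<and> j = base then of_nat (card N) else 0)"
proof (cases "j = base")
  case False
  then have "rep j \<notin> P" using assms by (simp add: rep_in_P_iff)
  then obtain h0 where h0: "h0 \<in> N" "rep j \<otimes> h0 \<otimes> inv (rep j) \<in> P"
      "tau (rep j \<otimes> h0 \<otimes> inv (rep j)) \<noteq> tau h0"
    using mackey[OF rep_closed[OF assms(2)]] by blast
  have inj: "inj_on (\<lambda>h. h \<otimes> h0) N"
    using h0 N_sub by (intro inj_onI) auto
  have im: "(\<lambda>h. h \<otimes> h0) ` N = N"
    using h0 subgroup.m_closed[OF N] by (intro card_subset_eq) (auto simp: N_fin card_image inj)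
  have "ecoef i j = (\<Sum>h\<in>N. inverse (tau (h \<otimes> h0)) * tau0 (rep i \<otimes> (h \<otimes> h0) \<otimes> inv (rep j)))"
    unfolding ecoef_def
    using sum.reindex[OF inj, of "\<lambda>h. inverse (tau h) * tau0 (rep i \<otimes> h \<otimes> inv (rep j))"] im
    by simp
  also have "\<dots> = (\<Sum>h\<in>N. inverse (tau h0) * tau (rep j \<otimes> h0 \<otimes> inv (rep j)) *
      (inverse (tau h) * tau0 (rep i \<otimes> h \<otimes> inv (rep j))))"
  proof (rule sum.cong[OF refl])
    fix h assume h: "h \<in> N"
    have "rep i \<otimes> (h \<otimes> h0) \<otimes> inv (rep j) =
        (rep i \<otimes> h \<otimes> inv (rep j)) \<otimes> (rep j \<otimes> h0 \<otimes> inv (rep j))"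
      using h h0 assms rep_closed N_sub
      by (simp add: conj_mult)
    then have "tau0 (rep i \<otimes> (h \<otimes> h0) \<otimes> inv (rep j)) =
        tau0 (rep i \<otimes> h \<otimes> inv (rep j)) * tau (rep j \<otimes> h0 \<otimes> inv (rep j))"
      using h h0 assms rep_closed N_sub by (simp add: tau0_mult_right)
    then show "inverse (tau (h \<otimes> h0)) * tau0 (rep i \<otimes> (h \<otimes> h0) \<otimes> inv (rep j)) =
        inverse (tau h0) * tau (rep j \<otimes> h0 \<otimes> inv (rep j)) *
        (inverse (tau h) * tau0 (rep i \<otimes> h \<otimes> inv (rep j)))"
      using h h0 NP by (simp add: tau_mult subset_iff)
  qed
  also have "\<dots> = inverse (tau h0) * tau (rep j \<otimes> h0 \<otimes> inv (rep j)) * ecoef i j"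
    unfolding ecoef_def by (simp add: sum_distrib_left)
  finally have "(1 - inverse (tau h0) * tau (rep j \<otimes> h0 \<otimes> inv (rep j))) * ecoef i j = 0"
    by (simp add: algebra_simps)
  moreover have "inverse (tau h0) * tau (rep j \<otimes> h0 \<otimes> inv (rep j)) \<noteq> 1"
    using h0 tau_nz[of h0] NP by (auto simp: field_simps)
  ultimately show ?thesis using False by auto
next
  case j: True
  show ?thesis
  proof (cases "i = base")
    case False
    then have i: "rep i \<notin> P" using assms by (simp add: rep_in_P_iff)
    have "rep i \<otimes> h \<otimes> inv (rep j) \<notin> P" if "h \<in> N" for h
      using that i j base P_inv NP P_mult_right_iff assms rep_closed N_sub
      by (metis (no_types, lifting) m_closed subsetD)
    then show ?thesis using False by (simp add: ecoef_def tau0_def)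
  next
    case True
    have "tau0 (rep i \<otimes> h \<otimes> inv (rep j)) = tau h" if h: "h \<in> N" for h
    proof -
      have hP: "h \<in> P" using h NP by auto
      have "tau0 (rep i \<otimes> h \<otimes> inv (rep j)) = tau (rep i) * tau h * tau (inv (rep j))"
        using hP True j base P_inv P_mult by (simp add: tau0_def tau_mult)
      also have "\<dots> = tau h * tau (rep j \<otimes> inv (rep j))"
        using True j base P_inv by (simp add: tau_mult)
      finally show ?thesis using base j tau_one P_sub by simp
    qed
    then show ?thesis using True j tau_nz NP by (simp add: ecoef_def subset_iff)
  qed
qed

text \<open>The left side is the trace of the unnormalised rank one projection times
  \<open>rho x\<close>, hence \<open>card N\<close> times the diagonal entry of \<open>rho x\<close>
  at \<open>base\<close>. It recovers \<open>tau x\<close> from values of \<open>psi\<close> and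
  from \<open>tau\<close> on \<open>N\<close>.\<close>

lemma psi_twisted_sum:
  assumes x: "x \<in> P"
  shows "(\<Sum>h\<in>N. inverse (tau h) * psi (h \<otimes> x)) = of_nat (card N) * tau x"
proof -
  have xG: "x \<in> carrier G" using x P_sub by auto
  have "(\<Sum>h\<in>N. inverse (tau h) * psi (h \<otimes> x)) =
     (\<Sum>h\<in>N. \<Sum>i<deg. \<Sum>k<deg. inverse (tau h) * tau0 (rep i \<otimes> h \<otimes> inv (rep k)) *
        tau0 (rep k \<otimes> x \<otimes> inv (rep i)))"
    using xG N_sub by (intro sum.cong refl)
      (simp add: psi_def sum_distrib_left mult.assoc flip: tau0_compose)
  also have "\<dots> = (\<Sum>i<deg. \<Sum>k<deg. ecoef i k * tau0 (rep k \<otimes> x \<otimes> inv (rep i)))"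
    unfolding ecoef_def sum_distrib_right
    by (subst sum.swap, intro sum.cong refl, subst sum.swap, rule refl)
  also have "\<dots> = (\<Sum>i<deg. \<Sum>k<deg. if i = base then if k = base then of_nat (card N) * tau0 (rep k \<otimes> x \<otimes> inv (rep i)) else 0 else 0)"
    by (intro sum.cong refl) (auto simp: ecoef_eq)
  also have "\<dots> = (\<Sum>i<deg. if i = base then of_nat (card N) * tau0 (rep base \<otimes> x \<otimes> inv (rep i)) else 0)"
    using base by (intro sum.cong refl) auto
  also have "\<dots> = of_nat (card N) * tau0 (rep base \<otimes> x \<otimes> inv (rep base))"
    using base by simp
  also have "tau0 (rep base \<otimes> x \<otimes> inv (rep base)) = tau x"
  proof -
    have "tau0 (rep base \<otimes> x \<otimes> inv (rep base)) = tau x * (tau (rep base) * tau (inv (rep base)))"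
      using x base P_inv P_mult by (simp add: tau0_def tau_mult)
    also have "tau (rep base) * tau (inv (rep base)) = tau (rep base \<otimes> inv (rep base))"
      using base P_inv by (simp add: tau_mult)
    finally show ?thesis using base tau_one P_sub by simp
  qed
  finally show ?thesis .
qed

lemma psi_one: "psi \<one> = of_nat deg"
  by (simp add: psi_def tau0_rep_one)

lemma psi_range:
  assumes "\<And>x. x \<in> P \<Longrightarrow> tau x \<in> K" "0 \<in> K" "\<And>x y. x \<in> K \<Longrightarrow> y \<in> K \<Longrightarrow> x + y \<in> K"
  shows "psi ` carrier G \<subseteq> K"
proof -
  have "(\<Sum>i<m. tau0 (f i)) \<in> K" for m :: nat and f
    by (induction m) (auto simp: tau0_def assms)
  then show ?thesis by (auto simp: psi_def)
qed

text \<open>A nonzero vector of an invariant subspace is moved so that its \<open>base\<close>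
  coordinate is nonzero; the projection for \<open>N\<close> turns it into a nonzero multiple of the
  unit vector at \<open>base\<close>, whose translates span everything.\<close>

lemma irreducible_rho: "irreducible_representation G deg rho"
proof -
  have "W = {0\<^sub>v deg} \<or> W = carrier_vec deg"
    if W: "VectorSpace.subspace class_ring W (module_vec TYPE(complex) deg)"
      and inv: "\<forall>g\<in>carrier G. \<forall>w\<in>W. rho g *\<^sub>v w \<in> W" for W
  proof -
    from W have sm: "submodule class_ring W (module_vec TYPE(complex) deg)"
      by (simp add: VectorSpace.subspace_def)
    have W0: "0\<^sub>v deg \<in> W" and Wc: "W \<subseteq> carrier_vec deg"
      and Wadd: "\<And>v w. v \<in> W \<Longrightarrow> w \<in> W \<Longrightarrow> v + w \<in> W"
      and Wsm: "\<And>c v. v \<in> W \<Longrightarrow> c \<cdot>\<^sub>v v \<in> W"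
      using submodule.zero_closed[OF sm] submodule.subset[OF sm] submodule.m_closed[OF sm]
        submodule.smult_closed[OF sm] by (auto simp: module_vec_simps)
    have Wsum: "vec deg (\<lambda>i. \<Sum>x\<in>A. f x * (v x $ i)) \<in> W"
      if "finite A" "\<And>x. x \<in> A \<Longrightarrow> v x \<in> W" for A :: "'x set" and f v
      using that
    proof (induction A rule: finite_induct)
      case empty
      have "vec deg (\<lambda>i. 0 :: complex) = 0\<^sub>v deg" by auto
      then show ?case using W0 by simp
    next
      case (insert x A)
      have "vec deg (\<lambda>i. \<Sum>x\<in>insert x A. f x * (v x $ i)) =
          f x \<cdot>\<^sub>v v x + vec deg (\<lambda>i. \<Sum>x\<in>A. f x * (v x $ i))"
        using insert.hyps carrier_vecD[OF subsetD[OF Wc insert.prems[of x]]]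
        by (intro eq_vecI) auto
      then show ?case using insert Wadd Wsm by auto
    qed
    show ?thesis
    proof (cases "W = {0\<^sub>v deg}")
      case False
      then obtain w where w: "w \<in> W" "w \<noteq> 0\<^sub>v deg" using W0 by blast
      have wc: "w \<in> carrier_vec deg" using w Wc by auto
      obtain a where a: "a < deg" "w $ a \<noteq> 0"
        using w wc by (metis eq_vecI carrier_vecD index_zero_vec)
      \<comment> \<open>Row \<open>base\<close> of \<open>rho (rep a)\<close> has its only nonzero
        entry in column \<open>a\<close>, so the nonzero coordinate of \<open>w\<close> is carried
        to \<open>base\<close>.\<close>
      define w' where "w' = rho (rep a) *\<^sub>v w"
      have w': "w' \<in> W" using inv w rep_closed[OF a(1)] by (simp add: w'_def)
      have w'c: "w' \<in> carrier_vec deg" using w' Wc by auto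
      have "tau0 (rep base \<otimes> rep a \<otimes> inv (rep j)) = (if j = a then tau (rep base) else 0)"
        if j: "j < deg" for j
      proof -
        have "tau0 (rep base \<otimes> rep a \<otimes> inv (rep j)) = tau (rep base) * tau0 (rep a \<otimes> inv (rep j))"
          using j a base rep_closed by (subst tau0_mult_left[symmetric]) (auto simp: m_assoc)
        also have "tau0 (rep a \<otimes> inv (rep j)) = (if a = j then 1 else 0)"
          using tau0_rep_one[OF a(1) j] rep_closed a j by simp
        finally show ?thesis by auto
      qed
      note row = this
      have "w' $ base = (\<Sum>j<deg. tau0 (rep base \<otimes> rep a \<otimes> inv (rep j)) * w $ j)"
        using base wc by (simp add: w'_def rho_def scalar_prod_def atLeast0LessThan)
      also have "\<dots> = (\<Sum>j<deg. if j = a then tau (rep base) * w $ j else 0)"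
        by (rule sum.cong) (auto simp: row)
      finally have w'base: "w' $ base \<noteq> 0"
        using a base tau_nz by simp
      have ub: "unit_vec deg base \<in> W"
      proof -
        have "vec deg (\<lambda>i. \<Sum>h\<in>N. inverse (tau h) * ((rho h *\<^sub>v w') $ i)) \<in> W"
          using inv w' N_sub by (intro Wsum N_fin) auto
        moreover have "vec deg (\<lambda>i. \<Sum>h\<in>N. inverse (tau h) * ((rho h *\<^sub>v w') $ i)) =
            (of_nat (card N) * w' $ base) \<cdot>\<^sub>v unit_vec deg base"
        proof (rule eq_vecI, simp_all)
          fix i assume i: "i < deg"
          have "(\<Sum>h\<in>N. inverse (tau h) * ((rho h *\<^sub>v w') $ i)) = (\<Sum>j<deg. ecoef i j * w' $ j)"
            using i w'c unfolding ecoef_def sum_distrib_right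
            by (subst sum.swap) (auto simp: rho_def scalar_prod_def atLeast0LessThan
                sum_distrib_left mult.assoc intro!: sum.cong)
          also have "\<dots> = (\<Sum>j<deg. if j = base then (if i = base then of_nat (card N) else 0) * w' $ j else 0)"
            using i by (intro sum.cong) (auto simp: ecoef_eq)
          also have "\<dots> = (if i = base then of_nat (card N) else 0) * w' $ base"
            using base by simp
          finally show "(\<Sum>h\<in>N. inverse (tau h) * ((rho h *\<^sub>v w') $ i)) =
              of_nat (card N) * w' $ base * unit_vec deg base $ i"
            using i base by (simp add: unit_vec_def)
        qed
        ultimately have "(1 / (of_nat (card N) * w' $ base)) \<cdot>\<^sub>v
            ((of_nat (card N) * w' $ base) \<cdot>\<^sub>v unit_vec deg base) \<in> W"
          using Wsm by simp
        then show ?thesis using w'base N_card by (simp add: smult_smult_assoc)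
      qed
      have unit: "unit_vec deg k \<in> W" if k: "k < deg" for k
      proof -
        have "rho (inv (rep k)) *\<^sub>v unit_vec deg base \<in> W"
          using inv ub k rep_closed by simp
        moreover have "rho (inv (rep k)) *\<^sub>v unit_vec deg base =
            tau (inv (rep base)) \<cdot>\<^sub>v unit_vec deg k"
        proof (rule eq_vecI)
          fix i assume "i < dim_vec (tau (inv (rep base)) \<cdot>\<^sub>v unit_vec deg k)"
          then have i: "i < deg" by simp
          have "(rho (inv (rep k)) *\<^sub>v unit_vec deg base) $ i =
              tau0 (rep i \<otimes> inv (rep k) \<otimes> inv (rep base))"
            using i base(1) by (simp add: rho_def)
          also have "\<dots> = tau0 (rep i \<otimes> inv (rep k)) * tau (inv (rep base))"
            using i k base P_inv rep_closed by (subst tau0_mult_right) auto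
          also have "tau0 (rep i \<otimes> inv (rep k)) = (if i = k then 1 else 0)"
            using tau0_rep_one[OF i k] rep_closed i k by simp
          finally show "(rho (inv (rep k)) *\<^sub>v unit_vec deg base) $ i =
              (tau (inv (rep base)) \<cdot>\<^sub>v unit_vec deg k) $ i"
            using i k by simp
        qed (simp add: rho_def)
        ultimately have "inverse (tau (inv (rep base))) \<cdot>\<^sub>v
            (tau (inv (rep base)) \<cdot>\<^sub>v unit_vec deg k) \<in> W"
          using Wsm by simp
        then show ?thesis using base P_inv tau_nz by (simp add: smult_smult_assoc)
      qed
      have "v \<in> W" if v: "v \<in> carrier_vec deg" for v
      proof -
        have "vec deg (\<lambda>i. \<Sum>k<deg. v $ k * (unit_vec deg k $ i)) \<in> W"
          using unit by (intro Wsum) auto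
        moreover have "vec deg (\<lambda>i. \<Sum>k<deg. v $ k * (unit_vec deg k $ i)) = v"
        proof (rule eq_vecI)
          fix i assume i: "i < dim_vec v"
          have "(\<Sum>k<deg. v $ k * (unit_vec deg k $ i)) = (\<Sum>k<deg. if k = i then v $ k else 0)"
            using i v by (intro sum.cong) (auto simp: unit_vec_def)
          then show "vec deg (\<lambda>i. \<Sum>k<deg. v $ k * (unit_vec deg k $ i)) $ i = v $ i"
            using i v by auto
        qed (use v in auto)
        ultimately show ?thesis by simp
      qed
      then show ?thesis using Wc by auto
    qed auto
  qed
  then show ?thesis
    using representation_rho base(1) unfolding irreducible_representation_def by auto
qed

lemma irreducible_character_psi: "irreducible_character G psi"
proof -
  have "psi = (\<lambda>g\<in>carrier G. mat_trace (rho g))"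
    by (auto simp: psi_def mat_trace_def rho_def)
  then show ?thesis using irreducible_rho unfolding irreducible_character_def by blast
qed

text \<open>\<open>chi\<close> is a positive multiple of a sum of functions that are multiplicative
  on the sets \<open>L x\<close> and zero elsewhere; \<open>psi\<close> is a sum of conjugates of
  \<open>tau\<close> extended by zero. The inner product thus splits into sums of multiplicative
  functions over closed sets, each with nonnegative real part. The one for \<open>m\<close> and
  \<open>base\<close> is positive because \<open>nu m\<close> and \<open>tau\<close> agree
  there.\<close>

lemma character_inner_nonzero:
  fixes Q :: "'x set" and L :: "'x \<Rightarrow> 'g set" and nu :: "'x \<Rightarrow> 'g \<Rightarrow> complex" and c :: real
  assumes Q: "finite Q" "m \<in> Q" and c: "c > 0"
    and L: "\<And>x. x \<in> Q \<Longrightarrow> L x \<subseteq> carrier G" "\<one> \<in> L m"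
    and L_mult: "\<And>x g h. x \<in> Q \<Longrightarrow> g \<in> L x \<Longrightarrow> h \<in> L x \<Longrightarrow> g \<otimes> h \<in> L x"
    and nu_mult: "\<And>x g h. x \<in> Q \<Longrightarrow> g \<in> L x \<Longrightarrow> h \<in> L x \<Longrightarrow> nu x (g \<otimes> h) = nu x g * nu x h"
    and agree: "\<And>g. g \<in> L m \<Longrightarrow> g \<in> P \<Longrightarrow> nu m g = tau g"
    and chi: "\<And>g. g \<in> carrier G \<Longrightarrow> chi g = of_real c * (\<Sum>x\<in>Q. if g \<in> L x then nu x g else 0)"
  shows "character_inner G chi psi \<noteq> 0"
proof -
  define H where "H x i = {g \<in> L x. rep i \<otimes> g \<otimes> inv (rep i) \<in> P}" for x i
  define F where "F x i g = nu x g * cnj (tau (rep i \<otimes> g \<otimes> inv (rep i)))" for x i g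
  have Hc: "H x i \<subseteq> carrier G" if "x \<in> Q" for x i using L(1)[OF that] by (auto simp: H_def)
  have conj: "rep i \<otimes> (g \<otimes> h) \<otimes> inv (rep i) =
      (rep i \<otimes> g \<otimes> inv (rep i)) \<otimes> (rep i \<otimes> h \<otimes> inv (rep i))"
    if "i < deg" "g \<in> carrier G" "h \<in> carrier G" for i g h
    using that rep_closed by (simp add: conj_mult)
  have nonneg: "0 \<le> Re (\<Sum>g\<in>H x i. F x i g)" if x: "x \<in> Q" and i: "i < deg" for x i
  proof (rule sum_multiplicative_nonneg[OF is_group Hc[OF x]])
    show "finite (H x i)" using Hc[OF x] fin by (rule finite_subset)
    fix g h assume gh: "g \<in> H x i" "h \<in> H x i"
    then have gc: "g \<in> carrier G" "h \<in> carrier G" using Hc[OF x] by auto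
    show "g \<otimes> h \<in> H x i"
      using gh L_mult[OF x] conj[OF i gc] P_mult by (auto simp: H_def)
    show "F x i (g \<otimes> h) = F x i g * F x i h"
      using gh nu_mult[OF x] conj[OF i gc] tau_mult by (auto simp: F_def H_def)
  qed
  have H_base: "H m base = L m \<inter> P"
    using base P_mult_left_iff P_mult_right_iff P_inv L(1)[OF Q(2)] P_sub
    by (auto simp: H_def subset_iff)
  have pos: "0 < Re (\<Sum>g\<in>H m base. F m base g)"
  proof -
    have "F m base g = of_real ((cmod (tau g))\<^sup>2)" if g: "g \<in> H m base" for g
    proof -
      have g: "g \<in> L m" "g \<in> P" using g H_base by auto
      have "tau (rep base \<otimes> g \<otimes> inv (rep base)) = tau g * (tau (rep base) * tau (inv (rep base)))"
        using g base P_inv P_mult by (simp add: tau_mult)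
      also have "tau (rep base) * tau (inv (rep base)) = 1"
        using base P_inv P_sub tau_one by (simp flip: tau_mult)
      finally show ?thesis using agree[OF g] by (simp add: F_def complex_norm_square[symmetric])
    qed
    then have "(\<Sum>g\<in>H m base. F m base g) = of_real (\<Sum>g\<in>H m base. (cmod (tau g))\<^sup>2)"
      by simp
    moreover have "0 < (\<Sum>g\<in>H m base. (cmod (tau g))\<^sup>2)"
    proof (rule sum_pos)
      show "finite (H m base)" using Hc[OF Q(2)] fin by (rule finite_subset)
      show "H m base \<noteq> {}" using H_base L(2) P_one by auto
      show "\<And>g. g \<in> H m base \<Longrightarrow> 0 < (cmod (tau g))\<^sup>2" using H_base tau_nz by simp
    qed
    ultimately show ?thesis by simp
  qed
  have restr: "(\<Sum>g\<in>carrier G. if g \<in> H x i then F x i g else 0) = (\<Sum>g\<in>H x i. F x i g)"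
    if "x \<in> Q" for x i
    using Hc[OF that, of i] fin by (simp add: sum.inter_restrict[symmetric] Int_absorb1)
  have "(\<Sum>g\<in>carrier G. chi g * cnj (psi g)) =
     (\<Sum>g\<in>carrier G. of_real c * (\<Sum>x\<in>Q. \<Sum>i<deg. if g \<in> H x i then F x i g else 0))"
    by (intro sum.cong refl)
      (auto simp: chi psi_def tau0_def H_def F_def sum_product cnj_sum if_distrib[of cnj]
        mult.assoc intro!: arg_cong[of _ _ "(*) (of_real c)"] sum.cong)
  also have "\<dots> = of_real c * (\<Sum>x\<in>Q. \<Sum>i<deg. \<Sum>g\<in>carrier G. if g \<in> H x i then F x i g else 0)"
    unfolding sum_distrib_left[symmetric]
    by (subst sum.swap, intro arg_cong[of _ _ "(*) _"] sum.cong refl, subst sum.swap, rule refl)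
  also have "\<dots> = of_real c * (\<Sum>x\<in>Q. \<Sum>i<deg. \<Sum>g\<in>H x i. F x i g)"
    by (simp add: restr)
  finally have eq: "Re (\<Sum>g\<in>carrier G. chi g * cnj (psi g)) =
     c * (\<Sum>x\<in>Q. \<Sum>i<deg. Re (\<Sum>g\<in>H x i. F x i g))"
    by simp
  have "0 < (\<Sum>i<deg. Re (\<Sum>g\<in>H m i. F m i g))"
    using pos base nonneg[OF Q(2)] by (intro sum_pos2[where i = base]) auto
  then have "0 < (\<Sum>x\<in>Q. \<Sum>i<deg. Re (\<Sum>g\<in>H x i. F x i g))"
    using Q nonneg by (intro sum_pos2[where i = m] sum_nonneg) (simp_all del: Re_sum)
  then have "0 < Re (\<Sum>g\<in>carrier G. chi g * cnj (psi g))"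
    unfolding eq by (intro mult_pos_pos[OF c])
  then have "(\<Sum>g\<in>carrier G. chi g * cnj (psi g)) \<noteq> 0" by force
  moreover have "card (carrier G) \<noteq> 0" using fin one_closed by (metis card_0_eq empty_iff)
  ultimately show ?thesis by (simp add: character_inner_def)
qed

end

section \<open>Unitriangular groups\<close>

lemma strictly_upper_carrier: "X \<in> strictly_upper n \<Longrightarrow> X \<in> carrier_mat n n"
  by (simp add: strictly_upper_def)

lemma strictly_upper_add: "X \<in> strictly_upper n \<Longrightarrow> Y \<in> strictly_upper n \<Longrightarrow> X + Y \<in> strictly_upper n"
  by (auto simp: strictly_upper_def)

lemma strictly_upper_smult: "X \<in> strictly_upper n \<Longrightarrow> c \<cdot>\<^sub>m X \<in> strictly_upper n"
  by (auto simp: strictly_upper_def)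

lemma strictly_upper_zero: "0\<^sub>m n n \<in> strictly_upper n"
  by (auto simp: strictly_upper_def)

lemma mat_mult_entry:
  assumes "A \<in> carrier_mat n n" "B \<in> carrier_mat n n" "i < n" "j < n"
  shows "(A * B) $$ (i, j) = (\<Sum>k<n. A $$ (i, k) * B $$ (k, j))"
  using assms by (simp add: scalar_prod_def atLeast0LessThan)

lemma UT_iff:
  "g \<in> carrier (UT n) \<longleftrightarrow> g \<in> carrier_mat n n \<and> (\<forall>i<n. g $$ (i, i) = 1) \<and> (\<forall>i<n. \<forall>j<i. g $$ (i, j) = 0)"
proof
  assume "g \<in> carrier (UT n)"
  then obtain X where X: "X \<in> strictly_upper n" "g = 1\<^sub>m n + X" by (auto simp: UT_def)
  then show "g \<in> carrier_mat n n \<and> (\<forall>i<n. g $$ (i, i) = 1) \<and> (\<forall>i<n. \<forall>j<i. g $$ (i, j) = 0)"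
    by (auto simp: strictly_upper_def)
next
  assume *: "g \<in> carrier_mat n n \<and> (\<forall>i<n. g $$ (i, i) = 1) \<and> (\<forall>i<n. \<forall>j<i. g $$ (i, j) = 0)"
  then have "g - 1\<^sub>m n \<in> strictly_upper n" by (auto simp: strictly_upper_def le_less)
  moreover have "g = 1\<^sub>m n + (g - 1\<^sub>m n)" using * by (intro eq_matI) auto
  ultimately show "g \<in> carrier (UT n)" unfolding UT_def by auto
qed

lemma UT_mult[simp]: "monoid.mult (UT n) = (*)" and UT_one[simp]: "one (UT n) = 1\<^sub>m n"
  by (simp_all add: UT_def)

lemma UT_carrier_mat: "g \<in> carrier (UT n) \<Longrightarrow> g \<in> carrier_mat n n"
  by (simp add: UT_iff)

lemma UT_entry: "g \<in> carrier (UT n) \<Longrightarrow> i < n \<Longrightarrow> j \<le> i \<Longrightarrow> g $$ (i, j) = (if i = j then 1 else 0)"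
  by (auto simp: UT_iff)

lemma UT_minus_one: "g \<in> carrier (UT n) \<Longrightarrow> g - 1\<^sub>m n \<in> strictly_upper n"
  by (auto simp: UT_iff strictly_upper_def le_less)

lemma one_plus_minus: "X \<in> carrier_mat n n \<Longrightarrow> 1\<^sub>m n + X - 1\<^sub>m n = (X :: 'a::field mat)"
  by (intro eq_matI) auto

lemma UT_one_plus: "X \<in> strictly_upper n \<Longrightarrow> 1\<^sub>m n + X \<in> carrier (UT n)"
  by (auto simp: UT_def)

lemma one_plus_minus_UT: "g \<in> carrier (UT n) \<Longrightarrow> 1\<^sub>m n + (g - 1\<^sub>m n) = g"
  by (intro eq_matI) (auto simp: UT_iff)

lemma strictly_upper_mult_triangular:
  assumes X: "X \<in> strictly_upper n"
    and A: "A \<in> carrier_mat n n" "\<And>i j. i < n \<Longrightarrow> j < i \<Longrightarrow> A $$ (i, j) = 0"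
  shows "X * A \<in> strictly_upper n" "A * X \<in> strictly_upper n"
proof -
  note Xc = strictly_upper_carrier[OF X]
  have *: "X $$ (i, k) * A $$ (k, j) = 0 \<and> A $$ (i, k) * X $$ (k, j) = 0" if "i < n" "j \<le> i" "k < n" for i j k
    using X A(2)[of k j] A(2)[of i k] that by (cases "k \<le> i"; cases "j \<le> k") (auto simp: strictly_upper_def)
  have "(\<Sum>k<n. X $$ (i, k) * A $$ (k, j)) = 0" "(\<Sum>k<n. A $$ (i, k) * X $$ (k, j)) = 0"
    if "i < n" "j \<le> i" for i j
    using *[OF that] by (auto intro!: sum.neutral simp del: mult_eq_0_iff)
  then show "X * A \<in> strictly_upper n" "A * X \<in> strictly_upper n"
    using Xc A(1) by (auto simp: strictly_upper_def mat_mult_entry simp del: index_mult_mat(1))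
qed

lemma strictly_upper_mult: "X \<in> strictly_upper n \<Longrightarrow> Y \<in> strictly_upper n \<Longrightarrow> X * Y \<in> strictly_upper n"
  by (rule strictly_upper_mult_triangular(1)) (auto simp: strictly_upper_def)

lemma strictly_upper_mult_UT: "X \<in> strictly_upper n \<Longrightarrow> g \<in> carrier (UT n) \<Longrightarrow> X * g \<in> strictly_upper n"
  by (rule strictly_upper_mult_triangular(1)) (auto simp: UT_iff)

lemma UT_mult_strictly_upper: "X \<in> strictly_upper n \<Longrightarrow> g \<in> carrier (UT n) \<Longrightarrow> g * X \<in> strictly_upper n"
  by (rule strictly_upper_mult_triangular(2)) (auto simp: UT_iff)

lemma one_plus_mult:
  assumes "X \<in> carrier_mat n n" "Y \<in> carrier_mat n n"
  shows "(1\<^sub>m n + X) * (1\<^sub>m n + Y) = 1\<^sub>m n + (X + Y + X * Y :: 'a::field mat)"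
proof -
  have "(1\<^sub>m n + X) * (1\<^sub>m n + Y) = 1\<^sub>m n * (1\<^sub>m n + Y) + X * (1\<^sub>m n + Y)"
    using assms by (intro add_mult_distrib_mat[of _ n n]) auto
  also have "X * (1\<^sub>m n + Y) = X * 1\<^sub>m n + X * Y"
    using assms by (intro mult_add_distrib_mat[of _ n n]) auto
  also have "1\<^sub>m n * (1\<^sub>m n + Y) + (X * 1\<^sub>m n + X * Y) = 1\<^sub>m n + (X + Y + X * Y)"
    using assms by (intro eq_matI) auto
  finally show ?thesis .
qed

lemma finite_UT: "finite (carrier (UT n :: 'a::{field,finite} mat monoid))"
proof (rule finite_imageD)
  let ?f = "\<lambda>g :: 'a mat. \<lambda>ij\<in>{..<n} \<times> {..<n}. g $$ ij"
  show "finite (?f ` carrier (UT n))"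
  proof (rule finite_subset)
    show "?f ` carrier (UT n) \<subseteq> ({..<n} \<times> {..<n}) \<rightarrow>\<^sub>E UNIV"
      by (intro image_subsetI) (simp add: restrict_PiE_iff)
  qed (simp add: finite_PiE)
  show "inj_on ?f (carrier (UT n))"
  proof (rule inj_onI)
    fix g h :: "'a mat" assume gh: "g \<in> carrier (UT n)" "h \<in> carrier (UT n)" "?f g = ?f h"
    show "g = h"
    proof (rule eq_matI)
      fix i j assume "i < dim_row h" "j < dim_col h"
      then show "g $$ (i, j) = h $$ (i, j)"
        using fun_cong[OF gh(3), of "(i, j)"] UT_carrier_mat[OF gh(2)] by auto
    qed (use UT_carrier_mat[OF gh(1)] UT_carrier_mat[OF gh(2)] in auto)
  qed
qed

lemma finite_strictly_upper: "finite (strictly_upper n :: 'a::{field,finite} mat set)"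
proof -
  have "strictly_upper n \<subseteq> (\<lambda>g. g - 1\<^sub>m n) ` carrier (UT n :: 'a mat monoid)"
  proof
    fix X :: "'a mat" assume X: "X \<in> strictly_upper n"
    then have "X = (1\<^sub>m n + X) - 1\<^sub>m n" by (simp add: one_plus_minus strictly_upper_carrier)
    then show "X \<in> (\<lambda>g. g - 1\<^sub>m n) ` carrier (UT n)" using UT_one_plus[OF X] by blast
  qed
  then show ?thesis using finite_UT finite_subset by blast
qed

lemma det_UT: "g \<in> carrier (UT n) \<Longrightarrow> det g = 1"
proof -
  assume g: "g \<in> carrier (UT n)"
  have "upper_triangular g" using g UT_carrier_mat[OF g] by (auto simp: UT_iff upper_triangular_def)
  then have "det g = prod_list (diag_mat g)" using UT_carrier_mat[OF g] by (rule det_upper_triangular)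
  also have "diag_mat g = map (\<lambda>i. 1) [0..<n]"
    unfolding diag_mat_def using g UT_carrier_mat[OF g] by (auto simp: UT_iff)
  also have "prod_list (map (\<lambda>i. 1 :: 'a) [0..<n]) = 1" by (induction n) auto
  finally show ?thesis .
qed

text \<open>Inverses come from finiteness: right multiplication by a matrix of determinant 1 is
  injective on the finite carrier, so it hits the identity matrix.\<close>

lemma group_UT: "group (UT n :: 'a::{field,finite} mat monoid)"
proof -
  have closed: "g * h \<in> carrier (UT n)" if gh: "g \<in> carrier (UT n)" "h \<in> carrier (UT n)" for g h :: "'a mat"
  proof -
    obtain X Y where XY: "X \<in> strictly_upper n" "g = 1\<^sub>m n + X" "Y \<in> strictly_upper n" "h = 1\<^sub>m n + Y"
      using gh by (auto simp: UT_def)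
    then show ?thesis
      by (auto simp: one_plus_mult strictly_upper_carrier
          intro!: UT_one_plus strictly_upper_add strictly_upper_mult)
  qed
  have one: "1\<^sub>m n \<in> carrier (UT n :: 'a mat monoid)" by (auto simp: UT_iff)
  show ?thesis
  proof (rule groupI)
    fix g :: "'a mat" assume g: "g \<in> carrier (UT n)"
    have "inj_on (\<lambda>h. h * g) (carrier (UT n))"
    proof (rule inj_onI)
      fix h k assume hk: "h \<in> carrier (UT n)" "k \<in> carrier (UT n)" "h * g = k * g"
      obtain B where B: "B \<in> carrier_mat n n" "g * B = 1\<^sub>m n"
        using det_non_zero_imp_unit[OF UT_carrier_mat[OF g]] det_UT[OF g]
        by (auto simp: Units_def ring_mat_simps)
      have c: "g \<in> carrier_mat n n" "h \<in> carrier_mat n n" "k \<in> carrier_mat n n"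
        using g hk by (auto simp: UT_iff)
      have "h * (g * B) = k * (g * B)"
        unfolding assoc_mult_mat[OF c(2,1) B(1), symmetric] assoc_mult_mat[OF c(3,1) B(1), symmetric]
          hk(3) ..
      then show "h = k" unfolding B(2) using c by simp
    qed
    then have "(\<lambda>h. h * g) ` carrier (UT n) = carrier (UT n)"
      using closed[OF _ g] finite_UT by (intro card_subset_eq) (auto simp: card_image)
    then show "\<exists>h\<in>carrier (UT n). h \<otimes>\<^bsub>UT n\<^esub> g = \<one>\<^bsub>UT n\<^esub>" using one by (metis UT_mult UT_one imageE)
  qed (use closed one in \<open>auto dest!: UT_carrier_mat intro!: assoc_mult_mat[of _ n n _ n _ n]\<close>)
qed

lemma UT_inv[simp]:
  fixes g :: "'a::{field,finite} mat"
  assumes "g \<in> carrier (UT n)"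
  shows "inv\<^bsub>UT n\<^esub> g \<in> carrier (UT n)" "inv\<^bsub>UT n\<^esub> g \<in> carrier_mat n n"
  using group.inv_closed[OF group_UT assms] by (auto intro: UT_carrier_mat)

section \<open>Supercharacters\<close>

text \<open>For \<open>\<mu>\<close> in the dual this is a subgroup on which
  \<open>g \<mapsto> \<theta> (\<mu> (g - 1))\<close> is multiplicative. The supercharacter will be
  a positive multiple of the sum of these linear characters, extended by zero, over the two-sided
  orbit.\<close>

definition left_annihilator :: "nat \<Rightarrow> ('a::field mat \<Rightarrow> 'a) \<Rightarrow> 'a mat set" where
  "left_annihilator n \<mu> = {g \<in> carrier (UT n). \<forall>Y\<in>strictly_upper n. \<mu> ((g - 1\<^sub>m n) * Y) = 0}"

lemma dual_add: "\<mu> \<in> dual n \<Longrightarrow> X \<in> strictly_upper n \<Longrightarrow> Y \<in> strictly_upper n \<Longrightarrow> \<mu> (X + Y) = \<mu> X + \<mu> Y"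
  and dual_smult: "\<mu> \<in> dual n \<Longrightarrow> X \<in> strictly_upper n \<Longrightarrow> \<mu> (c \<cdot>\<^sub>m X) = c * \<mu> X"
  by (auto simp: dual_def)

context
  fixes n :: nat and \<theta> :: "'a::{field,finite} \<Rightarrow> complex"
  assumes \<theta>: "nontrivial_additive_hom \<theta>"
begin

interpretation UT: group "UT n :: 'a mat monoid" by (rule group_UT)

lemma theta_add: "\<theta> (x + y) = \<theta> x * \<theta> y"
  using \<theta> by (simp add: nontrivial_additive_hom_def)

lemma theta_0: "\<theta> 0 = 1"
  using \<theta> theta_add[of 0 0] by (simp add: nontrivial_additive_hom_def)

lemma right_act_mem:
  fixes \<phi> :: "'a mat \<Rightarrow> 'a"
  assumes "\<phi> \<in> dual n" "\<mu> \<in> two_sided_orbit n \<phi>" "y \<in> carrier (UT n)"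
  shows "right_act n \<mu> y \<in> two_sided_orbit n \<phi>"
proof -
  obtain g h where gh: "g \<in> carrier (UT n)" "h \<in> carrier (UT n)" "\<mu> = right_act n (left_act n g \<phi>) h"
    using assms(2) by (auto simp: two_sided_orbit_def)
  have "right_act n \<mu> y = right_act n (left_act n g \<phi>) (h * y)"
  proof
    fix X
    show "right_act n \<mu> y X = right_act n (left_act n g \<phi>) (h * y) X"
    proof (cases "X \<in> strictly_upper n")
      case True
      have "X * inv\<^bsub>UT n\<^esub> y * inv\<^bsub>UT n\<^esub> h = X * (inv\<^bsub>UT n\<^esub> y * inv\<^bsub>UT n\<^esub> h)"
        using True gh assms(3) strictly_upper_carrier[OF True]
        by (intro assoc_mult_mat[of _ n n _ n _ n]) auto
      also have "inv\<^bsub>UT n\<^esub> y * inv\<^bsub>UT n\<^esub> h = inv\<^bsub>UT n\<^esub> (h * y)"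
        using UT.inv_mult_group[OF gh(2) assms(3)] by simp
      finally show ?thesis
        using True gh assms(3) by (simp add: right_act_def strictly_upper_mult_UT UT_inv)
    qed (simp add: right_act_def)
  qed
  moreover have "h * y \<in> carrier (UT n)" using UT.m_closed[OF gh(2) assms(3)] by simp
  ultimately show ?thesis using gh by (auto simp: two_sided_orbit_def)
qed

lemma right_act_cancel:
  fixes \<phi> :: "'a mat \<Rightarrow> 'a"
  assumes "\<mu> \<in> two_sided_orbit n \<phi>" "y \<in> carrier (UT n)"
  shows "right_act n (right_act n \<mu> y) (inv\<^bsub>UT n\<^esub> y) = \<mu>"
proof
  fix X
  obtain g h where gh: "\<mu> = right_act n (left_act n g \<phi>) h"
    using assms by (auto simp: two_sided_orbit_def)
  show "right_act n (right_act n \<mu> y) (inv\<^bsub>UT n\<^esub> y) X = \<mu> X"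
  proof (cases "X \<in> strictly_upper n")
    case True
    have "X * y * inv\<^bsub>UT n\<^esub> y = X * (y * inv\<^bsub>UT n\<^esub> y)"
      using True assms UT_carrier_mat[OF assms(2)] strictly_upper_carrier[OF True]
      by (intro assoc_mult_mat[of _ n n _ n _ n]) auto
    also have "y * inv\<^bsub>UT n\<^esub> y = 1\<^sub>m n" using UT.r_inv[OF assms(2)] by simp
    finally show ?thesis
      using True assms strictly_upper_carrier[OF True]
      by (simp add: right_act_def strictly_upper_mult_UT UT_inv)
  qed (simp add: right_act_def gh)
qed

lemma orbit_in_dual:
  fixes \<phi> :: "'a mat \<Rightarrow> 'a"
  assumes "\<phi> \<in> dual n" "\<mu> \<in> two_sided_orbit n \<phi>"
  shows "\<mu> \<in> dual n"
proof -
  obtain g h where gh: "g \<in> carrier (UT n)" "h \<in> carrier (UT n)" "\<mu> = right_act n (left_act n g \<phi>) h"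
    using assms(2) by (auto simp: two_sided_orbit_def)
  have U: "X * inv\<^bsub>UT n\<^esub> h \<in> strictly_upper n"
    "inv\<^bsub>UT n\<^esub> g * (X * inv\<^bsub>UT n\<^esub> h) \<in> strictly_upper n" if "X \<in> strictly_upper n" for X
    using strictly_upper_mult_UT[OF that UT_inv(1)[OF gh(2)]]
      UT_mult_strictly_upper[OF strictly_upper_mult_UT[OF that UT_inv(1)[OF gh(2)]] UT_inv(1)[OF gh(1)]]
    by auto
  have \<mu>: "\<mu> X = \<phi> (inv\<^bsub>UT n\<^esub> g * (X * inv\<^bsub>UT n\<^esub> h))" if "X \<in> strictly_upper n" for X
    using that U by (simp add: gh right_act_def left_act_def)
  have c: "inv\<^bsub>UT n\<^esub> g \<in> carrier_mat n n" "inv\<^bsub>UT n\<^esub> h \<in> carrier_mat n n"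
    using gh by simp_all
  have "\<mu> (X + Y) = \<mu> X + \<mu> Y" if XY: "X \<in> strictly_upper n" "Y \<in> strictly_upper n" for X Y
  proof -
    have "inv\<^bsub>UT n\<^esub> g * ((X + Y) * inv\<^bsub>UT n\<^esub> h) =
        inv\<^bsub>UT n\<^esub> g * (X * inv\<^bsub>UT n\<^esub> h) + inv\<^bsub>UT n\<^esub> g * (Y * inv\<^bsub>UT n\<^esub> h)"
      using c XY[THEN strictly_upper_carrier] 
      by (simp add: add_mult_distrib_mat[of _ n n] mult_add_distrib_mat[of _ n n _ n])
    then show ?thesis using XY U by (simp add: \<mu> strictly_upper_add dual_add[OF assms(1)])
  qed
  moreover have "\<mu> (c \<cdot>\<^sub>m X) = c * \<mu> X" if X: "X \<in> strictly_upper n" for X c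
  proof -
    have "inv\<^bsub>UT n\<^esub> g * ((c \<cdot>\<^sub>m X) * inv\<^bsub>UT n\<^esub> h) = c \<cdot>\<^sub>m (inv\<^bsub>UT n\<^esub> g * (X * inv\<^bsub>UT n\<^esub> h))"
      using \<open>inv\<^bsub>UT n\<^esub> g \<in> carrier_mat n n\<close> \<open>inv\<^bsub>UT n\<^esub> h \<in> carrier_mat n n\<close> strictly_upper_carrier[OF X]
      by (simp add: mult_smult_distrib[of _ n n _ n] mult_smult_assoc_mat[of _ n n _ n])
    then show ?thesis using X U by (simp add: \<mu> strictly_upper_smult dual_smult[OF assms(1)])
  qed
  ultimately show ?thesis using gh by (auto simp: dual_def right_act_def)
qed

lemma finite_two_sided_orbit: "finite (two_sided_orbit n (\<phi> :: 'a mat \<Rightarrow> 'a))"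
proof -
  have "two_sided_orbit n \<phi> =
      (\<lambda>(g, h). right_act n (left_act n g \<phi>) h) ` (carrier (UT n) \<times> carrier (UT n))"
    by (auto simp: two_sided_orbit_def)
  then show ?thesis using finite_UT[where 'a = 'a, of n] by simp
qed

lemma self_in_two_sided_orbit:
  fixes \<phi> :: "'a mat \<Rightarrow> 'a"
  assumes "\<phi> \<in> dual n"
  shows "\<phi> \<in> two_sided_orbit n \<phi>"
proof -
  have "right_act n (left_act n (1\<^sub>m n) \<phi>) (1\<^sub>m n) = \<phi>"
  proof
    fix X
    have "inv\<^bsub>UT n\<^esub> (1\<^sub>m n) = (1\<^sub>m n :: 'a mat)" using UT.inv_one by simp
    note inv = this
    show "right_act n (left_act n (1\<^sub>m n) \<phi>) (1\<^sub>m n) X = \<phi> X"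
    proof (cases "X \<in> strictly_upper n")
      case True
      then show ?thesis
        unfolding right_act_def left_act_def inv using strictly_upper_carrier[OF True] by simp
    next
      case False
      then show ?thesis using assms by (simp add: right_act_def dual_def extensional_def)
    qed
  qed
  then show ?thesis using UT.one_closed by (force simp: two_sided_orbit_def)
qed

text \<open>Orthogonality for the additive character
  \<open>Y \<mapsto> \<theta> (\<mu> (X * Y))\<close>: a nonzero linear form takes every value, in
  particular one at which \<theta> is not 1.\<close>

lemma theta_sum_strictly_upper:
  fixes X :: "'a mat"
  assumes \<mu>: "\<mu> \<in> dual n" and X: "X \<in> strictly_upper n"
  shows "(\<Sum>Y\<in>strictly_upper n. \<theta> (\<mu> (X * Y))) =
    (if \<forall>Y\<in>strictly_upper n. \<mu> (X * Y) = 0 then of_nat (card (strictly_upper n :: 'a mat set)) else 0)"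
proof (cases "\<forall>Y\<in>strictly_upper n. \<mu> (X * Y) = 0")
  case False
  then obtain Y where Y: "Y \<in> strictly_upper n" "\<mu> (X * Y) \<noteq> 0" by auto
  obtain x where x: "\<theta> x \<noteq> 1" using \<theta> by (auto simp: nontrivial_additive_hom_def)
  define Z where "Z = (x / \<mu> (X * Y)) \<cdot>\<^sub>m Y"
  have Z: "Z \<in> strictly_upper n" using Y by (simp add: Z_def strictly_upper_smult)
  have "X * Z = (x / \<mu> (X * Y)) \<cdot>\<^sub>m (X * Y)"
    using X Y unfolding Z_def by (intro mult_smult_distrib) (auto intro: strictly_upper_carrier)
  then have \<mu>Z: "\<mu> (X * Z) = x" using Y X \<mu> by (simp add: dual_smult strictly_upper_mult)
  have bij: "bij_betw (\<lambda>Y. Y + Z) (strictly_upper n) (strictly_upper n)"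
  proof (rule bij_betw_byWitness[where f' = "\<lambda>Y. Y + (-1) \<cdot>\<^sub>m Z"])
    show "\<forall>Y\<in>strictly_upper n. Y + Z + (- 1) \<cdot>\<^sub>m Z = Y" "\<forall>Y\<in>strictly_upper n. Y + (- 1) \<cdot>\<^sub>m Z + Z = Y"
      using Z by (auto simp: strictly_upper_def intro!: eq_matI)
  qed (use Z in \<open>auto intro!: strictly_upper_add strictly_upper_smult\<close>)
  have "(\<Sum>Y\<in>strictly_upper n. \<theta> (\<mu> (X * Y))) = (\<Sum>Y\<in>strictly_upper n. \<theta> (\<mu> (X * (Y + Z))))"
    by (rule sum.reindex_bij_betw[OF bij, symmetric])
  also have "\<dots> = (\<Sum>Y\<in>strictly_upper n. \<theta> (\<mu> (X * Y)) * \<theta> x)"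
  proof (rule sum.cong[OF refl])
    fix Y :: "'a mat" assume Y: "Y \<in> strictly_upper n"
    have "X * (Y + Z) = X * Y + X * Z"
      using X Y Z by (intro mult_add_distrib_mat) (auto intro: strictly_upper_carrier)
    then show "\<theta> (\<mu> (X * (Y + Z))) = \<theta> (\<mu> (X * Y)) * \<theta> x"
      using X Y Z by (simp add: dual_add[OF \<mu>] strictly_upper_mult theta_add \<mu>Z)
  qed
  also have "\<dots> = (\<Sum>Y\<in>strictly_upper n. \<theta> (\<mu> (X * Y))) * \<theta> x"
    by (rule sum_distrib_right[symmetric])
  finally have "(\<Sum>Y\<in>strictly_upper n. \<theta> (\<mu> (X * Y))) = 0" using x by (metis mult_cancel_left2)
  then show ?thesis using False by auto
qed (simp add: theta_0)

text \<open>The two-sided orbit is invariant under the right action, so the sum over it may be averaged over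
  right translations; the average of \<open>\<theta> \<circ> \<mu>\<close> vanishes unless \<open>g\<close> is in the left annihilator of \<open>\<mu>\<close>.\<close>

lemma supercharacter_eq:
  fixes \<phi> :: "'a mat \<Rightarrow> 'a"
  assumes \<phi>: "\<phi> \<in> dual n"
  shows "\<exists>c>0. \<forall>g\<in>carrier (UT n). supercharacter \<theta> n \<phi> g = of_real c *
    (\<Sum>\<mu>\<in>two_sided_orbit n \<phi>. if g \<in> left_annihilator n \<mu> then \<theta> (\<mu> (g - 1\<^sub>m n)) else 0)"
proof -
  let ?Q = "two_sided_orbit n \<phi>"
  let ?U = "strictly_upper n :: 'a mat set"
  define c where "c = real (card (left_orbit n \<phi>)) / real (card ?Q)"
  have "finite (left_orbit n \<phi>)" "left_orbit n \<phi> \<noteq> {}"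
  proof -
    have "left_orbit n \<phi> = (\<lambda>g. left_act n g \<phi>) ` carrier (UT n)" by (auto simp: left_orbit_def)
    then show "finite (left_orbit n \<phi>)" "left_orbit n \<phi> \<noteq> {}" using finite_UT UT.one_closed by auto
  qed
  then have "card (left_orbit n \<phi>) > 0" by (simp add: card_gt_0_iff)
  moreover have "card ?Q > 0"
    using finite_two_sided_orbit self_in_two_sided_orbit[OF \<phi>] card_gt_0_iff by blast
  ultimately have "c > 0" by (simp add: c_def)
  moreover have "supercharacter \<theta> n \<phi> g = of_real c *
    (\<Sum>\<mu>\<in>?Q. if g \<in> left_annihilator n \<mu> then \<theta> (\<mu> (g - 1\<^sub>m n)) else 0)"
    if g: "g \<in> carrier (UT n)" for g
  proof -
    define X where "X = g - 1\<^sub>m n"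
    have X: "X \<in> ?U" using UT_minus_one[OF g] by (simp add: X_def)
    have shift: "(\<Sum>\<mu>\<in>?Q. \<theta> (\<mu> X)) = (\<Sum>\<mu>\<in>?Q. \<theta> (\<mu> X) * \<theta> (\<mu> (X * Y)))" if Y: "Y \<in> ?U" for Y
    proof -
      \<comment> \<open>The action inverts its group element, so \<open>y\<close> is the inverse of
        \<open>1 + Y\<close>; acting with it replaces \<open>\<mu> X\<close> by
        \<open>\<mu> (X + X * Y)\<close>.\<close>
      define y where "y = inv\<^bsub>UT n\<^esub> (1\<^sub>m n + Y)"
      have y: "y \<in> carrier (UT n)" "inv\<^bsub>UT n\<^esub> y = 1\<^sub>m n + Y"
        using UT_one_plus[OF Y] by (simp_all add: y_def UT.inv_inv)
      have bij: "bij_betw (\<lambda>\<mu>. right_act n \<mu> y) ?Q ?Q"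
      proof (rule bij_betw_byWitness[where f' = "\<lambda>\<mu>. right_act n \<mu> (inv\<^bsub>UT n\<^esub> y)"])
        show "\<forall>\<mu>\<in>?Q. right_act n (right_act n \<mu> y) (inv\<^bsub>UT n\<^esub> y) = \<mu>"
          using right_act_cancel[OF _ y(1)] by blast
        show "\<forall>\<mu>\<in>?Q. right_act n (right_act n \<mu> (inv\<^bsub>UT n\<^esub> y)) y = \<mu>"
          using right_act_cancel[OF _ UT_inv(1)[OF y(1)]] UT.inv_inv[OF y(1)] by metis
        show "(\<lambda>\<mu>. right_act n \<mu> y) ` ?Q \<subseteq> ?Q"
          using right_act_mem[OF \<phi> _ y(1)] by blast
        show "(\<lambda>\<mu>. right_act n \<mu> (inv\<^bsub>UT n\<^esub> y)) ` ?Q \<subseteq> ?Q"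
          using right_act_mem[OF \<phi> _ UT_inv(1)[OF y(1)]] by blast
      qed
      have "(\<Sum>\<mu>\<in>?Q. \<theta> (\<mu> X)) = (\<Sum>\<mu>\<in>?Q. \<theta> (right_act n \<mu> y X))"
        by (rule sum.reindex_bij_betw[OF bij, symmetric])
      also have "\<dots> = (\<Sum>\<mu>\<in>?Q. \<theta> (\<mu> X) * \<theta> (\<mu> (X * Y)))"
      proof (rule sum.cong[OF refl])
        fix \<mu> assume \<mu>: "\<mu> \<in> ?Q"
        have "X * (1\<^sub>m n + Y) = X * 1\<^sub>m n + X * Y"
          using X Y by (intro mult_add_distrib_mat) (auto intro: strictly_upper_carrier)
        then have "X * (1\<^sub>m n + Y) = X + X * Y" using strictly_upper_carrier[OF X] by simp
        then show "\<theta> (right_act n \<mu> y X) = \<theta> (\<mu> X) * \<theta> (\<mu> (X * Y))"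
          using X Y dual_add[OF orbit_in_dual[OF \<phi> \<mu>]]
          by (simp add: right_act_def y theta_add strictly_upper_mult)
      qed
      finally show ?thesis .
    qed
    have "of_nat (card ?U) * (\<Sum>\<mu>\<in>?Q. \<theta> (\<mu> X)) = (\<Sum>Y\<in>?U. \<Sum>\<mu>\<in>?Q. \<theta> (\<mu> X) * \<theta> (\<mu> (X * Y)))"
      by (simp add: shift[symmetric])
    also have "\<dots> = (\<Sum>\<mu>\<in>?Q. \<theta> (\<mu> X) * (\<Sum>Y\<in>?U. \<theta> (\<mu> (X * Y))))"
      by (subst sum.swap) (simp add: sum_distrib_left)
    also have "\<dots> = (\<Sum>\<mu>\<in>?Q. of_nat (card ?U) * (if g \<in> left_annihilator n \<mu> then \<theta> (\<mu> X) else 0))"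
      using g X by (intro sum.cong refl)
        (auto simp: theta_sum_strictly_upper orbit_in_dual[OF \<phi>] left_annihilator_def X_def)
    also have "\<dots> = of_nat (card ?U) * (\<Sum>\<mu>\<in>?Q. if g \<in> left_annihilator n \<mu> then \<theta> (\<mu> X) else 0)"
      by (simp add: sum_distrib_left)
    finally have "(\<Sum>\<mu>\<in>?Q. \<theta> (\<mu> X)) = (\<Sum>\<mu>\<in>?Q. if g \<in> left_annihilator n \<mu> then \<theta> (\<mu> X) else 0)"
      using finite_strictly_upper[where 'a = 'a] X by (auto simp: card_eq_0_iff)
    then show ?thesis using g unfolding X_def supercharacter_def c_def by simp
  qed
  ultimately show ?thesis by blast
qed

text \<open>With \<open>g = 1 + X\<close> and \<open>h = 1 + Y\<close> the product is
  \<open>1 + X + Y + X * Y\<close>, and \<open>\<mu>\<close> kills \<open>X * Y\<close> and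
  \<open>X * (Y * Z)\<close> because \<open>Y\<close> and \<open>Y * Z\<close> are strictly upper
  triangular.\<close>

lemma left_annihilator_mult:
  fixes g h :: "'a mat"
  assumes \<mu>: "\<mu> \<in> dual n" and g: "g \<in> left_annihilator n \<mu>" and h: "h \<in> left_annihilator n \<mu>"
  shows "g * h \<in> left_annihilator n \<mu>"
    and "\<theta> (\<mu> (g * h - 1\<^sub>m n)) = \<theta> (\<mu> (g - 1\<^sub>m n)) * \<theta> (\<mu> (h - 1\<^sub>m n))"
proof -
  define X Y where "X = g - 1\<^sub>m n" and "Y = h - 1\<^sub>m n"
  have gh: "g \<in> carrier (UT n)" "h \<in> carrier (UT n)" using g h by (auto simp: left_annihilator_def)
  have U: "X \<in> strictly_upper n" "Y \<in> strictly_upper n"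
    using gh UT_minus_one by (auto simp: X_def Y_def)
  note c = U[THEN strictly_upper_carrier]
  have "g * h = 1\<^sub>m n + (X + Y + X * Y)"
    using one_plus_mult[OF c] one_plus_minus_UT[OF gh(1)] one_plus_minus_UT[OF gh(2)] by (simp add: X_def Y_def)
  then have m: "g * h - 1\<^sub>m n = X + Y + X * Y" using c by (simp add: one_plus_minus)
  have a: "\<mu> (X * Z) = 0" "\<mu> (Y * Z) = 0" if "Z \<in> strictly_upper n" for Z
    using g h that by (auto simp: left_annihilator_def X_def Y_def)
  have "\<mu> ((X + Y + X * Y) * Z) = 0" if Z: "Z \<in> strictly_upper n" for Z
  proof -
    have "(X + Y + X * Y) * Z = X * Z + Y * Z + X * (Y * Z)"
      using c strictly_upper_carrier[OF Z]
      by (simp add: add_mult_distrib_mat[of _ n n] assoc_mult_mat[of _ n n] assoc_add_mat[of _ n n])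
    then show ?thesis
      using U Z a by (simp add: dual_add[OF \<mu>] strictly_upper_mult strictly_upper_add)
  qed
  then show "g * h \<in> left_annihilator n \<mu>"
    using UT.m_closed[OF gh] by (auto simp: left_annihilator_def m)
  show "\<theta> (\<mu> (g * h - 1\<^sub>m n)) = \<theta> (\<mu> (g - 1\<^sub>m n)) * \<theta> (\<mu> (h - 1\<^sub>m n))"
    using U a by (simp add: m dual_add[OF \<mu>] strictly_upper_mult strictly_upper_add theta_add flip: X_def Y_def)
qed

end

text \<open>Only the summand of \<open>\<phi>\<close> itself has to be compared with
  \<open>tau\<close>; the rest of the orbit contributes nonnegative real parts.\<close>

lemma supercharacter_inner_nonzero:
  fixes \<theta> :: "'a::{field,finite} \<Rightarrow> complex"
  assumes mp: "mackey_pair (UT n) P N tau" and \<theta>: "nontrivial_additive_hom \<theta>" and \<phi>: "\<phi> \<in> dual n"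
    and agree: "\<And>g. g \<in> left_annihilator n \<phi> \<Longrightarrow> g \<in> P \<Longrightarrow> \<theta> (\<phi> (g - 1\<^sub>m n)) = tau g"
  shows "character_inner (UT n) (supercharacter \<theta> n \<phi>) (mackey_pair.psi (UT n) P tau) \<noteq> 0"
proof -
  interpret mackey_pair "UT n" P N tau by (rule mp)
  obtain c where c: "c > 0" "\<And>g. g \<in> carrier (UT n) \<Longrightarrow> supercharacter \<theta> n \<phi> g = of_real c *
    (\<Sum>\<mu>\<in>two_sided_orbit n \<phi>. if g \<in> left_annihilator n \<mu> then \<theta> (\<mu> (g - 1\<^sub>m n)) else 0)"
    using supercharacter_eq[OF \<theta> \<phi>] by blast
  show ?thesis
  proof (rule character_inner_nonzero[where nu = "\<lambda>\<mu> g. \<theta> (\<mu> (g - 1\<^sub>m n))" and c = c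
        and L = "left_annihilator n" and m = \<phi> and Q = "two_sided_orbit n \<phi>"])
    have z: "1\<^sub>m n - 1\<^sub>m n = (0\<^sub>m n n :: 'a mat)" by (intro eq_matI) auto
    have "\<phi> (0\<^sub>m n n * Y) = 0" if "Y \<in> strictly_upper n" for Y
    proof -
      have "0\<^sub>m n n * Y = 0 \<cdot>\<^sub>m Y" using strictly_upper_carrier[OF that] by (intro eq_matI) auto
      then show ?thesis using dual_smult[OF \<phi> that, of 0] by simp
    qed
    then have "\<forall>Y\<in>strictly_upper n. \<phi> ((1\<^sub>m n - 1\<^sub>m n) * Y) = 0"
      unfolding z by blast
    then show "\<one>\<^bsub>UT n\<^esub> \<in> left_annihilator n \<phi>"
      using one_closed unfolding left_annihilator_def by simp
  qed (use c finite_two_sided_orbit[OF \<theta>] self_in_two_sided_orbit[OF \<theta> \<phi>] agree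
      left_annihilator_mult[OF \<theta> orbit_in_dual[OF \<theta> \<phi>]] in \<open>auto simp: left_annihilator_def\<close>)
qed

section \<open>The inducing subgroup and its linear character\<close>

text \<open>\<open>arc_end r a\<close> is the column of the nonzero entry of a quasi-monomial form of exotic shape in row
  \<open>a \<le> 4 * r\<close>, with rows and columns numbered from 0.\<close>

definition arc_end :: "nat \<Rightarrow> nat \<Rightarrow> nat" where
  "arc_end r a = (if a < r then a + 2 * r else if a < 2 * r then a + 3 * r + 1
     else if a \<le> 3 * r then a + r else a + 2 * r)"

locale exotic_data =
  fixes n r e :: nat and w :: "nat \<Rightarrow> 'a::{field,finite}" and \<theta> :: "'a \<Rightarrow> complex"
  assumes w: "w a \<noteq> 0" and r_def: "r = CHAR('a) ^ e" and e: "e > 0" and n: "6 * r < n"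
    and \<theta>: "nontrivial_additive_hom \<theta>"
begin

text \<open>The entries of \<open>g\<close> conjugated by the diagonal matrix with entries
  \<open>w\<close>. Conjugation respects products, and a suitable \<open>w\<close> turns every
  nonzero coefficient of the form into 1.\<close>

definition E :: "'a mat \<Rightarrow> nat \<Rightarrow> nat \<Rightarrow> 'a" where
  "E g a b = w a * g $$ (a, b) / w b"

abbreviation sg :: "nat \<Rightarrow> nat" where "sg \<equiv> arc_end r"

text \<open>Of the columns strictly between row \<open>a\<close> and the end of its arc, \<open>J a\<close> contains those in which the
  elements of \<open>N\<close> vanish; in the remaining ones the elements of \<open>P\<close> are arbitrary.\<close>

definition J :: "nat \<Rightarrow> nat set" where
  "J a = (if a < r then {a<..<r} else if a < 2 * r then {a<..3 * r} \<union> {4 * r<..<a + 3 * r + 1}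
     else if a < 3 * r then {a<..<3 * r} else if a = 3 * r then {3 * r<..<4 * r} else {a<..<a + 2 * r})"

text \<open>The common Toeplitz sequence is read off the first row of \<open>C\<close>;
  \<open>c g r\<close> is the entry on the arc from \<open>3 * r\<close> to
  \<open>4 * r\<close>.\<close>

definition c :: "'a mat \<Rightarrow> nat \<Rightarrow> 'a" where
  "c g k = E g (3 * r) (3 * r + k)"

text \<open>On the positions of \<open>J\<close> the condition selects the pairs whose row and
  column lie in the same one of \<open>A\<close>, \<open>M\<close>, \<open>B\<close>,
  \<open>C\<close>. There the entry is prescribed by the Toeplitz sequence, at the other positions
  of \<open>J\<close> it is 0.\<close>

definition link :: "'a mat \<Rightarrow> nat \<Rightarrow> nat \<Rightarrow> 'a" where
  "link g a b = (if b \<le> 4 * r \<and> (a < r \<or> b < 2 * r \<or> 2 * r \<le> a) then c g (b - a) else 0)"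

definition P :: "'a mat set" where
  "P = {g \<in> carrier (UT n). \<forall>a\<le>4 * r. \<forall>b\<in>J a. E g a b = link g a b}"

definition N :: "'a mat set" where
  "N = {g \<in> carrier (UT n). \<forall>a\<le>4 * r. \<forall>b\<in>J a. E g a b = 0}"

lemma r2: "2 \<le> r"
  using CHAR_power_ge_2[OF e, where 'a = 'a] by (simp add: r_def)

lemma E_diag: "g \<in> carrier (UT n) \<Longrightarrow> a < n \<Longrightarrow> E g a a = 1"
  using w by (simp add: E_def UT_iff)

lemma E_lower: "g \<in> carrier (UT n) \<Longrightarrow> b < a \<Longrightarrow> a < n \<Longrightarrow> E g a b = 0"
  by (simp add: E_def UT_iff)

lemma E_mult:
  assumes "g \<in> carrier_mat n n" "h \<in> carrier_mat n n" "a < n" "b < n"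
  shows "E (g * h) a b = (\<Sum>m<n. E g a m * E h m b)"
  unfolding E_def mat_mult_entry[OF assms] using w
  by (simp add: sum_distrib_left sum_divide_distrib mult.assoc)

lemma E_mult_on:
  assumes g: "g \<in> carrier (UT n)" and h: "h \<in> carrier (UT n)" and "b < n"
    and S: "S \<subseteq> {a..b}" "\<And>m. a \<le> m \<Longrightarrow> m \<le> b \<Longrightarrow> m \<notin> S \<Longrightarrow> E g a m = 0 \<or> E h m b = 0"
    and "a \<le> b"
  shows "E (g * h) a b = (\<Sum>m\<in>S. E g a m * E h m b)"
proof -
  have "E (g * h) a b = (\<Sum>m<n. E g a m * E h m b)"
    using assms by (intro E_mult UT_carrier_mat) auto
  also have "\<dots> = (\<Sum>m\<in>S. E g a m * E h m b)"
  proof (intro sum.mono_neutral_right ballI)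
    fix m assume m: "m \<in> {..<n} - S"
    show "E g a m * E h m b = 0"
    proof (cases "a \<le> m \<and> m \<le> b")
      case True
      then show ?thesis using S(2) m by auto
    next
      case False
      then show ?thesis using E_lower[OF g, of m a] E_lower[OF h, of b m] m assms by auto
    qed
  qed (use assms in auto)
  finally show ?thesis .
qed

lemma J_diff_bounds:
  "a \<le> 4 * r \<Longrightarrow> b \<in> J a \<Longrightarrow> b \<le> 4 * r \<Longrightarrow> a < r \<or> b < 2 * r \<or> 2 * r \<le> a \<Longrightarrow> 0 < b - a \<and> b - a < r"
  by (auto simp: J_def split: if_splits)

lemma link_eq_0:
  assumes "a \<le> 4 * r" "b \<in> J a" "\<And>k. 0 < k \<Longrightarrow> k < r \<Longrightarrow> c g k = 0"
  shows "link g a b = 0"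
  using J_diff_bounds[OF assms(1,2)] assms(3)[of "b - a"] by (auto simp: link_def)

lemma P_UT: "g \<in> P \<Longrightarrow> g \<in> carrier (UT n)"
  by (simp add: P_def)

lemma P_link: "g \<in> P \<Longrightarrow> a \<le> 4 * r \<Longrightarrow> b \<in> J a \<Longrightarrow> E g a b = link g a b"
  by (simp add: P_def)

lemma c_0: "g \<in> carrier (UT n) \<Longrightarrow> c g 0 = 1"
  using n by (simp add: c_def E_diag)

text \<open>The offsets are the first rows of the five blocks of size \<open>r\<close>; the last two
  start one row apart inside \<open>C\<close>.\<close>

lemma P_toeplitz:
  assumes g: "g \<in> P" and s: "s \<in> {0, r, 2 * r, 3 * r, 3 * r + 1}" and ij: "i \<le> j" "j < r"
  shows "E g (s + i) (s + j) = c g (j - i)"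
proof (cases "i = j \<or> s = 3 * r \<and> i = 0")
  case True
  then show ?thesis using P_UT[OF g] n ij s by (auto simp: E_diag c_0 c_def[of g j])
next
  case False
  then have "s + j \<in> J (s + i)" "s + i \<le> 4 * r"
    using s ij by (auto simp: J_def)
  moreover have "link g (s + i) (s + j) = c g (j - i)"
    using s ij by (auto simp: link_def)
  ultimately show ?thesis using P_link[OF g] by simp
qed

lemma P_toeplitz_C:
  assumes g: "g \<in> P" and ij: "i \<le> j" "j \<le> r"
  shows "E g (3 * r + i) (3 * r + j) = c g (j - i)"
proof (cases "i = j \<or> i = 0")
  case True
  then show ?thesis using P_UT[OF g] n ij by (auto simp: E_diag c_0 c_def[of g j])
next
  case False
  then have "3 * r + j \<in> J (3 * r + i)" "3 * r + i \<le> 4 * r"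
    using ij by (auto simp: J_def)
  moreover have "link g (3 * r + i) (3 * r + j) = c g (j - i)"
    using ij by (auto simp: link_def)
  ultimately show ?thesis using P_link[OF g] by simp
qed

lemma P_zero_MB: "g \<in> P \<Longrightarrow> r \<le> a \<Longrightarrow> a < 2 * r \<Longrightarrow> 2 * r \<le> b \<Longrightarrow> b \<le> 3 * r \<Longrightarrow> E g a b = 0"
  using P_link[of g a b] by (auto simp: J_def link_def)

lemma P_zero_M: "g \<in> P \<Longrightarrow> r \<le> a \<Longrightarrow> a < 2 * r \<Longrightarrow> 4 * r < b \<Longrightarrow> b < a + 3 * r + 1 \<Longrightarrow> E g a b = 0"
  using P_link[of g a b] by (auto simp: J_def link_def)

lemma P_zero_C: "g \<in> P \<Longrightarrow> 3 * r < a \<Longrightarrow> a \<le> 4 * r \<Longrightarrow> 4 * r < b \<Longrightarrow> b < a + 2 * r \<Longrightarrow> E g a b = 0"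
  using P_link[of g a b] by (auto simp: J_def link_def)

lemma toeplitz_mult:
  assumes g: "g \<in> carrier (UT n)" and h: "h \<in> carrier (UT n)" and ij: "i \<le> j" "s + j < n"
    and tg: "\<And>m. i \<le> m \<Longrightarrow> m \<le> j \<Longrightarrow> E g (s + i) (s + m) = c g (m - i)"
    and th: "\<And>m. i \<le> m \<Longrightarrow> m \<le> j \<Longrightarrow> E h (s + m) (s + j) = c h (j - m)"
  shows "E (g * h) (s + i) (s + j) = (\<Sum>l\<le>j - i. c g l * c h (j - i - l))"
proof -
  have "E (g * h) (s + i) (s + j) = (\<Sum>m\<in>{s + i..s + j}. E g (s + i) m * E h m (s + j))"
    using ij by (intro E_mult_on[OF g h]) auto
  also have "\<dots> = (\<Sum>l\<le>j - i. E g (s + i) (s + (i + l)) * E h (s + (i + l)) (s + j))"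
    using ij by (intro sum.reindex_bij_witness[where i = "\<lambda>l. s + i + l" and j = "\<lambda>m. m - (s + i)"])
      (auto simp: algebra_simps)
  also have "\<dots> = (\<Sum>l\<le>j - i. c g l * c h (j - i - l))"
    using ij by (intro sum.cong refl) (simp add: tg th)
  finally show ?thesis .
qed

lemma c_mult:
  assumes g: "g \<in> P" and h: "h \<in> P" and k: "k \<le> r"
  shows "c (g * h) k = (\<Sum>l\<le>k. c g l * c h (k - l))"
proof -
  have "E (g * h) (3 * r + 0) (3 * r + k) = (\<Sum>l\<le>k - 0. c g l * c h (k - 0 - l))"
    using k n P_toeplitz_C[OF g, of 0] P_toeplitz_C[OF h, of _ k]
    by (intro toeplitz_mult P_UT g h) simp_all
  then show ?thesis by (simp add: c_def[of "g * h"])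
qed

text \<open>Inside the diagonal blocks, products of upper triangular Toeplitz matrices are again
  Toeplitz. At a position prescribed to be 0, every intermediate index meets a vanishing entry of
  one of the factors.\<close>

lemma P_mult:
  assumes g: "g \<in> P" and h: "h \<in> P"
  shows "g * h \<in> P"
proof -
  note U = P_UT[OF g] P_UT[OF h]
  have gh: "g * h \<in> carrier (UT n)"
    using monoid.m_closed[OF group.is_monoid[OF group_UT], OF U] by simp
  have "E (g * h) a b = link (g * h) a b" if a: "a \<le> 4 * r" and b: "b \<in> J a" for a b
  proof (cases "b \<le> 4 * r \<and> (a < r \<or> b < 2 * r \<or> 2 * r \<le> a)")
    case True
    define s where "s = (if a < r then 0 else if a < 2 * r then r else if a < 3 * r then 2 * r else 3 * r)"
    define i j where "i = a - s" and "j = b - s"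
    have ab: "a = s + i" "b = s + j" "i \<le> j" "s + j < n" "b - a = j - i" "j - i \<le> r"
      using True a b n by (auto simp: s_def i_def j_def J_def split: if_splits)
    have js: "j < r \<and> s \<in> {0, r, 2 * r} \<or> j \<le> r \<and> s = 3 * r"
      using True a b by (auto simp: s_def j_def J_def split: if_splits)
    have t: "E f (s + k) (s + m) = c f (m - k)" if "f \<in> P" "k \<le> m" "m \<le> j" for f k m
      using P_toeplitz[OF that(1), of s k m] P_toeplitz_C[OF that(1), of k m] that js by auto
    have "E (g * h) a b = (\<Sum>l\<le>j - i. c g l * c h (j - i - l))"
      unfolding ab(1,2) using ab by (intro toeplitz_mult[OF U]) (auto intro: t g h)
    also have "\<dots> = c (g * h) (b - a)" using c_mult[OF g h, of "b - a"] ab by simp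
    finally show ?thesis using True by (simp add: link_def)
  next
    case False
    have "E g a m = 0 \<or> E h m b = 0" if m: "a \<le> m" "m \<le> b" for m
    proof -
      consider "r \<le> a" "a < 2 * r" "2 * r \<le> b" "b \<le> 3 * r"
        | "r \<le> a" "a < 2 * r" "4 * r < b" "b < a + 3 * r + 1"
        | "3 * r < a" "4 * r < b" "b < a + 2 * r"
        using False a b by (auto simp: J_def split: if_splits)
      then show ?thesis
      proof cases
        case 1
        then show ?thesis using P_zero_MB[OF g, of a m] P_zero_MB[OF h, of m b] m by (cases "m < 2 * r") auto
      next
        case 2
        then show ?thesis using P_zero_MB[OF g, of a m] P_zero_M[OF g, of a m] P_zero_M[OF h, of m b]
            P_zero_C[OF h, of m b] m by linarith
      next
        case 3
        then show ?thesis using P_zero_C[OF g, of a m] P_zero_C[OF h, of m b] m a by linarith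
      qed
    qed
    then have "E (g * h) a b = (\<Sum>m\<in>{}. E g a m * E h m b)"
      using a b n by (intro E_mult_on[OF U]) (auto simp: J_def split: if_splits)
    then show ?thesis using False by (auto simp: link_def)
  qed
  then show ?thesis using gh by (simp add: P_def)
qed

lemma one_in_N: "1\<^sub>m n \<in> N"
  using n by (auto simp: N_def UT_iff E_def J_def split: if_splits)

lemma N_c: "g \<in> N \<Longrightarrow> 0 < k \<Longrightarrow> k < r \<Longrightarrow> c g k = 0"
  by (auto simp: N_def J_def c_def)

lemma N_subset_P: "N \<subseteq> P"
  using link_eq_0 N_c by (fastforce simp: P_def N_def)

text \<open>So \<open>N\<close> is the kernel of the map from \<open>P\<close> to the unit series
  modulo \<open>t^r\<close>, the coefficient of \<open>t^r\<close> itself remaining free.\<close>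

lemma N_eq: "N = {g \<in> P. \<forall>k. 0 < k \<and> k < r \<longrightarrow> c g k = 0}"
proof (intro equalityI subsetI)
  fix g assume "g \<in> N"
  then show "g \<in> {g \<in> P. \<forall>k. 0 < k \<and> k < r \<longrightarrow> c g k = 0}" using N_subset_P N_c by auto
next
  fix g assume "g \<in> {g \<in> P. \<forall>k. 0 < k \<and> k < r \<longrightarrow> c g k = 0}"
  then show "g \<in> N" by (auto simp: N_def P_def link_eq_0)
qed

lemma N_mult: "g \<in> N \<Longrightarrow> h \<in> N \<Longrightarrow> g * h \<in> N"
proof -
  assume g: "g \<in> N" and h: "h \<in> N"
  have P: "g \<in> P" "h \<in> P" using g h N_subset_P by auto
  have "c (g * h) k = 0" if k: "0 < k" "k < r" for k
  proof -
    have "c (g * h) k = (\<Sum>l\<le>k. c g l * c h (k - l))" using c_mult[OF P] k by simp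
    also have "\<dots> = 0"
    proof (rule sum.neutral, rule ballI)
      fix l assume "l \<in> {..k}"
      then show "c g l * c h (k - l) = 0"
        using N_c[OF g, of l] N_c[OF h, of "k - l"] k by (cases "l = 0") auto
    qed
    finally show ?thesis .
  qed
  then show ?thesis using P_mult[OF P] by (auto simp: N_eq)
qed

lemma subgroup_P: "subgroup P (UT n)"
proof (rule group.finite_closed_subgroup[OF group_UT])
  show "P \<subseteq> carrier (UT n)" using P_UT by auto
  then show "finite P" using finite_UT finite_subset by blast
qed (use one_in_N N_subset_P P_mult in auto)

lemma subgroup_N: "subgroup N (UT n)"
proof (rule group.finite_closed_subgroup[OF group_UT])
  show "N \<subseteq> carrier (UT n)" using P_UT N_subset_P by auto
  then show "finite N" using finite_UT finite_subset by blast
qed (use one_in_N N_mult in auto)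

text \<open>Modulo \<open>t^(r+1)\<close> the pair \<open>A + \<epsilon> D\<close> is multiplicative over the dual numbers (\<open>A_mult\<close>, \<open>D_mult\<close>), so
  \<open>D / A\<close> is additive. The series \<open>D\<close> collects the sums along the subdiagonals of the free blocks.\<close>

definition A :: "'a mat \<Rightarrow> 'a fps" where
  "A g = Abs_fps (\<lambda>k. if k \<le> r then c g k else 0)"

text \<open>Row and column offsets of the blocks of size \<open>r\<close> from \<open>A\<close> to
  \<open>M\<close>, from \<open>A\<close> to \<open>B\<close>, from \<open>B\<close> to the first
  rows of \<open>C\<close> and from \<open>M\<close> to the last rows of \<open>C\<close>. The
  second and third carry arcs on their main diagonals, the other two the additional terms of
  \<open>F\<close>.\<close>

definition blocks :: "(nat \<times> nat) list" where
  "blocks = [(0, r), (0, 2 * r), (2 * r, 3 * r), (r, 3 * r + 1)]"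

text \<open>Diagonals are numbered by length from the lower left corner, \<open>l = r\<close> being
  the main one. Triangular factors move entries only up and to the right, so with this numbering the
  sums obey Cauchy products.\<close>

definition d :: "nat \<times> nat \<Rightarrow> 'a mat \<Rightarrow> nat \<Rightarrow> 'a" where
  "d s g l = (\<Sum>j<l. E g (fst s + (r - l + j)) (snd s + j))"

definition D :: "'a mat \<Rightarrow> 'a fps" where
  "D g = Abs_fps (\<lambda>l. if l \<le> r then (\<Sum>s\<leftarrow>blocks. d s g l) else 0)"

text \<open>The arcs from \<open>M\<close> and from the rows of \<open>C\<close> after
  \<open>3 * r\<close>. The arcs from \<open>A\<close> and \<open>B\<close> are accounted for by
  \<open>D\<close>, the one from \<open>3 * r\<close> by \<open>c g r\<close>.\<close>

definition Lam :: "'a mat \<Rightarrow> 'a" where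
  "Lam g = (\<Sum>a\<in>{r..<2 * r} \<union> {3 * r<..4 * r}. E g a (sg a))"

lemma A_nth: "fps_nth (A g) k = (if k \<le> r then c g k else 0)"
  by (simp add: A_def)

lemma A_0: "g \<in> P \<Longrightarrow> fps_nth (A g) 0 = 1"
  using c_0[OF P_UT] by (simp add: A_nth)

lemma A_mult: "g \<in> P \<Longrightarrow> h \<in> P \<Longrightarrow> fps_agree r (A (g * h)) (A g * A h)"
  using c_mult[of g h] by (auto simp: fps_agree_def A_nth fps_mult_nth atMost_atLeast0 intro!: sum.cong)

text \<open>Indices between the row block and the column block contribute nothing because of the
  zeros of \<open>P\<close> in rows \<open>M\<close> and columns \<open>2 * r\<close> to
  \<open>3 * r\<close>. The block from \<open>M\<close> to \<open>C\<close> starts at column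
  \<open>3 * r + 1\<close>, which is why these zeros reach one column past \<open>B\<close>.\<close>

lemma block_mult:
  assumes g: "g \<in> P" and h: "h \<in> P" and s: "(s, t) \<in> set blocks" and ij: "i < r" "j < r"
  shows "E (g * h) (s + i) (t + j) =
    (\<Sum>m\<in>{i..<r}. c g (m - i) * E h (s + m) (t + j)) + (\<Sum>m\<in>{..j}. E g (s + i) (t + m) * c h (j - m))"
proof -
  have st: "s + r \<le> t" "t + r \<le> n" "s \<in> {0, r, 2 * r}" "t \<in> {r, 2 * r, 3 * r, 3 * r + 1}"
    using s n by (auto simp: blocks_def)
  have "E (g * h) (s + i) (t + j) = (\<Sum>m\<in>{s + i..<s + r} \<union> {t..t + j}. E g (s + i) m * E h m (t + j))"
  proof (intro E_mult_on P_UT g h)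
    fix m assume m: "m \<le> t + j" "s + i \<le> m" "m \<notin> {s + i..<s + r} \<union> {t..t + j}"
    then have "s + r \<le> m" "m < t" by auto
    then consider "r \<le> m" "m < 2 * r" "t = 2 * r" | "s = r" "2 * r \<le> m" "m \<le> 3 * r"
      using s by (auto simp: blocks_def)
    then show "E g (s + i) m = 0 \<or> E h m (t + j) = 0"
    proof cases
      case 1
      then show ?thesis using P_zero_MB[OF h, of m "t + j"] ij by auto
    next
      case 2
      then show ?thesis using P_zero_MB[OF g, of "s + i" m] ij by auto
    qed
  qed (use st ij in auto)
  also have "\<dots> = (\<Sum>m\<in>{s + i..<s + r}. E g (s + i) m * E h m (t + j)) +
      (\<Sum>m\<in>{t..t + j}. E g (s + i) m * E h m (t + j))"
    using st by (intro sum.union_disjoint) auto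
  also have "(\<Sum>m\<in>{s + i..<s + r}. E g (s + i) m * E h m (t + j)) =
      (\<Sum>m\<in>{i..<r}. E g (s + i) (s + m) * E h (s + m) (t + j))"
    by (intro sum.reindex_bij_witness[where i = "\<lambda>m. s + m" and j = "\<lambda>m. m - s"]) auto
  also have "\<dots> = (\<Sum>m\<in>{i..<r}. c g (m - i) * E h (s + m) (t + j))"
    using P_toeplitz[OF g, of s i] st by (intro sum.cong refl) auto
  also have "(\<Sum>m\<in>{t..t + j}. E g (s + i) m * E h m (t + j)) =
      (\<Sum>m\<in>{..j}. E g (s + i) (t + m) * E h (t + m) (t + j))"
    by (intro sum.reindex_bij_witness[where i = "\<lambda>m. t + m" and j = "\<lambda>m. m - t"]) auto
  also have "\<dots> = (\<Sum>m\<in>{..j}. E g (s + i) (t + m) * c h (j - m))"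
    using P_toeplitz[OF h, of t _ j] st ij by (intro sum.cong refl) auto
  finally show ?thesis .
qed

text \<open>A Toeplitz coefficient of index \<open>k\<close> shifts a diagonal by \<open>k\<close>;
  reindexing the double sums by this shift turns them into two Cauchy products.\<close>

lemma d_mult:
  assumes g: "g \<in> P" and h: "h \<in> P" and s: "s \<in> set blocks" and l: "l \<le> r"
  shows "d s (g * h) l = (\<Sum>k\<le>l. c g k * d s h (l - k)) + (\<Sum>k\<le>l. d s g k * c h (l - k))"
proof -
  obtain a b where ab: "s = (a, b)" by (cases s)
  have "d s (g * h) l = (\<Sum>j<l. (\<Sum>m\<in>{r - l + j..<r}. c g (m - (r - l + j)) * E h (a + m) (b + j)) +
      (\<Sum>m\<in>{..j}. E g (a + (r - l + j)) (b + m) * c h (j - m)))"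
    unfolding d_def ab fst_conv snd_conv using l s ab
    by (intro sum.cong refl block_mult[OF g h]) auto
  also have "\<dots> = (\<Sum>j<l. \<Sum>m\<in>{r - l + j..<r}. c g (m - (r - l + j)) * E h (a + m) (b + j)) +
      (\<Sum>j<l. \<Sum>m\<in>{..j}. E g (a + (r - l + j)) (b + m) * c h (j - m))"
    by (rule sum.distrib)
  also have "(\<Sum>j<l. \<Sum>m\<in>{r - l + j..<r}. c g (m - (r - l + j)) * E h (a + m) (b + j)) =
      (\<Sum>(k, j)\<in>Sigma {..l} (\<lambda>k. {..<l - k}). c g k * E h (a + (r - (l - k) + j)) (b + j))"
    unfolding sum.Sigma[OF finite_lessThan ballI[OF finite_atLeastLessThan]] using l
    by (intro sum.reindex_bij_witness[where i = "\<lambda>(k, j). (j, r - l + j + k)"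
          and j = "\<lambda>(j, m). (m - (r - l + j), j)"]) auto
  also have "\<dots> = (\<Sum>k\<le>l. c g k * d s h (l - k))"
    unfolding d_def ab fst_conv snd_conv sum_distrib_left by (subst sum.Sigma) auto
  also have "(\<Sum>j<l. \<Sum>m\<in>{..j}. E g (a + (r - l + j)) (b + m) * c h (j - m)) =
      (\<Sum>(k, m)\<in>Sigma {..l} (\<lambda>k. {..<k}). E g (a + (r - k + m)) (b + m) * c h (l - k))"
    unfolding sum.Sigma[OF finite_lessThan ballI[OF finite_atMost]] using l
    by (intro sum.reindex_bij_witness[where i = "\<lambda>(k, m). (l - k + m, m)"
          and j = "\<lambda>(j, m). (l - (j - m), m)"]) auto
  also have "\<dots> = (\<Sum>k\<le>l. d s g k * c h (l - k))"
    unfolding d_def ab fst_conv snd_conv sum_distrib_right by (subst sum.Sigma) auto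
  finally show ?thesis .
qed

lemma D_nth: "fps_nth (D g) l = (if l \<le> r then \<Sum>s\<leftarrow>blocks. d s g l else 0)"
  by (simp add: D_def)

lemma D_mult:
  assumes g: "g \<in> P" and h: "h \<in> P"
  shows "fps_agree r (D (g * h)) (A g * D h + D g * A h)"
  unfolding fps_agree_def
proof (intro allI impI)
  fix l assume l: "l \<le> r"
  have "fps_nth (D (g * h)) l =
     (\<Sum>s\<leftarrow>blocks. (\<Sum>k\<le>l. c g k * d s h (l - k)) + (\<Sum>k\<le>l. d s g k * c h (l - k)))"
    unfolding D_nth using l d_mult[OF g h _ l] by (auto intro!: arg_cong[of _ _ sum_list] map_cong)
  also have "\<dots> = (\<Sum>k\<le>l. c g k * (\<Sum>s\<leftarrow>blocks. d s h (l - k))) + (\<Sum>k\<le>l. (\<Sum>s\<leftarrow>blocks. d s g k) * c h (l - k))"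
    by (simp add: blocks_def sum.distrib distrib_left distrib_right add_ac)
  also have "\<dots> = fps_nth (A g * D h + D g * A h) l"
    using l by (auto simp: fps_mult_nth A_nth D_nth atMost_atLeast0
        intro!: arg_cong2[where f = "(+)"] sum.cong)
  finally show "fps_nth (D (g * h)) l = fps_nth (A g * D h + D g * A h) l" .
qed

text \<open>Strictly inside one of these arcs each intermediate index meets a zero entry of
  \<open>g\<close> or of \<open>h\<close>, so only the two endpoints contribute.\<close>

lemma Lam_mult:
  assumes g: "g \<in> P" and h: "h \<in> P"
  shows "Lam (g * h) = Lam g + Lam h"
proof -
  note U = P_UT[OF g] P_UT[OF h]
  have "E (g * h) a (sg a) = E g a (sg a) + E h a (sg a)"
    if a: "a \<in> {r..<2 * r} \<union> {3 * r<..4 * r}" for a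
  proof -
    have s: "a < sg a" "sg a < n" using a n by (auto simp: arc_end_def)
    have "E (g * h) a (sg a) = (\<Sum>m\<in>{a, sg a}. E g a m * E h m (sg a))"
    proof (intro E_mult_on U)
      fix m assume m: "a \<le> m" "m \<le> sg a" "m \<notin> {a, sg a}"
      then have m: "a < m" "m < sg a" by auto
      consider "r \<le> a" "a < 2 * r" "sg a = a + 3 * r + 1" | "3 * r < a" "a \<le> 4 * r" "sg a = a + 2 * r"
        using a by (auto simp: arc_end_def)
      then show "E g a m = 0 \<or> E h m (sg a) = 0"
      proof cases
        case 1
        then show ?thesis using P_zero_MB[OF g, of a m] P_zero_M[OF g, of a m]
            P_zero_M[OF h, of m "sg a"] P_zero_C[OF h, of m "sg a"] m by linarith
      next
        case 2
        then show ?thesis using P_zero_C[OF g, of a m] P_zero_C[OF h, of m "sg a"] m by linarith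
      qed
    qed (use s in auto)
    then show ?thesis using s U n by (simp add: E_diag)
  qed
  then show ?thesis by (simp add: Lam_def sum.distrib)
qed

definition \<omega> :: "'a fps \<Rightarrow> complex" where
  "\<omega> = (SOME \<omega>. (\<forall>f g. fps_nth f 0 = 1 \<longrightarrow> fps_nth g 0 = 1 \<longrightarrow> \<omega> (f * g) = \<omega> f * \<omega> g) \<and>
    (\<forall>f. fps_nth f 0 = 1 \<longrightarrow> \<omega> f \<noteq> 0) \<and> (\<forall>f g. fps_agree r f g \<longrightarrow> \<omega> f = \<omega> g) \<and>
    (\<forall>x. \<omega> (1 + fps_const x * fps_X ^ r) = \<theta> x))"

lemma \<omega>:
  "fps_nth f 0 = 1 \<Longrightarrow> fps_nth g 0 = 1 \<Longrightarrow> \<omega> (f * g) = \<omega> f * \<omega> g"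
  "fps_nth f 0 = 1 \<Longrightarrow> \<omega> f \<noteq> 0"
  "fps_agree r f g \<Longrightarrow> \<omega> f = \<omega> g"
  "\<omega> (1 + fps_const x * fps_X ^ r) = \<theta> x"
proof -
  have "r > 0" using r2 by simp
  then have "\<exists>\<omega>. (\<forall>f g. fps_nth f 0 = 1 \<longrightarrow> fps_nth g 0 = 1 \<longrightarrow> \<omega> (f * g) = \<omega> f * \<omega> g) \<and>
    (\<forall>f. fps_nth f 0 = 1 \<longrightarrow> \<omega> f \<noteq> 0) \<and> (\<forall>f g. fps_agree r f g \<longrightarrow> \<omega> f = \<omega> g) \<and>
    (\<forall>x. \<omega> (1 + fps_const x * fps_X ^ r) = \<theta> x)"
    by (rule unit_fps_character_exists[OF \<theta>]) blast
  from someI_ex[OF this] show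
    "fps_nth f 0 = 1 \<Longrightarrow> fps_nth g 0 = 1 \<Longrightarrow> \<omega> (f * g) = \<omega> f * \<omega> g"
    "fps_nth f 0 = 1 \<Longrightarrow> \<omega> f \<noteq> 0"
    "fps_agree r f g \<Longrightarrow> \<omega> f = \<omega> g"
    "\<omega> (1 + fps_const x * fps_X ^ r) = \<theta> x" unfolding \<omega>_def[symmetric] by blast+
qed

definition tau :: "'a mat \<Rightarrow> complex" where
  "tau g = \<omega> (A g) * \<theta> (fps_nth (D g * inverse (A g)) r + Lam g)"

lemma \<theta>_add: "\<theta> (x + y) = \<theta> x * \<theta> y" and \<theta>_nz: "\<theta> x \<noteq> 0"
  using \<theta> by (simp_all add: nontrivial_additive_hom_def)

lemma tau_mult:
  assumes g: "g \<in> P" and h: "h \<in> P"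
  shows "tau (g * h) = tau g * tau h"
proof -
  have A0: "fps_nth (A g) 0 = 1" "fps_nth (A h) 0 = 1" "fps_nth (A (g * h)) 0 = 1"
    using g h P_mult by (simp_all add: A_0)
  have "\<omega> (A (g * h)) = \<omega> (A g) * \<omega> (A h)"
    using \<omega>(3)[OF A_mult[OF g h]] \<omega>(1)[OF A0(1,2)] by simp
  moreover have "fps_nth (D (g * h) * inverse (A (g * h))) r =
      fps_nth (D g * inverse (A g)) r + fps_nth (D h * inverse (A h)) r"
  proof -
    have "fps_agree r (D (g * h) * inverse (A (g * h))) ((A g * D h + D g * A h) * inverse (A g * A h))"
      using A0 by (intro fps_agree_mult D_mult[OF g h] fps_agree_inverse A_mult[OF g h]) auto
    also have "(A g * D h + D g * A h) * inverse (A g * A h) =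
        D h * inverse (A h) * (A g * inverse (A g)) + D g * inverse (A g) * (A h * inverse (A h))"
      by (simp add: fps_inverse_mult algebra_simps)
    also have "\<dots> = D g * inverse (A g) + D h * inverse (A h)"
      using A0 by (simp add: inverse_mult_eq_1')
    finally show ?thesis by (simp add: fps_agree_def)
  qed
  ultimately show ?thesis by (simp add: tau_def Lam_mult[OF g h] \<theta>_add)
qed

lemma tau_nz: "g \<in> P \<Longrightarrow> tau g \<noteq> 0"
  using \<omega>(2)[OF A_0] \<theta>_nz by (simp add: tau_def)

text \<open>The first sum is the rescaled quasi-monomial form itself; the other two are what later
  identifies the diagonal block on \<open>M\<close> with those on \<open>A\<close> and on the last
  rows of \<open>C\<close>.\<close>

definition F :: "'a mat \<Rightarrow> 'a" where
  "F g = (\<Sum>a\<le>4 * r. E g a (sg a)) + (\<Sum>j<r. E g j (r + j)) + (\<Sum>j<r. E g (r + j) (3 * r + 1 + j))"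

lemma tau_N:
  assumes g: "g \<in> N"
  shows "tau g = \<theta> (F g)"
proof -
  have gP: "g \<in> P" using g N_subset_P by auto
  have "fps_agree r (A g) (1 + fps_const (c g r) * fps_X ^ r)"
    using N_c[OF g] c_0[OF P_UT[OF gP]] r2 by (auto simp: fps_agree_def A_nth)
  then have \<omega>A: "\<omega> (A g) = \<theta> (c g r)" using \<omega>(3,4) by metis
  \<comment> \<open>\<open>D g\<close> has no constant term, so the coefficient of degree
    \<open>r\<close> in the product sees \<open>inverse (A g)\<close> only below degree
    \<open>r\<close>, where it agrees with 1.\<close>
  have "fps_agree (r - 1) (inverse (A g)) (inverse 1)"
    using N_c[OF g] c_0[OF P_UT[OF gP]] r2 by (intro fps_agree_inverse) (auto simp: fps_agree_def A_nth)
  then have inv: "fps_nth (inverse (A g)) k = (if k = 0 then 1 else 0)" if "k < r" for k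
    using that by (auto simp: fps_agree_def)
  have "fps_nth (D g * inverse (A g)) r = (\<Sum>k\<le>r. fps_nth (D g) k * fps_nth (inverse (A g)) (r - k))"
    by (simp add: fps_mult_nth atMost_atLeast0)
  also have "\<dots> = (\<Sum>k\<le>r. if k = r then fps_nth (D g) r else 0)"
  proof (rule sum.cong[OF refl])
    fix k assume "k \<in> {..r}"
    moreover have "fps_nth (D g) 0 = 0" by (simp add: D_nth d_def blocks_def)
    ultimately show "fps_nth (D g) k * fps_nth (inverse (A g)) (r - k) = (if k = r then fps_nth (D g) r else 0)"
      using inv[of "r - k"] r2 by (cases "k = 0") auto
  qed
  also have "\<dots> = fps_nth (D g) r" by simp
  also have "\<dots> = (\<Sum>j<r. E g j (r + j)) + (\<Sum>j<r. E g j (2 * r + j)) +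
      (\<Sum>j<r. E g (2 * r + j) (3 * r + j)) + (\<Sum>j<r. E g (r + j) (3 * r + 1 + j))"
    by (simp add: D_nth d_def blocks_def)
  finally have B: "fps_nth (D g * inverse (A g)) r = \<dots>" .
  have "{..4 * r} = {..<r} \<union> (({r..<2 * r} \<union> {3 * r<..4 * r}) \<union> ({2 * r..<3 * r} \<union> {3 * r}))" by auto
  then have "(\<Sum>a\<le>4 * r. E g a (sg a)) = (\<Sum>a<r. E g a (sg a)) + Lam g +
      (\<Sum>a\<in>{2 * r..<3 * r}. E g a (sg a)) + E g (3 * r) (sg (3 * r))"
    unfolding Lam_def
    by (simp only:) (subst sum.union_disjoint, auto, subst sum.union_disjoint, auto)
  also have "(\<Sum>a<r. E g a (sg a)) = (\<Sum>j<r. E g j (2 * r + j))"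
    by (intro sum.cong refl) (simp add: arc_end_def add.commute)
  also have "(\<Sum>a\<in>{2 * r..<3 * r}. E g a (sg a)) = (\<Sum>j<r. E g (2 * r + j) (3 * r + j))"
    by (intro sum.reindex_bij_witness[where i = "\<lambda>j. 2 * r + j" and j = "\<lambda>m. m - 2 * r"])
      (auto simp: arc_end_def algebra_simps)
  also have "E g (3 * r) (sg (3 * r)) = c g r" using r2 by (simp add: arc_end_def c_def add.commute)
  finally have "F g = c g r + (fps_nth (D g * inverse (A g)) r + Lam g)"
    unfolding F_def B by (simp add: algebra_simps)
  then show ?thesis by (simp add: tau_def \<omega>A \<theta>_add)
qed

end

section \<open>Mackey's criterion for the inducing subgroup\<close>

context exotic_data
begin

definition el :: "nat \<Rightarrow> nat \<Rightarrow> 'a mat" where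
  "el a b = mat n n (\<lambda>(i, j). if i = a \<and> j = b then w b / w a else 0)"

lemma el_carrier[simp]: "el a b \<in> carrier_mat n n"
  by (simp add: el_def)

lemma el_strictly_upper: "a < b \<Longrightarrow> el a b \<in> strictly_upper n"
  by (auto simp: el_def strictly_upper_def)

lemma E_el: "i < n \<Longrightarrow> j < n \<Longrightarrow> E (el a b) i j = (if i = a \<and> j = b then 1 else 0)"
  using w by (simp add: E_def el_def)

lemma E_mult_el:
  assumes "g \<in> carrier_mat n n" "i < n" "j < n" "a < n" "b < n"
  shows "E (g * el a b) i j = (if j = b then E g i a else 0)"
proof -
  have "E (g * el a b) i j = (\<Sum>m<n. E g i m * E (el a b) m j)"
    using assms by (intro E_mult) auto
  also have "\<dots> = (\<Sum>m<n. if m = a then if j = b then E g i a else 0 else 0)"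
    using assms by (intro sum.cong refl) (simp add: E_el)
  finally show ?thesis using assms by simp
qed

lemma E_el_mult:
  assumes "g \<in> carrier_mat n n" "i < n" "j < n" "a < n" "b < n"
  shows "E (el a b * g) i j = (if i = a then E g b j else 0)"
proof -
  have "E (el a b * g) i j = (\<Sum>m<n. E (el a b) i m * E g m j)"
    using assms by (intro E_mult) auto
  also have "\<dots> = (\<Sum>m<n. if m = b then if i = a then E g b j else 0 else 0)"
    using assms by (intro sum.cong refl) (simp add: E_el)
  finally show ?thesis using assms by simp
qed

lemma sg_bounds: "a \<le> 4 * r \<Longrightarrow> a < sg a \<and> 2 * r \<le> sg a \<and> sg a \<le> 6 * r"
  using r2 by (auto simp: arc_end_def)

lemma sg_inj: "a \<le> 4 * r \<Longrightarrow> b \<le> 4 * r \<Longrightarrow> sg a = sg b \<Longrightarrow> a = b"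
  by (auto simp: arc_end_def split: if_splits)

lemma J_bounds: "a \<le> 4 * r \<Longrightarrow> b \<in> J a \<Longrightarrow> a < b \<and> b < sg a"
  using r2 by (auto simp: J_def arc_end_def split: if_splits)

lemma E_one_plus: "X \<in> carrier_mat n n \<Longrightarrow> a \<noteq> b \<Longrightarrow> a < n \<Longrightarrow> b < n \<Longrightarrow> E (1\<^sub>m n + X) a b = E X a b"
  by (simp add: E_def)

lemma E_smult: "X \<in> carrier_mat n n \<Longrightarrow> a < n \<Longrightarrow> b < n \<Longrightarrow> E (x \<cdot>\<^sub>m X) a b = x * E X a b"
  by (simp add: E_def)

lemma F_one_plus:
  assumes "X \<in> carrier_mat n n"
  shows "F (1\<^sub>m n + X) = F X"
proof -
  have "E (1\<^sub>m n + X) a (sg a) = E X a (sg a)" if "a \<le> 4 * r" for a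
    using sg_bounds[OF that] n assms that by (intro E_one_plus) auto
  moreover have "E (1\<^sub>m n + X) j (r + j) = E X j (r + j)"
    "E (1\<^sub>m n + X) (r + j) (3 * r + 1 + j) = E X (r + j) (3 * r + 1 + j)" if "j < r" for j
    using n assms that by (intro E_one_plus; simp)+
  ultimately show ?thesis by (simp add: F_def)
qed

lemma F_smult:
  assumes "X \<in> carrier_mat n n"
  shows "F (x \<cdot>\<^sub>m X) = x * F X"
proof -
  have "E (x \<cdot>\<^sub>m X) a (sg a) = x * E X a (sg a)" if "a \<le> 4 * r" for a
    using sg_bounds[OF that] n assms that by (intro E_smult) auto
  moreover have "E (x \<cdot>\<^sub>m X) j (r + j) = x * E X j (r + j)"
    "E (x \<cdot>\<^sub>m X) (r + j) (3 * r + 1 + j) = x * E X (r + j) (3 * r + 1 + j)" if "j < r" for j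
    using n assms that by (intro E_smult; simp)+
  ultimately show ?thesis by (simp add: F_def sum_distrib_left distrib_left)
qed

definition Jzero :: "'a mat \<Rightarrow> bool" where
  "Jzero X \<longleftrightarrow> (\<forall>a\<le>4 * r. \<forall>b\<in>J a. E X a b = 0)"

lemma one_plus_N:
  assumes "X \<in> strictly_upper n" "Jzero X"
  shows "1\<^sub>m n + X \<in> N"
proof -
  have "E (1\<^sub>m n + X) a b = 0" if ab: "a \<le> 4 * r" "b \<in> J a" for a b
  proof -
    have "E (1\<^sub>m n + X) a b = E X a b"
      using J_bounds[OF ab] sg_bounds[OF ab(1)] n assms(1)
      by (intro E_one_plus strictly_upper_carrier) auto
    then show ?thesis using ab assms(2) by (simp add: Jzero_def)
  qed
  then show ?thesis using UT_one_plus[OF assms(1)] by (simp add: N_def)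
qed

lemma Jzero_smult:
  assumes "X \<in> carrier_mat n n" "Jzero X"
  shows "Jzero (x \<cdot>\<^sub>m X)"
proof -
  have "E (x \<cdot>\<^sub>m X) a b = x * E X a b" if ab: "a \<le> 4 * r" "b \<in> J a" for a b
    using J_bounds[OF ab] sg_bounds[OF ab(1)] n assms(1) by (intro E_smult) auto
  then show ?thesis using assms(2) by (simp add: Jzero_def)
qed

definition witness :: "'a mat \<Rightarrow> bool" where
  "witness g \<longleftrightarrow> (\<exists>h\<in>N. g * h * inv\<^bsub>UT n\<^esub> g \<in> P \<and> tau (g * h * inv\<^bsub>UT n\<^esub> g) \<noteq> tau h)"

text \<open>Conjugation by \<open>g\<close> takes \<open>1 + z * g\<close> to
  \<open>1 + g * z\<close>, which avoids computing the inverse of \<open>g\<close>. Both elements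
  lie in \<open>N\<close>, where \<open>tau\<close> is \<theta> of \<open>F\<close>; scaling
  \<open>y\<close> makes the two values of \<open>F\<close> differ by an \<open>x\<close> with
  \<open>\<theta> x \<noteq> 1\<close>.\<close>

lemma witnessI:
  assumes g: "g \<in> carrier (UT n)" and y: "y \<in> strictly_upper n"
    and J: "Jzero (g * y)" "Jzero (y * g)" and F: "F (g * y) \<noteq> F (y * g)"
  shows "witness g"
proof -
  note gc = UT_carrier_mat[OF g] and yc = strictly_upper_carrier[OF y]
  obtain x where x: "\<theta> x \<noteq> 1" using \<theta> by (auto simp: nontrivial_additive_hom_def)
  define s where "s = x / (F (g * y) - F (y * g))"
  define z where "z = s \<cdot>\<^sub>m y"
  have z: "z \<in> strictly_upper n" using y by (simp add: z_def strictly_upper_smult)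
  note zc = strictly_upper_carrier[OF z]
  have gz: "g * z = s \<cdot>\<^sub>m (g * y)" and zg: "z * g = s \<cdot>\<^sub>m (y * g)"
    using gc yc by (simp_all add: z_def mult_smult_distrib[of _ n n _ n] mult_smult_assoc_mat[of _ n n _ n])
  have U: "g * z \<in> strictly_upper n" "z * g \<in> strictly_upper n"
    using z g UT_mult_strictly_upper strictly_upper_mult_UT by blast+
  note Uc = U[THEN strictly_upper_carrier]
  have "1\<^sub>m n + z * g \<in> N" "1\<^sub>m n + g * z \<in> N"
    using J gc yc by (auto intro!: one_plus_N U) (simp_all add: gz zg Jzero_smult)
  moreover have "g * (1\<^sub>m n + z * g) * inv\<^bsub>UT n\<^esub> g = 1\<^sub>m n + g * z"
  proof -
    have "g * (1\<^sub>m n + z * g) = g * 1\<^sub>m n + g * (z * g)"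
      using gc zc by (intro mult_add_distrib_mat[of _ n n _ n]) auto
    also have "g * (z * g) = g * z * g" using gc zc by (intro assoc_mult_mat[symmetric, of _ n n _ n _ n]) auto
    also have "g * 1\<^sub>m n + g * z * g = (1\<^sub>m n + g * z) * g"
      using gc zc by (subst add_mult_distrib_mat[of _ n n _ _ n]) auto
    finally have "g * (1\<^sub>m n + z * g) * inv\<^bsub>UT n\<^esub> g = (1\<^sub>m n + g * z) * g * inv\<^bsub>UT n\<^esub> g" by simp
    also have "\<dots> = (1\<^sub>m n + g * z) * (g * inv\<^bsub>UT n\<^esub> g)"
      using gc zc g by (intro assoc_mult_mat[of _ n n _ n _ n]) auto
    also have "g * inv\<^bsub>UT n\<^esub> g = 1\<^sub>m n" using group.r_inv[OF group_UT g] by simp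
    finally show ?thesis using gc zc by simp
  qed
  moreover have "tau (1\<^sub>m n + g * z) \<noteq> tau (1\<^sub>m n + z * g)"
  proof -
    have "F (1\<^sub>m n + g * z) = s * F (g * y)" "F (1\<^sub>m n + z * g) = s * F (y * g)"
      using gc yc zc by (simp_all add: F_one_plus gz zg F_smult)
    moreover have "s * F (g * y) = x + s * F (y * g)" using F by (simp add: s_def field_simps)
    ultimately have "tau (1\<^sub>m n + g * z) = \<theta> x * tau (1\<^sub>m n + z * g)"
      using \<open>1\<^sub>m n + z * g \<in> N\<close> \<open>1\<^sub>m n + g * z \<in> N\<close> by (simp add: tau_N \<theta>_add)
    then show ?thesis
      using x tau_nz[of "1\<^sub>m n + z * g"] \<open>1\<^sub>m n + z * g \<in> N\<close> N_subset_P by auto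
  qed
  ultimately show ?thesis unfolding witness_def using N_subset_P by (intro bexI[of _ "1\<^sub>m n + z * g"]) auto
qed

lemma sum_shift_delta:
  "(\<Sum>j<r. if s + j = b then f j else 0) = (if s \<le> b \<and> b < s + r then f (b - s) else (0 :: 'a))"
proof (cases "s \<le> b")
  case True
  then have "(\<Sum>j<r. if s + j = b then f j else 0) = (\<Sum>j<r. if j = b - s then f j else 0)"
    by (intro sum.cong refl) auto
  then show ?thesis using True by auto
qed (auto intro!: sum.neutral)

text \<open>In rescaled coordinates \<open>g * el a b\<close> is column \<open>a\<close> of
  \<open>g\<close> placed in column \<open>b\<close>, and \<open>el a b * g\<close> is row
  \<open>b\<close> of \<open>g\<close> placed in row \<open>a\<close>. The assumptions
  \<open>col\<close> and \<open>row\<close> say that both vanish on \<open>J\<close>, and the three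
  terms on either side come from the three sums in \<open>F\<close>.\<close>

lemma no_witness_test:
  assumes g: "g \<in> carrier (UT n)" and nw: "\<not> witness g" and ab: "a < b" "b < n"
    and col: "\<And>i. i \<le> 4 * r \<Longrightarrow> b \<in> J i \<Longrightarrow> E g i a = 0"
    and row: "\<And>j. a \<le> 4 * r \<Longrightarrow> j \<in> J a \<Longrightarrow> E g b j = 0"
  shows "(\<Sum>i\<le>4 * r. if sg i = b then E g i a else 0)
      + (if r \<le> b \<and> b < r + r then E g (b - r) a else 0)
      + (if 3 * r + 1 \<le> b \<and> b < 3 * r + 1 + r then E g (r + (b - (3 * r + 1))) a else 0)
    = (if a \<le> 4 * r then E g b (sg a) else 0) + (if a < r then E g b (r + a) else 0)
      + (if r \<le> a \<and> a < r + r then E g b (3 * r + 1 + (a - r)) else 0)"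
proof -
  note gc = UT_carrier_mat[OF g]
  have an: "a < n" using ab by simp
  have bound: "i < n \<and> j < n" if "i \<le> 4 * r" "j \<in> J i" for i j
    using J_bounds[OF that] sg_bounds[OF that(1)] n that by auto
  have "Jzero (g * el a b)" "Jzero (el a b * g)"
    unfolding Jzero_def using bound col row
    by (auto simp: E_mult_el[OF gc _ _ an ab(2)] E_el_mult[OF gc _ _ an ab(2)])
  then have "F (g * el a b) = F (el a b * g)"
    using witnessI[OF g el_strictly_upper[OF ab(1)]] nw by blast
  moreover have "F (g * el a b) = (\<Sum>i\<le>4 * r. if sg i = b then E g i a else 0)
      + (if r \<le> b \<and> b < r + r then E g (b - r) a else 0)
      + (if 3 * r + 1 \<le> b \<and> b < 3 * r + 1 + r then E g (r + (b - (3 * r + 1))) a else 0)"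
  proof -
    have "(\<Sum>i\<le>4 * r. E (g * el a b) i (sg i)) = (\<Sum>i\<le>4 * r. if sg i = b then E g i a else 0)"
    proof (intro sum.cong refl)
      fix i assume "i \<in> {..4 * r}"
      then show "E (g * el a b) i (sg i) = (if sg i = b then E g i a else 0)"
        using sg_bounds[of i] n by (intro E_mult_el[OF gc _ _ an ab(2)]) auto
    qed
    moreover have "(\<Sum>j<r. E (g * el a b) j (r + j)) = (\<Sum>j<r. if r + j = b then E g j a else 0)"
      using n by (intro sum.cong refl E_mult_el[OF gc _ _ an ab(2)]) auto
    moreover have "(\<Sum>j<r. E (g * el a b) (r + j) (3 * r + 1 + j)) =
        (\<Sum>j<r. if 3 * r + 1 + j = b then E g (r + j) a else 0)"
      using n by (intro sum.cong refl E_mult_el[OF gc _ _ an ab(2)]) auto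
    ultimately show ?thesis unfolding F_def sum_shift_delta by simp
  qed
  moreover have "F (el a b * g) = (if a \<le> 4 * r then E g b (sg a) else 0) + (if a < r then E g b (r + a) else 0)
      + (if r \<le> a \<and> a < r + r then E g b (3 * r + 1 + (a - r)) else 0)"
  proof -
    have "(\<Sum>i\<le>4 * r. E (el a b * g) i (sg i)) = (\<Sum>i\<le>4 * r. if i = a then E g b (sg i) else 0)"
    proof (intro sum.cong refl)
      fix i assume "i \<in> {..4 * r}"
      then show "E (el a b * g) i (sg i) = (if i = a then E g b (sg i) else 0)"
        using sg_bounds[of i] n by (intro E_el_mult[OF gc _ _ an ab(2)]) auto
    qed
    moreover have "(\<Sum>j<r. E (el a b * g) j (r + j)) = (\<Sum>j<r. if j = a then E g b (r + j) else 0)"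
      using n by (intro sum.cong refl E_el_mult[OF gc _ _ an ab(2)]) auto
    moreover have "(\<Sum>j<r. E (el a b * g) (r + j) (3 * r + 1 + j)) =
        (\<Sum>j<r. if r + j = a then E g b (3 * r + 1 + j) else 0)"
      using n by (intro sum.cong refl E_el_mult[OF gc _ _ an ab(2)]) auto
    ultimately show ?thesis unfolding F_def sum_shift_delta by simp
  qed
  ultimately show ?thesis by simp
qed

lemma sum_sg_hit:
  assumes "k \<le> 4 * r" "sg k = b"
  shows "(\<Sum>i\<le>4 * r. if sg i = b then f i else 0) = (f k :: 'a)"
proof -
  have "(\<Sum>i\<le>4 * r. if sg i = b then f i else 0) = (\<Sum>i\<le>4 * r. if i = k then f i else 0)"
    using assms sg_inj by (intro sum.cong refl) auto
  then show ?thesis using assms by simp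
qed

lemma sum_sg_miss:
  "r \<le> b \<Longrightarrow> b < 2 * r \<Longrightarrow> (\<Sum>i\<le>4 * r. if sg i = b then f i else 0) = (0 :: 'a)"
  using sg_bounds by (intro sum.neutral) fastforce

context
  fixes g assumes g: "g \<in> carrier (UT n)" and nw: "\<not> witness g"
begin

text \<open>Test against \<open>el a (arc_end r b)\<close>; longer arcs ending further to the right have been treated before.\<close>

lemma no_witness_zero:
  "b \<le> 4 * r \<Longrightarrow> sg b = k \<Longrightarrow> b < a \<Longrightarrow> a < k \<Longrightarrow> \<not> (a \<le> 4 * r \<and> k < sg a) \<Longrightarrow> E g b a = 0"
proof (induction "n - k" arbitrary: k a b rule: less_induct)
  case less
  have k: "k \<le> 6 * r" using less.prems sg_bounds by auto
  have low: "E g i j = 0" if "j < i" "i \<le> 6 * r" for i j using that n g by (intro E_lower) auto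
  \<comment> \<open>The arc from \<open>i\<close> passes over column \<open>k\<close> and ends to
    its right, so the induction hypothesis applies when \<open>i < a\<close>. The last assumption
    excludes \<open>i = a\<close>, and for \<open>a < i\<close> the entry is below the
    diagonal.\<close>
  have col: "E g i a = 0" if i: "i \<le> 4 * r" "k \<in> J i" for i
  proof -
    have ik: "i < k" "k < sg i" using J_bounds[OF i] by auto
    show ?thesis
    proof (cases "i < a")
      case True
      show ?thesis
      proof (rule less.hyps[OF _ i(1) refl True])
        show "n - sg i < n - k" using ik k n by auto
        show "a < sg i" "\<not> (a \<le> 4 * r \<and> sg i < sg a)" using ik less.prems by auto
      qed
    next
      case False
      then have "i \<noteq> a" using ik i less.prems by auto
      then show ?thesis using False i by (intro low) auto
    qed
  qed
  have row: "E g k j = 0" if "a \<le> 4 * r" "j \<in> J a" for j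
    using J_bounds[OF that] less.prems that k by (intro low) auto
  have eq: "(\<Sum>i\<le>4 * r. if sg i = k then E g i a else 0)
      + (if r \<le> k \<and> k < r + r then E g (k - r) a else 0)
      + (if 3 * r + 1 \<le> k \<and> k < 3 * r + 1 + r then E g (r + (k - (3 * r + 1))) a else 0)
    = (if a \<le> 4 * r then E g k (sg a) else 0) + (if a < r then E g k (r + a) else 0)
      + (if r \<le> a \<and> a < r + r then E g k (3 * r + 1 + (a - r)) else 0)"
    using less.prems k n by (intro no_witness_test[OF g nw] col row) auto
  have "(if r \<le> k \<and> k < r + r then E g (k - r) a else 0) = 0"
    using sg_bounds[of b] less.prems by auto
  moreover have "\<not> (3 * r + 1 \<le> k \<and> k < 3 * r + 1 + r)"
    using less.prems by (auto simp: arc_end_def split: if_splits)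
  moreover have "E g k (sg a) = 0" if "a \<le> 4 * r"
  proof -
    have "sg a \<noteq> k" using sg_inj[of a b] that less.prems by auto
    then show ?thesis using that less.prems k by (intro low) auto
  qed
  moreover have "E g k (r + a) = 0" if "a < r"
    using that less.prems k r2 by (intro low) (auto simp: arc_end_def)
  moreover have "E g k (3 * r + 1 + (a - r)) = 0" if "r \<le> a" "a < r + r"
    using that less.prems k r2 by (intro low) (auto simp: arc_end_def)
  ultimately show ?case using eq sum_sg_hit[OF less.prems(1,2), of "\<lambda>i. E g i a"] by auto
qed

section \<open>Identification of the diagonal blocks\<close>

lemma nw_low: "j < i \<Longrightarrow> i \<le> 6 * r \<Longrightarrow> E g i j = 0"
  using n g by (intro E_lower) auto

lemma nw_MB: "r \<le> a \<Longrightarrow> a < 2 * r \<Longrightarrow> 2 * r \<le> b \<Longrightarrow> b \<le> 3 * r \<Longrightarrow> E g a b = 0"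
  by (rule no_witness_zero[of a "sg a"]) (auto simp: arc_end_def)

lemma nw_M: "r \<le> a \<Longrightarrow> a < 2 * r \<Longrightarrow> 4 * r < b \<Longrightarrow> b < a + 3 * r + 1 \<Longrightarrow> E g a b = 0"
  by (rule no_witness_zero[of a "sg a"]) (auto simp: arc_end_def)

lemma nw_C: "3 * r < a \<Longrightarrow> a \<le> 4 * r \<Longrightarrow> 4 * r < b \<Longrightarrow> b < a + 2 * r \<Longrightarrow> E g a b = 0"
  by (rule no_witness_zero[of a "sg a"]) (auto simp: arc_end_def)

text \<open>Test against \<open>el j (2 * r + i)\<close>: the arc from \<open>i\<close> ends in
  column \<open>2 * r + i\<close> and the arc from \<open>j\<close> in column
  \<open>2 * r + j\<close>, while all other terms vanish.\<close>

lemma nw_link_AB: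
  assumes "i < j" "j < r"
  shows "E g i j = E g (2 * r + i) (2 * r + j)"
proof -
  have sg: "sg i = 2 * r + i" "sg j = 2 * r + j" using assms by (auto simp: arc_end_def)
  have "E g (2 * r + i) (r + j) = 0" using assms by (intro nw_low) auto
  moreover have "E g k j = 0" if "k \<le> 4 * r" "2 * r + i \<in> J k" for k
    using that assms by (intro nw_low) (auto simp: J_def split: if_splits)
  moreover have "E g (2 * r + i) k = 0" if "k \<in> J j" for k
    using that assms by (intro nw_low) (auto simp: J_def split: if_splits)
  ultimately show ?thesis
    using no_witness_test[OF g nw, of j "2 * r + i"] assms n r2 sg
      sum_sg_hit[of i "2 * r + i" "\<lambda>k. E g k j"]
    by (auto split: if_splits)
qed

lemma nw_link_BC:
  assumes "i < j" "j < r"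
  shows "E g (2 * r + i) (2 * r + j) = E g (3 * r + i) (3 * r + j)"
proof -
  have sg: "sg (2 * r + i) = 3 * r + i" "sg (2 * r + j) = 3 * r + j" using assms by (auto simp: arc_end_def)
  \<comment> \<open>For \<open>0 < i\<close> column \<open>3 * r + i\<close> also belongs to the
    block from \<open>M\<close> to \<open>C\<close>; the entry it brings in has its row in
    \<open>M\<close> and its column in \<open>B\<close>.\<close>
  have z: "E g (r + (3 * r + i - (3 * r + 1))) (2 * r + j) = 0" if "0 < i"
    using that assms by (intro nw_MB) auto
  have "E g k (2 * r + j) = 0" if "k \<le> 4 * r" "3 * r + i \<in> J k" for k
  proof (cases "k < 2 * r")
    case True
    then show ?thesis using that assms by (intro nw_MB) (auto simp: J_def split: if_splits)
  next
    case False
    then show ?thesis using that assms by (intro nw_low) (auto simp: J_def split: if_splits)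
  qed
  moreover have "E g (3 * r + i) k = 0" if "k \<in> J (2 * r + j)" for k
    using that assms by (intro nw_low) (auto simp: J_def split: if_splits)
  ultimately have "(\<Sum>k\<le>4 * r. if sg k = 3 * r + i then E g k (2 * r + j) else 0)
      = E g (3 * r + i) (3 * r + j)"
    using no_witness_test[OF g nw, of "2 * r + j" "3 * r + i"] assms n r2 z sg
    by (auto split: if_splits)
  then show ?thesis using sum_sg_hit[of "2 * r + i" "3 * r + i"] sg assms by simp
qed

text \<open>No arc ends in a column of \<open>M\<close>, so both sides come from the additional term
  of \<open>F\<close> on the block from \<open>A\<close> to \<open>M\<close>.\<close>

lemma nw_link_AM:
  assumes "i < j" "j < r"
  shows "E g i j = E g (r + i) (r + j)"
proof -
  have sg: "sg j = 2 * r + j" using assms by (auto simp: arc_end_def)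
  have "E g (r + i) (2 * r + j) = 0" using assms by (intro nw_MB) auto
  moreover have "E g k j = 0" if "k \<le> 4 * r" "r + i \<in> J k" for k
    using that assms by (intro nw_low) (auto simp: J_def split: if_splits)
  moreover have "E g (r + i) k = 0" if "k \<in> J j" for k
    using that assms by (intro nw_low) (auto simp: J_def split: if_splits)
  ultimately show ?thesis
    using no_witness_test[OF g nw, of j "r + i"] assms n r2 sg sum_sg_miss[of "r + i" "\<lambda>k. E g k j"]
    by (auto split: if_splits)
qed

text \<open>Here the additional term on the block from \<open>M\<close> to \<open>C\<close> acts.
  The arc ending in column \<open>3 * r + 1 + i\<close> starts below row \<open>r + j\<close> and
  gives an entry under the diagonal; the arc from \<open>r + j\<close> leads to an entry that
  \<open>nw_C\<close> makes zero.\<close>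

lemma nw_link_MC:
  assumes "i < j" "j < r"
  shows "E g (r + i) (r + j) = E g (3 * r + 1 + i) (3 * r + 1 + j)"
proof -
  have sg: "sg (2 * r + (i + 1)) = 3 * r + 1 + i" "sg (r + j) = 4 * r + 1 + j" using assms by (auto simp: arc_end_def)
  have "E g (3 * r + 1 + i) (4 * r + 1 + j) = 0" using assms by (intro nw_C) auto
  moreover have "E g k (r + j) = 0" if "k \<le> 4 * r" "3 * r + 1 + i \<in> J k" for k
    using that assms by (intro nw_low) (auto simp: J_def split: if_splits)
  moreover have "E g (3 * r + 1 + i) k = 0" if "k \<in> J (r + j)" for k
  proof (cases "k \<le> 3 * r")
    case True
    then show ?thesis using assms by (intro nw_low) auto
  next
    case False
    then show ?thesis using that assms by (intro nw_C) (auto simp: J_def split: if_splits)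
  qed
  moreover have "(\<Sum>k\<le>4 * r. if sg k = 3 * r + 1 + i then E g k (r + j) else 0) = 0"
  proof -
    have "(\<Sum>k\<le>4 * r. if sg k = 3 * r + 1 + i then E g k (r + j) else 0) = E g (2 * r + (i + 1)) (r + j)"
      using assms sg by (intro sum_sg_hit) auto
    also have "\<dots> = 0" using assms by (intro nw_low) auto
    finally show ?thesis .
  qed
  ultimately show ?thesis
    using no_witness_test[OF g nw, of "r + j" "3 * r + 1 + i"] assms n r2 sg
    by (auto split: if_splits)
qed

text \<open>The links carry the block of \<open>C\<close> starting at \<open>3 * r + 1\<close>
  through \<open>M\<close>, \<open>A\<close> and \<open>B\<close> to the one starting at
  \<open>3 * r\<close>. This moves an entry one step up its diagonal; repetition ends in row
  \<open>3 * r\<close>.\<close>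

lemma nw_toeplitz:
  "i < j \<Longrightarrow> j \<le> r \<Longrightarrow> E g (3 * r + i) (3 * r + j) = c g (j - i)"
proof (induction i arbitrary: j)
  case 0
  then show ?case by (simp add: c_def)
next
  case (Suc i)
  then obtain k where j: "j = Suc k" by (cases j) auto
  have "E g (3 * r + Suc i) (3 * r + j) = E g (3 * r + 1 + i) (3 * r + 1 + k)" by (simp add: j)
  also have "\<dots> = E g (3 * r + i) (3 * r + k)"
    using nw_link_MC[of i k] nw_link_AM[of i k] nw_link_AB[of i k] nw_link_BC[of i k] Suc.prems j by simp
  also have "\<dots> = c g (k - i)" using Suc j by simp
  finally show ?case by (simp add: j)
qed

lemma no_witness_P: "g \<in> P"
proof -
  have "E g a b = link g a b" if a: "a \<le> 4 * r" and b: "b \<in> J a" for a b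
  proof (cases "b \<le> 4 * r \<and> (a < r \<or> b < 2 * r \<or> 2 * r \<le> a)")
    case True
    have "a < b" using J_bounds[OF a b] by simp
    moreover have "a < r \<Longrightarrow> b < r" "2 * r \<le> a \<Longrightarrow> a < 3 * r \<Longrightarrow> b < 3 * r"
      using b by (simp_all add: J_def)
    ultimately consider "a < r" "a < b" "b < r" | "r \<le> a" "a < b" "b < 2 * r" | "2 * r \<le> a" "a < b" "b < 3 * r"
      | "3 * r \<le> a" "a < b" "b \<le> 4 * r"
      using True by linarith
    then have "E g a b = c g (b - a)"
    proof cases
      case 1
      then show ?thesis using nw_link_AB[of a b] nw_link_BC[of a b] nw_toeplitz[of a b] by simp
    next
      case 2
      then show ?thesis
        using nw_link_AM[of "a - r" "b - r"] nw_link_AB[of "a - r" "b - r"] nw_link_BC[of "a - r" "b - r"]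
          nw_toeplitz[of "a - r" "b - r"] by simp
    next
      case 3
      then show ?thesis using nw_link_BC[of "a - 2 * r" "b - 2 * r"] nw_toeplitz[of "a - 2 * r" "b - 2 * r"]
        by simp
    next
      case 4
      then show ?thesis using nw_toeplitz[of "a - 3 * r" "b - 3 * r"] by simp
    qed
    then show ?thesis using True by (simp add: link_def)
  next
    case False
    then consider "r \<le> a" "a < 2 * r" "2 * r \<le> b" "b \<le> 3 * r"
        | "r \<le> a" "a < 2 * r" "4 * r < b" "b < a + 3 * r + 1"
        | "3 * r < a" "4 * r < b" "b < a + 2 * r"
      using a b by (auto simp: J_def split: if_splits)
    then have "E g a b = 0"
      by cases (use nw_MB nw_M nw_C a in auto)
    then show ?thesis using False by (auto simp: link_def)
  qed
  then show ?thesis using g by (simp add: P_def)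
qed

end

lemma mackey_pair: "mackey_pair (UT n) P N tau"
proof (intro mackey_pair.intro mackey_pair_axioms.intro)
  show "group (UT n :: 'a mat monoid)" by (rule group_UT)
  show "finite (carrier (UT n :: 'a mat monoid))" by (rule finite_UT)
  fix g assume "g \<in> carrier (UT n)" "g \<notin> P"
  then show "\<exists>h\<in>N. g \<otimes>\<^bsub>UT n\<^esub> h \<otimes>\<^bsub>UT n\<^esub> inv\<^bsub>UT n\<^esub> g \<in> P \<and>
      tau (g \<otimes>\<^bsub>UT n\<^esub> h \<otimes>\<^bsub>UT n\<^esub> inv\<^bsub>UT n\<^esub> g) \<noteq> tau h"
    using no_witness_P by (auto simp: witness_def)
qed (use subgroup_P subgroup_N N_subset_P tau_mult tau_nz in auto)

end

section \<open>Degree and values\<close>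

context exotic_data
begin

interpretation mackey_pair "UT n" P N tau by (rule mackey_pair)

section \<open>The index of the inducing subgroup\<close>

definition mk :: "(nat \<Rightarrow> nat \<Rightarrow> 'a) \<Rightarrow> 'a mat" where
  "mk f = mat n n (\<lambda>(a, b). if a = b then 1 else if a < b then w b / w a * f a b else 0)"

lemma mk_UT: "mk f \<in> carrier (UT n)"
  by (auto simp: mk_def UT_iff)

lemma E_mk: "a < b \<Longrightarrow> b < n \<Longrightarrow> E (mk f) a b = f a b"
  using w by (simp add: E_def mk_def)

lemma UT_eqI:
  assumes g: "g \<in> carrier (UT n)" and h: "h \<in> carrier (UT n)"
    and eq: "\<And>a b. a < b \<Longrightarrow> b < n \<Longrightarrow> E g a b = E h a b"
  shows "g = h"
proof (rule eq_matI)
  fix a b assume "a < dim_row h" "b < dim_col h"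
  then have ab: "a < n" "b < n" using UT_carrier_mat[OF h] by auto
  show "g $$ (a, b) = h $$ (a, b)"
  proof (cases "a < b")
    case True
    then show ?thesis using eq[OF True ab(2)] w by (simp add: E_def)
  next
    case False
    then show ?thesis using UT_entry[OF g ab(1), of b] UT_entry[OF h ab(1), of b] by simp
  qed
qed (use UT_carrier_mat[OF g] UT_carrier_mat[OF h] in auto)

text \<open>The positions at which an element of \<open>P\<close> is determined by its other
  entries. Row \<open>3 * r\<close>, from which the Toeplitz sequence is read, is left out.\<close>

definition Js :: "(nat \<times> nat) set" where
  "Js = Sigma ({..4 * r} - {3 * r}) J"

lemma Js_bounds: "(a, b) \<in> Js \<Longrightarrow> a < b \<and> b < n"
  using J_bounds[of a b] sg_bounds[of a] n by (auto simp: Js_def)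

lemma link_cong:
  assumes "(a, b) \<in> Js" "\<And>k. 0 < k \<Longrightarrow> k < r \<Longrightarrow> c g k = c h k"
  shows "link g a b = link h a b"
  using J_diff_bounds[of a b] assms(1) assms(2)[of "b - a"] by (auto simp: link_def Js_def)

lemma c_eqI: "(\<And>b. 3 * r < b \<Longrightarrow> b < n \<Longrightarrow> E g (3 * r) b = E h (3 * r) b) \<Longrightarrow> 0 < k \<Longrightarrow> k < r \<Longrightarrow> c g k = c h k"
  using n by (simp add: c_def)

lemma P_iff: "g \<in> P \<longleftrightarrow> g \<in> carrier (UT n) \<and> (\<forall>(a, b)\<in>Js. E g a b = link g a b)"
proof -
  have "E g (3 * r) b = link g (3 * r) b" if "b \<in> J (3 * r)" for b
    using that r2 by (simp add: J_def link_def c_def)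
  then show ?thesis by (auto simp: P_def Js_def)
qed

lemma card_UT: "card (carrier (UT n :: 'a mat monoid)) = card P * CARD('a) ^ card Js"
proof -
  let ?fwd = "\<lambda>(g, u). mk (\<lambda>a b. if (a, b) \<in> Js then u (a, b) else E g a b)"
  let ?bwd = "\<lambda>h. (mk (\<lambda>a b. if (a, b) \<in> Js then link h a b else E h a b), \<lambda>x\<in>Js. E h (fst x) (snd x))"
  have row: "(3 * r, b) \<notin> Js" for b by (simp add: Js_def)
  have bij: "bij_betw ?fwd (P \<times> (Js \<rightarrow>\<^sub>E UNIV)) (carrier (UT n))"
  proof (rule bij_betw_byWitness[where f' = ?bwd])
    show "?fwd ` (P \<times> (Js \<rightarrow>\<^sub>E UNIV)) \<subseteq> carrier (UT n)" by (auto simp: mk_UT)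
    show "?bwd ` carrier (UT n) \<subseteq> P \<times> (Js \<rightarrow>\<^sub>E UNIV)"
    proof (rule image_subsetI)
      fix h :: "'a mat" assume "h \<in> carrier (UT n)"
      let ?g = "mk (\<lambda>a b. if (a, b) \<in> Js then link h a b else E h a b)"
      have ceq: "c ?g k = c h k" if "0 < k" "k < r" for k
        using that by (intro c_eqI) (simp_all add: E_mk row)
      have "E ?g a b = link ?g a b" if ab: "(a, b) \<in> Js" for a b
        using Js_bounds[OF ab] ab link_cong[OF ab ceq] by (simp add: E_mk)
      then have "?g \<in> P" by (auto simp: P_iff mk_UT)
      then show "?bwd h \<in> P \<times> (Js \<rightarrow>\<^sub>E UNIV)" by simp
    qed
    show "\<forall>x\<in>P \<times> (Js \<rightarrow>\<^sub>E UNIV). ?bwd (?fwd x) = x"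
    proof (rule ballI)
      fix x assume x: "x \<in> P \<times> (Js \<rightarrow>\<^sub>E (UNIV :: 'a set))"
      obtain g u where gu: "x = (g, u)" "g \<in> P" "u \<in> Js \<rightarrow>\<^sub>E UNIV" using x by (cases x) auto
      let ?h = "mk (\<lambda>a b. if (a, b) \<in> Js then u (a, b) else E g a b)"
      have ceq: "c ?h k = c g k" if "0 < k" "k < r" for k
        using that by (intro c_eqI) (simp_all add: E_mk row)
      have "mk (\<lambda>a b. if (a, b) \<in> Js then link ?h a b else E ?h a b) = g"
      proof (rule UT_eqI[OF mk_UT P_UT[OF gu(2)]])
        fix a b assume ab: "a < b" "b < n"
        show "E (mk (\<lambda>a b. if (a, b) \<in> Js then link ?h a b else E ?h a b)) a b = E g a b"
        proof (cases "(a, b) \<in> Js")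
          case True
          then show ?thesis using ab link_cong[OF True ceq] gu(2) by (auto simp: E_mk P_iff)
        qed (use ab in \<open>simp add: E_mk\<close>)
      qed
      moreover have "(\<lambda>x\<in>Js. E ?h (fst x) (snd x)) = u"
      proof
        fix x show "(\<lambda>x\<in>Js. E ?h (fst x) (snd x)) x = u x"
        proof (cases "x \<in> Js")
          case True
          then show ?thesis using Js_bounds[of "fst x" "snd x"] by (simp add: E_mk)
        next
          case False
          then show ?thesis using PiE_arb[OF gu(3) False] by simp
        qed
      qed
      ultimately show "?bwd (?fwd x) = x" unfolding gu(1) prod.case by (simp only:)
    qed
    show "\<forall>h\<in>carrier (UT n). ?fwd (?bwd h) = h"
    proof (rule ballI)
      fix h :: "'a mat" assume h: "h \<in> carrier (UT n)"
      let ?g = "mk (\<lambda>a b. if (a, b) \<in> Js then link h a b else E h a b)"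
      have "mk (\<lambda>a b. if (a, b) \<in> Js then (\<lambda>x\<in>Js. E h (fst x) (snd x)) (a, b) else E ?g a b) = h"
        by (rule UT_eqI[OF mk_UT h]) (simp add: E_mk)
      then show "?fwd (?bwd h) = h" by simp
    qed
  qed
  have finJs: "finite Js" by (auto simp: Js_def J_def)
  show ?thesis
    using bij_betw_same_card[OF bij] finJs by (simp add: card_cartesian_product card_PiE)
qed

text \<open>Origin of the exponent: \<open>A\<close> and \<open>B\<close> have
  \<open>r * (r - 1) / 2\<close> positions each, every row of \<open>M\<close> has
  \<open>2 * r\<close>, and each of the \<open>r\<close> rows of \<open>C\<close> after
  \<open>3 * r\<close> has \<open>2 * r - 1\<close>.\<close>

lemma card_Js: "card Js = 5 * r\<^sup>2 - 2 * r"
proof -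
  have gauss: "(\<Sum>i<m. m - Suc i) * 2 = m * (m - 1)" for m :: nat
  proof -
    have "(\<Sum>i<m. m - Suc i) = \<Sum>{..<m}" by (rule sum.nat_diff_reindex)
    moreover have "\<Sum>{..<m} * 2 = m * (m - 1)" by (induction m) (auto simp: algebra_simps)
    ultimately show ?thesis by simp
  qed
  have "card Js = (\<Sum>a\<in>{..4 * r} - {3 * r}. card (J a))"
    unfolding Js_def by (rule card_SigmaI) (auto simp: J_def)
  also have "{..4 * r} - {3 * r} = {..<r} \<union> ({r..<2 * r} \<union> ({2 * r..<3 * r} \<union> {3 * r<..4 * r}))"
    by auto
  also have "(\<Sum>a\<in>\<dots>. card (J a)) = (\<Sum>a\<in>{..<r}. card (J a)) + ((\<Sum>a\<in>{r..<2 * r}. card (J a)) +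
      ((\<Sum>a\<in>{2 * r..<3 * r}. card (J a)) + (\<Sum>a\<in>{3 * r<..4 * r}. card (J a))))"
    by (subst sum.union_disjoint, auto, subst sum.union_disjoint, auto, subst sum.union_disjoint, auto)
  also have "(\<Sum>a\<in>{..<r}. card (J a)) = (\<Sum>i<r. r - Suc i)"
    by (intro sum.cong refl) (simp add: J_def)
  also have "(\<Sum>a\<in>{2 * r..<3 * r}. card (J a)) = (\<Sum>i<r. r - Suc i)"
    by (intro sum.reindex_bij_witness[where i = "\<lambda>i. 2 * r + i" and j = "\<lambda>a. a - 2 * r"]) (auto simp: J_def)
  also have "(\<Sum>a\<in>{r..<2 * r}. card (J a)) = (\<Sum>a\<in>{r..<2 * r}. 2 * r)"
  proof (rule sum.cong[OF refl])
    fix a assume a: "a \<in> {r..<2 * r}"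
    have "card ({a<..3 * r} \<union> {4 * r<..<a + 3 * r + 1}) = card {a<..3 * r} + card {4 * r<..<a + 3 * r + 1}"
      by (rule card_Un_disjoint) auto
    then show "card (J a) = 2 * r" using a by (simp add: J_def)
  qed
  also have "(\<Sum>a\<in>{3 * r<..4 * r}. card (J a)) = (\<Sum>a\<in>{3 * r<..4 * r}. 2 * r - 1)"
    using r2 by (intro sum.cong refl) (auto simp: J_def)
  finally have "card Js = (\<Sum>i<r. r - Suc i) * 2 + 2 * r * r + r * (2 * r - 1)" by simp
  then have "card Js = r * (r - 1) + 2 * r * r + r * (2 * r - 1)" using gauss[of r] by simp
  then have "card Js + 2 * r = r * ((r - 1) + 2 * r + (2 * r - 1) + 2)" by (simp add: distrib_left mult_ac)
  also have "(r - 1) + 2 * r + (2 * r - 1) + 2 = 5 * r" using r2 by simp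
  finally show ?thesis by (simp add: power2_eq_square)
qed

lemma deg_eq: "deg = CARD('a) ^ (5 * r\<^sup>2 - 2 * r)"
proof -
  have "deg * card P = card P * CARD('a) ^ card Js"
    using lagrange_finite[OF finite_UT subgroup_P] card_UT by (simp add: deg_def Coset.order_def)
  moreover have "card P > 0"
    using subgroup.finite_imp_card_positive[OF subgroup_P finite_UT] .
  ultimately show ?thesis by (simp add: card_Js)
qed

section \<open>Values of the linear character and of the induced character\<close>

lemma \<theta>_0: "\<theta> 0 = 1"
  using \<theta>_add[of 0 0] \<theta>_nz[of 0] by simp

lemma \<theta>_power: "\<theta> x ^ k = \<theta> (of_nat k * x)"
  by (induction k) (simp_all add: \<theta>_0 \<theta>_add algebra_simps)

lemma \<omega>_power: "fps_nth f 0 = 1 \<Longrightarrow> \<omega> f ^ k = \<omega> (f ^ k)"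
proof (induction k)
  case 0
  have "\<omega> 1 * \<omega> 1 = \<omega> 1" "\<omega> 1 \<noteq> 0" using \<omega>(1)[of 1 1] \<omega>(2)[of 1] by simp_all
  then show ?case by simp
next
  case (Suc k)
  then show ?case by (simp add: \<omega>(1) fps_nth_power_0)
qed

text \<open>Write \<open>A g = 1 + u\<close>. Its power of exponent \<open>p * r\<close> is
  \<open>1 + u ^ (p * r)\<close>, which is 1 modulo \<open>t^(r+1)\<close> since \<open>u\<close>
  has no constant term and \<open>p * r > r\<close>. The other factor of \<open>tau\<close> is a
  \<open>p\<close>-th root of unity.\<close>

lemma tau_power:
  assumes "g \<in> P"
  shows "tau g ^ (CHAR('a) * r) = 1"
proof -
  define u where "u = A g - 1"
  have u0: "fps_nth u 0 = 0" using A_0[OF assms] by (simp add: u_def)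
  have pr: "CHAR('a) * r = CHAR('a) ^ Suc e" by (simp add: r_def)
  have Au: "1 + u = A g" by (simp add: u_def)
  have "A g ^ (CHAR('a) * r) = 1 + u ^ (CHAR('a) * r)"
    unfolding pr by (rule fps_CHAR_power[of u "Suc e", unfolded Au])
  have lt: "r < CHAR('a) * r"
    using prime_gt_1_nat[OF prime_CHAR_finite[where 'a = 'a]] r2 by simp
  have "fps_nth (u ^ (CHAR('a) * r)) k = 0" if "k \<le> r" for k
    using startsby_zero_power_prefix[OF u0, of "CHAR('a) * r"] le_less_trans[OF that lt] by blast
  then have "fps_agree r (1 + u ^ (CHAR('a) * r)) 1" by (simp add: fps_agree_def)
  then have "\<omega> (A g) ^ (CHAR('a) * r) = \<omega> 1"
    using \<omega>(3) \<open>A g ^ (CHAR('a) * r) = 1 + u ^ (CHAR('a) * r)\<close>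
    by (simp add: \<omega>_power[OF A_0[OF assms]])
  also have "\<omega> 1 = 1" using \<omega>_power[of 1 0] by simp
  finally show ?thesis by (simp add: tau_def power_mult_distrib \<theta>_power \<theta>_0)
qed

lemma tau_N_power: "g \<in> N \<Longrightarrow> tau g ^ CHAR('a) = 1"
  by (simp add: tau_N \<theta>_power \<theta>_0)

lemma exists_exotic_value: "\<exists>x\<in>P. tau x ^ r \<noteq> 1"
proof -
  obtain y where y: "\<theta> y \<noteq> 1" using \<theta> by (auto simp: nontrivial_additive_hom_def)
  obtain x where x: "x ^ r = y" using CHAR_power_surj[of e y] by (auto simp: r_def)
  \<comment> \<open>The superdiagonal is \<open>x\<close> inside the diagonal blocks, so that
    \<open>A t\<close> is \<open>1 + x * fps_X\<close>. The positions joining neighbouring blocks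
    stay 0: they would enter \<open>D\<close> or violate the zeros required in
    \<open>P\<close>.\<close>
  define t where "t = mk (\<lambda>a b. if b = Suc a \<and> (b < r \<or> r \<le> a \<and> b < 2 * r \<or>
    2 * r \<le> a \<and> b < 3 * r \<or> 3 * r \<le> a \<and> b \<le> 4 * r) then x else 0)"
  have t: "E t a b = (if b = Suc a \<and> (b < r \<or> r \<le> a \<and> b < 2 * r \<or>
    2 * r \<le> a \<and> b < 3 * r \<or> 3 * r \<le> a \<and> b \<le> 4 * r) then x else 0)" if "a < b" "b < n" for a b
    unfolding t_def using that by (rule E_mk)
  have c: "c t k = (if k = 1 then x else 0)" if "0 < k" "k \<le> r" for k
    using that n by (simp add: c_def t)
  have tP: "t \<in> P"
  proof -
    have "E t a b = link t a b" if ab: "(a, b) \<in> Js" for a b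
    proof (cases "b \<le> 4 * r \<and> (a < r \<or> b < 2 * r \<or> 2 * r \<le> a)")
      case True
      then have "0 < b - a" "b - a < r" using ab by (auto simp: Js_def J_def split: if_splits)
      then have "link t a b = (if b = Suc a then x else 0)" using True by (auto simp: link_def c)
      also have "\<dots> = E t a b"
        using t Js_bounds[OF ab] True ab by (auto simp: Js_def J_def split: if_splits)
      finally show ?thesis by simp
    next
      case False
      then have "link t a b = 0" by (auto simp: link_def)
      also have "\<dots> = E t a b"
        using t Js_bounds[OF ab] False by auto
      finally show ?thesis by simp
    qed
    then show ?thesis using mk_UT by (auto simp: P_iff t_def)
  qed
  have "fps_agree r (A t) (1 + fps_const x * fps_X)"
    using c c_0[OF P_UT[OF tP]] by (auto simp: fps_agree_def A_nth fps_X_nth)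
  then have "\<omega> (A t) = \<omega> (1 + fps_const x * fps_X)" by (rule \<omega>(3))
  then have "\<omega> (A t) ^ r = \<omega> ((1 + fps_const x * fps_X) ^ r)"
    by (simp add: \<omega>_power)
  also have "(1 + fps_const x * fps_X) ^ r = 1 + fps_const y * fps_X ^ r"
    using fps_CHAR_power[of "fps_const x * fps_X" e] x
    by (simp add: r_def power_mult_distrib fps_const_power)
  finally have "\<omega> (A t) ^ r = \<theta> y" by (simp add: \<omega>(4))
  moreover have "D t = 0"
  proof -
    have "d s t l = 0" if s: "s \<in> set blocks" and l: "l \<le> r" for s l
    proof -
      obtain a b where ab: "s = (a, b)" by (cases s)
      have "E t (a + (r - l + j)) (b + j) = 0" if "j < l" for j
      proof -
        define i where "i = r - l + j"
        have "i < r" "j < r" using that l by (auto simp: i_def)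
        then show ?thesis
          unfolding i_def[symmetric] using s n ab by (subst t) (auto simp: blocks_def)
      qed
      then show ?thesis by (simp add: d_def ab)
    qed
    then show ?thesis by (auto simp: fps_eq_iff D_nth blocks_def)
  qed
  moreover have "Lam t = 0"
    unfolding Lam_def
  proof (rule sum.neutral, rule ballI)
    fix a assume a: "a \<in> {r..<2 * r} \<union> {3 * r<..4 * r}"
    then have "sg a \<noteq> Suc a" using r2 by (auto simp: arc_end_def)
    then show "E t a (sg a) = 0" using a sg_bounds[of a] n by (subst t) auto
  qed
  ultimately have "tau t ^ r = \<theta> y" by (simp add: tau_def \<theta>_0)
  then show ?thesis using y tP by (intro bexI[of _ t]) simp_all
qed

lemma psi_values: "psi ` carrier (UT n) \<subseteq> cyclotomic_field (CHAR('a) * r)"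
proof (rule psi_range)
  have "CHAR('a) * r > 0" using prime_gt_0_nat[OF prime_CHAR_finite[where 'a = 'a]] r2 by simp
  then show "tau x \<in> cyclotomic_field (CHAR('a) * r)" if "x \<in> P" for x
    using tau_power[OF that] by (rule root_of_unity_in_cyclotomic_field)
qed (auto intro: cyclotomic_field_0 cyclotomic_field_add)

lemma psi_exotic: "\<not> psi ` carrier (UT n) \<subseteq> cyclotomic_field r"
proof
  let ?p = "CHAR('a)" and ?K = "cyclotomic_field r"
  assume sub: "psi ` carrier (UT n) \<subseteq> ?K"
  have p: "prime ?p" by (rule prime_CHAR_finite)
  have pr: "?p * r > 0" using prime_gt_0_nat[OF p] r2 by simp
  obtain x where x: "x \<in> P" "tau x ^ r \<noteq> 1" using exists_exotic_value by blast
  have "inverse (tau h) * psi (h * x) \<in> ?K" if h: "h \<in> N" for h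
  proof -
    have "tau h ^ r = 1"
    proof -
      \<comment> \<open>As \<open>e > 0\<close>, the \<open>p\<close>-th roots of unity are among
        the \<open>r\<close>-th roots of unity.\<close>
      obtain k where "r = ?p * k" using e by (cases e) (auto simp: r_def)
      then show ?thesis using tau_N_power[OF h] by (simp add: power_mult)
    qed
    then have "tau h \<in> ?K" using r2 by (intro root_of_unity_in_cyclotomic_field) auto
    then have "inverse (tau h) \<in> ?K"
      using tau_nz[of h] h N_subset_P by (intro cyclotomic_field_inverse) auto
    moreover have "h * x \<in> carrier (UT n)"
      using P_mult[of h x] x h N_subset_P P_UT by auto
    ultimately show ?thesis using sub by (intro cyclotomic_field_mult) auto
  qed
  then have "(\<Sum>h\<in>N. inverse (tau h) * psi (h * x)) \<in> ?K" by (rule cyclotomic_field_sum)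
  then have "of_nat (card N) * tau x \<in> ?K" using psi_twisted_sum[OF x(1)] by simp
  moreover have "inverse (of_nat (card N)) \<in> ?K"
    using N_card by (intro cyclotomic_field_inverse cyclotomic_field_of_nat) auto
  ultimately have "inverse (of_nat (card N)) * (of_nat (card N) * tau x) \<in> ?K"
    by (rule cyclotomic_field_mult[rotated])
  then have taux: "tau x \<in> ?K" using N_card by (simp add: field_simps)
  obtain k where k: "tau x = zeta (?p * r) ^ k"
    using root_of_unity_is_zeta_power[OF pr tau_power[OF x(1)]] by blast
  \<comment> \<open>Otherwise \<open>tau x ^ r\<close> would be 1. Since \<open>r\<close> is a power
    of \<open>p\<close>, it follows that \<open>k\<close> is invertible modulo \<open>p * r\<close>,
    so a power of \<open>tau x\<close> is \<open>zeta (p * r)\<close> itself.\<close>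
  have "\<not> ?p dvd k"
  proof
    assume "?p dvd k"
    then obtain l where "k = ?p * l" by auto
    then have "tau x ^ r = (zeta (?p * r) ^ (?p * r)) ^ l"
      by (simp add: k power_mult[symmetric] mult_ac)
    then show False using x(2) zeta_power_eq_1[OF pr] by simp
  qed
  then have "coprime k ?p" using prime_imp_coprime[OF p] coprime_commute by blast
  then have "coprime k (?p * r)" by (simp add: r_def)
  then obtain l where l: "[k * l = 1] (mod (?p * r))"
    using cong_solve_coprime_nat unfolding One_nat_def by blast
  have "1 < ?p * r" using prime_gt_1_nat[OF p] r2 mult_le_mono2[of 1 r ?p] by linarith
  then have "k * l mod (?p * r) = 1" using l by (simp add: cong_def)
  then have "k * l = ?p * r * (k * l div (?p * r)) + 1" by (metis mult_div_mod_eq)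
  then obtain m where m: "k * l = ?p * r * m + 1" by blast
  have "zeta (?p * r) = zeta (?p * r) ^ (k * l)"
    unfolding m power_add power_mult[of _ "?p * r" m] zeta_power_eq_1[OF pr] by simp
  also have "\<dots> \<in> ?K" using cyclotomic_field_power[OF taux, of l] by (simp add: k power_mult)
  finally show False using zeta_prime_power_notin[OF refl p r_def e] by simp
qed

text \<open>Testing against \<open>el b (sg a)\<close> shows that an element of the left annihilator
  has zeros strictly inside every arc. Hence it lies in \<open>N\<close>, and the additional terms
  of \<open>F\<close> vanish on it, their positions being inside arcs.\<close>

lemma psi_constituent:
  assumes \<phi>: "\<phi> \<in> dual n"
    and \<phi>_eq: "\<And>X. X \<in> strictly_upper n \<Longrightarrow> \<phi> X = (\<Sum>a\<le>4 * r. E X a (sg a))"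
  shows "character_inner (UT n) (supercharacter \<theta> n \<phi>) psi \<noteq> 0"
proof (rule supercharacter_inner_nonzero[OF mackey_pair \<theta> \<phi>])
  fix g assume g: "g \<in> left_annihilator n \<phi>" "g \<in> P"
  have gU: "g \<in> carrier (UT n)" using g by (simp add: P_UT)
  define X where "X = g - 1\<^sub>m n"
  have X: "X \<in> strictly_upper n" using UT_minus_one[OF gU] by (simp add: X_def)
  note Xc = strictly_upper_carrier[OF X]
  have gX: "g = 1\<^sub>m n + X" using one_plus_minus_UT[OF gU] by (simp add: X_def)
  have zero: "E X a b = 0" if ab: "a \<le> 4 * r" "a < b" "b < sg a" for a b
  proof -
    have sn: "sg a < n" using sg_bounds[OF ab(1)] n by simp
    have elU: "el b (sg a) \<in> strictly_upper n" using ab by (intro el_strictly_upper)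
    have "\<phi> (X * el b (sg a)) = (\<Sum>i\<le>4 * r. E (X * el b (sg a)) i (sg i))"
      using elU X by (intro \<phi>_eq strictly_upper_mult)
    also have "\<dots> = (\<Sum>i\<le>4 * r. if sg i = sg a then E X i b else 0)"
    proof (intro sum.cong refl)
      fix i assume "i \<in> {..4 * r}"
      then show "E (X * el b (sg a)) i (sg i) = (if sg i = sg a then E X i b else 0)"
        using sg_bounds[of i] n ab sn by (intro E_mult_el Xc) auto
    qed
    also have "\<dots> = E X a b" by (rule sum_sg_hit[OF ab(1) refl])
    finally show ?thesis using g elU by (simp add: left_annihilator_def X_def)
  qed
  have "Jzero X" unfolding Jzero_def using J_bounds zero by blast
  then have "g \<in> N" unfolding gX by (intro one_plus_N X)
  then have "tau g = \<theta> (F X)" using tau_N by (simp add: gX F_one_plus Xc)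
  also have "F X = \<phi> X"
  proof -
    have "E X j (r + j) = 0" "E X (r + j) (3 * r + 1 + j) = 0" if "j < r" for j
      using that by (auto intro!: zero simp: arc_end_def)
    then show ?thesis by (simp add: F_def \<phi>_eq[OF X])
  qed
  finally show "\<theta> (\<phi> (g - 1\<^sub>m n)) = tau g" by (simp add: X_def)
qed

lemma exotic_character:
  shows "irreducible_character (UT n) psi"
    and "character_degree (UT n) psi = of_nat (CARD('a) ^ (5 * r\<^sup>2 - 2 * r))"
  using irreducible_character_psi psi_one by (simp_all add: character_degree_def deg_eq)

end

section \<open>Quasi-monomial forms of exotic shape\<close>

text \<open>Here rows and columns are numbered from 1, as in \<open>coeff_of\<close>.\<close>

definition support :: "nat \<Rightarrow> ('a::field mat \<Rightarrow> 'a) \<Rightarrow> (nat \<times> nat) set" where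
  "support n \<phi> = {(i, j). i \<in> {1..n} \<and> j \<in> {1..n} \<and> coeff_of n \<phi> i j \<noteq> 0}"

lemma support_less: "(i, j) \<in> support n \<phi> \<Longrightarrow> i < j"
  by (auto simp: support_def coeff_of_def split: if_splits)

lemma card_le_1_unique: "finite A \<Longrightarrow> card A \<le> 1 \<Longrightarrow> x \<in> A \<Longrightarrow> y \<in> A \<Longrightarrow> x = y"
  by (metis One_nat_def card_le_Suc0_iff_eq)

lemma single_valued_support:
  assumes "quasi_monomial n \<phi>"
  shows "single_valued (support n \<phi>)" "single_valued ((support n \<phi>)\<inverse>)"
proof -
  have row: "card {j \<in> {1..n}. coeff_of n \<phi> i j \<noteq> 0} \<le> 1"
    and col: "card {j \<in> {1..n}. coeff_of n \<phi> j i \<noteq> 0} \<le> 1" if "i \<in> {1..n}" for i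
    using assms that by (auto simp: quasi_monomial_def)
  show "single_valued (support n \<phi>)"
  proof (rule single_valuedI)
    fix i j k assume "(i, j) \<in> support n \<phi>" "(i, k) \<in> support n \<phi>"
    then show "j = k" using card_le_1_unique[OF _ row[of i], of j k] by (simp add: support_def)
  qed
  show "single_valued ((support n \<phi>)\<inverse>)"
  proof (rule single_valuedI)
    fix i j k assume "(i, j) \<in> (support n \<phi>)\<inverse>" "(i, k) \<in> (support n \<phi>)\<inverse>"
    then show "j = k" using card_le_1_unique[OF _ col[of i], of j k] by (simp add: support_def)
  qed
qed

text \<open>A block of the shape is a connected component of a disjoint union of increasing paths,
  hence the forward orbit of its minimum, so consecutive elements are joined.\<close>

lemma is_shape_consecutive:
  assumes qm: "quasi_monomial n \<phi>" and sh: "is_shape n \<phi> Q"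
    and B: "B \<in> Q" "u \<in> B" "v \<in> B" "u < v" and gap: "\<And>x. x \<in> B \<Longrightarrow> \<not> (u < x \<and> x < v)"
  shows "(u, v) \<in> support n \<phi>"
proof -
  let ?R = "support n \<phi>"
  have part: "partition_on {1..n} Q" and join: "joins_support n \<phi> Q"
    and fine: "\<And>Q'. partition_on {1..n} Q' \<Longrightarrow> joins_support n \<phi> Q' \<Longrightarrow> refines {1..n} Q Q'"
    using sh by (auto simp: is_shape_def)
  have Un: "\<Union>Q = {1..n}" and disj: "\<And>X Y. X \<in> Q \<Longrightarrow> Y \<in> Q \<Longrightarrow> X \<noteq> Y \<Longrightarrow> X \<inter> Y = {}" and ne: "{} \<notin> Q"
    using part by (auto simp: partition_on_def disjoint_def)
  have finB: "finite B" using Un B(1) by (metis Union_upper finite_atLeastAtMost finite_subset)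
  define m where "m = Min B"
  have m: "m \<in> B" "\<And>x. x \<in> B \<Longrightarrow> m \<le> x" 
    using Min_in[OF finB] Min_le[OF finB] B(2) by (auto simp: m_def)
  \<comment> \<open>The forward path from the least element of the block. If it missed part of the
    block, splitting the block into \<open>K\<close> and the rest would give a partition that the
    finest one does not refine.\<close>
  define K where "K = B \<inter> ?R\<^sup>* `` {m}"
  have mK: "m \<in> K" using m by (auto simp: K_def)
  have edge: "\<exists>C\<in>Q. i \<in> C \<and> j \<in> C" if "(i, j) \<in> ?R" for i j
    using that join by (auto simp: joins_support_def support_def)
  have edge_B: "i \<in> B \<longleftrightarrow> j \<in> B" if "(i, j) \<in> ?R" for i j
    using edge[OF that] disj[OF _ B(1)] by blast
  have edge_K: "i \<in> K \<longleftrightarrow> j \<in> K" if ij: "(i, j) \<in> ?R" "i \<in> B" for i j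
  proof
    assume "i \<in> K"
    then show "j \<in> K" using ij edge_B by (auto simp: K_def)
  next
    assume j: "j \<in> K"
    \<comment> \<open>An arc ending in \<open>m\<close> would start at a smaller element of the
      block. Any other point of the path is reached through a predecessor on the path, which is
      unique.\<close>
    have "j \<noteq> m" using support_less[OF ij(1)] m(2)[OF ij(2)] by auto
    moreover have "(m, j) \<in> ?R\<^sup>*" using j by (simp add: K_def)
    ultimately obtain k where k: "(m, k) \<in> ?R\<^sup>*" "(k, j) \<in> ?R" by (metis rtranclE)
    then have "k = i" using single_valuedD[OF single_valued_support(2)[OF qm]] ij(1) by blast
    then show "i \<in> K" using k ij by (simp add: K_def)
  qed
  have "B \<subseteq> K"
  proof (rule ccontr)
    assume notsub: "\<not> B \<subseteq> K"
    define Q' where "Q' = (Q - {B}) \<union> {K, B - K}"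
    have KB: "K \<subseteq> B" by (auto simp: K_def)
    have "partition_on {1..n} Q'"
    proof (rule partition_onI)
      have "\<Union>Q' = \<Union>(Q - {B}) \<union> B" using KB by (auto simp: Q'_def)
      also have "\<dots> = {1..n}" using Un B(1) by auto
      finally show "\<Union>Q' = {1..n}" .
      show "{} \<notin> Q'" using ne mK notsub by (auto simp: Q'_def)
      have other: "X \<inter> B = {}" if "X \<in> Q - {B}" for X using disj B(1) that by blast
      show "disjnt X Y" if "X \<in> Q'" "Y \<in> Q'" "X \<noteq> Y" for X Y
        using that other[of X] other[of Y] disj[of X Y] KB unfolding Q'_def disjnt_def by blast
    qed
    moreover have "joins_support n \<phi> Q'"
      unfolding joins_support_def
    proof (intro ballI impI)
      fix i j assume "i \<in> {1..n}" "j \<in> {1..n}" "coeff_of n \<phi> i j \<noteq> 0"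
      then have ij: "(i, j) \<in> ?R" by (simp add: support_def)
      then obtain C where C: "C \<in> Q" "i \<in> C" "j \<in> C" using edge by blast
      show "\<exists>B\<in>Q'. i \<in> B \<and> j \<in> B"
      proof (cases "C = B")
        case True
        then show ?thesis using edge_K[OF ij] C by (cases "i \<in> K") (auto simp: Q'_def)
      next
        case False
        then show ?thesis using C by (auto simp: Q'_def)
      qed
    qed
    ultimately have "refines {1..n} Q Q'" by (rule fine)
    then obtain Y where Y: "Y \<in> Q'" "B \<subseteq> Y" using B(1) by (auto simp: refines_def)
    then have "Y = K \<or> Y = B - K \<or> (Y \<in> Q \<and> Y \<noteq> B)" by (auto simp: Q'_def)
    then show False
    proof (elim disjE)
      assume "Y = K" then show False using Y notsub by simp
    next
      assume "Y = B - K" then show False using Y mK m by auto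
    next
      assume "Y \<in> Q \<and> Y \<noteq> B" then show False using disj[of Y B] Y B m by auto
    qed
  qed
  then have uv: "(m, u) \<in> ?R\<^sup>*" "(m, v) \<in> ?R\<^sup>*" using B by (auto simp: K_def)
  have mono: "x \<le> y" if "(x, y) \<in> ?R\<^sup>*" for x y
    using that by (induction rule: rtrancl_induct) (auto dest!: support_less)
  \<comment> \<open>Paths from \<open>m\<close> in a single-valued relation are comparable, and arcs
    increase, so the path leads from \<open>u\<close> to \<open>v\<close>.\<close>
  have "(u, v) \<in> ?R\<^sup>*"
    using single_valued_confluent[OF single_valued_support(1)[OF qm] uv] mono[of v u] B(4) by auto
  then obtain k where k: "(u, k) \<in> ?R" "(k, v) \<in> ?R\<^sup>*" using B(4) by (metis converse_rtranclE less_irrefl)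
  have "k \<in> B" using edge_B[OF k(1)] B by simp
  then have "k = v" using gap[of k] support_less[OF k(1)] mono[OF k(2)] by auto
  then show ?thesis using k by simp
qed

text \<open>The arcs join consecutive elements of a part. The first case is the part with five
  elements; the second, fourth and fifth are the three arcs in a part with four elements, and the
  third is the two-element parts.\<close>

lemma exotic_partition_arc:
  assumes a: "a \<le> 4 * r" and r: "2 \<le> r" and n: "6 * r < n"
  shows "\<exists>B\<in>exotic_partition r n. Suc a \<in> B \<and> Suc (arc_end r a) \<in> B \<and>
    (\<forall>x\<in>B. \<not> (Suc a < x \<and> x < Suc (arc_end r a)))"
proof -
  consider "a = 0 \<or> a = 2 * r \<or> a = 3 * r \<or> a = 4 * r" | "0 < a" "a < r" | "r \<le> a" "a < 2 * r"
    | "2 * r < a" "a < 3 * r" | "3 * r < a" "a < 4 * r"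
    using a by linarith
  then show ?thesis
  proof cases
    case 1
    have "{1, 2 * r + 1, 3 * r + 1, 4 * r + 1, 6 * r + 1} \<in> exotic_partition r n"
      by (simp add: exotic_partition_def)
    then show ?thesis by (rule bexI[rotated]) (use 1 r in \<open>auto simp: arc_end_def\<close>)
  next
    case 2
    have "{Suc a, 2 * r + Suc a, 3 * r + Suc a, 5 * r + Suc a} \<in> exotic_partition r n"
      using 2 unfolding exotic_partition_def by (intro UnI1 UnI2 CollectI exI[of _ "Suc a"]) auto
    then show ?thesis by (rule bexI[rotated]) (use 2 r in \<open>auto simp: arc_end_def\<close>)
  next
    case 3
    have "{Suc a, 3 * r + 1 + Suc a} \<in> exotic_partition r n"
      using 3 unfolding exotic_partition_def by (intro UnI1 UnI2 CollectI exI[of _ "Suc a"]) auto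
    then show ?thesis by (rule bexI[rotated]) (use 3 r in \<open>auto simp: arc_end_def\<close>)
  next
    case 4
    define i where "i = Suc a - 2 * r"
    have i: "a = 2 * r + i - 1" "1 < i" "i \<le> r" using 4 by (auto simp: i_def)
    have "{i, 2 * r + i, 3 * r + i, 5 * r + i} \<in> exotic_partition r n"
      using i unfolding exotic_partition_def by (intro UnI1 UnI2 CollectI exI[of _ i]) auto
    then show ?thesis by (rule bexI[rotated]) (use i r in \<open>auto simp: arc_end_def\<close>)
  next
    case 5
    define i where "i = Suc a - 3 * r"
    have i: "a = 3 * r + i - 1" "1 < i" "i \<le> r" using 5 by (auto simp: i_def)
    have "{i, 2 * r + i, 3 * r + i, 5 * r + i} \<in> exotic_partition r n"
      using i unfolding exotic_partition_def by (intro UnI1 UnI2 CollectI exI[of _ i]) auto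
    then show ?thesis by (rule bexI[rotated]) (use i r in \<open>auto simp: arc_end_def\<close>)
  qed
qed

lemma exotic_partition_not_last:
  assumes "B \<in> exotic_partition r n" "i \<in> B" "j \<in> B" "i < j" "2 \<le> r"
  shows "i \<le> 4 * r + 1"
  using assms by (auto simp: exotic_partition_def)

lemma support_of_exotic_shape:
  assumes qm: "quasi_monomial n \<phi>" and sh: "is_shape n \<phi> (exotic_partition r n)"
    and r: "2 \<le> r" and n: "6 * r < n"
  shows "support n \<phi> = {(Suc a, Suc (arc_end r a)) | a. a \<le> 4 * r}"
proof -
  have arc: "(Suc a, Suc (arc_end r a)) \<in> support n \<phi>" if a: "a \<le> 4 * r" for a
  proof -
    have "a < arc_end r a" using r by (auto simp: arc_end_def)
    then show ?thesis
      using exotic_partition_arc[OF a r n] is_shape_consecutive[OF qm sh] by (metis Suc_less_eq)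
  qed
  moreover have "\<exists>a\<le>4 * r. (i, j) = (Suc a, Suc (arc_end r a))" if ij: "(i, j) \<in> support n \<phi>" for i j
  proof -
    obtain B where "B \<in> exotic_partition r n" "i \<in> B" "j \<in> B"
      using ij sh unfolding is_shape_def joins_support_def support_def by blast
    then have "i \<le> 4 * r + 1" using exotic_partition_not_last support_less[OF ij] r by blast
    moreover have "1 \<le> i" using ij by (simp add: support_def)
    ultimately obtain a where a: "i = Suc a" "a \<le> 4 * r" by (cases i) auto
    then have "j = Suc (arc_end r a)"
      using single_valuedD[OF single_valued_support(1)[OF qm] ij] arc[OF a(2)] by simp
    then show ?thesis using a by auto
  qed
  ultimately show ?thesis by (intro equalityI subrelI) blast+
qed

lemma dual_zero: "\<phi> \<in> dual n \<Longrightarrow> \<phi> (0\<^sub>m n n) = 0"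
proof -
  assume \<phi>: "\<phi> \<in> dual n"
  have "0\<^sub>m n n = 0 \<cdot>\<^sub>m (0\<^sub>m n n :: 'a mat)" by (intro eq_matI) auto
  then show ?thesis using dual_smult[OF \<phi> strictly_upper_zero, of 0] by simp
qed

lemma dual_expand:
  fixes X :: "'a::field mat"
  assumes \<phi>: "\<phi> \<in> dual n" and X: "X \<in> strictly_upper n"
  shows "\<phi> X = (\<Sum>(a, b)\<in>{(a, b). a < b \<and> b < n}. X $$ (a, b) * coeff_of n \<phi> (Suc a) (Suc b))"
proof -
  let ?T = "{(a, b). a < b \<and> b < n}"
  let ?M = "\<lambda>S. mat n n (\<lambda>x. if x \<in> S then X $$ x else 0)"
  have fin: "finite ?T" by (rule finite_subset[of _ "{..<n} \<times> {..<n}"]) auto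
  have "\<phi> (?M S) = (\<Sum>(a, b)\<in>S. X $$ (a, b) * coeff_of n \<phi> (Suc a) (Suc b))" if "finite S" "S \<subseteq> ?T" for S
    using that
  proof (induction S rule: finite_induct)
    case empty
    have "?M {} = 0\<^sub>m n n" by (intro eq_matI) auto
    then show ?case using dual_zero[OF \<phi>] by simp
  next
    case (insert x S)
    obtain a b where x: "x = (a, b)" "a < b" "b < n" using insert.prems by auto
    have U: "?M S \<in> strictly_upper n" using insert.prems by (auto simp: strictly_upper_def)
    have eU: "elementary_mat n (Suc a) (Suc b) \<in> (strictly_upper n :: 'a mat set)"
      using x by (auto simp: strictly_upper_def elementary_mat_def)
    have "?M (insert x S) = ?M S + X $$ (a, b) \<cdot>\<^sub>m elementary_mat n (Suc a) (Suc b)"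
      using x insert.hyps by (intro eq_matI) (auto simp: elementary_mat_def)
    then have "\<phi> (?M (insert x S)) = \<phi> (?M S) + X $$ (a, b) * \<phi> (elementary_mat n (Suc a) (Suc b))"
      using U eU by (simp add: dual_add[OF \<phi>] dual_smult[OF \<phi>] strictly_upper_smult)
    also have "\<phi> (elementary_mat n (Suc a) (Suc b)) = coeff_of n \<phi> (Suc a) (Suc b)"
      using x by (simp add: coeff_of_def)
    finally show ?case using insert x by (simp add: add.commute)
  qed
  from this[OF fin subset_refl] show ?thesis
  proof -
    assume eq: "\<phi> (?M ?T) = (\<Sum>(a, b)\<in>?T. X $$ (a, b) * coeff_of n \<phi> (Suc a) (Suc b))"
    have "?M ?T = X" using X by (intro eq_matI) (auto simp: strictly_upper_def not_less)
    then show ?thesis using eq by simp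
  qed
qed

lemma arc_end_less: "2 \<le> r \<Longrightarrow> a < arc_end r a"
  by (auto simp: arc_end_def)

text \<open>The arcs form a disjoint union of paths, so weights can be chosen backwards along each path.\<close>

lemma arc_weights_exist:
  fixes l :: "nat \<Rightarrow> 'a::field"
  assumes l: "\<And>a. a \<le> 4 * r \<Longrightarrow> l a \<noteq> 0" and r: "2 \<le> r"
  shows "\<exists>w. (\<forall>a. w a \<noteq> 0) \<and> (\<forall>a\<le>4 * r. w a = l a * w (arc_end r a))"
proof -
  have "\<exists>w. (\<forall>a. w a \<noteq> 0) \<and> (\<forall>a\<le>4 * r. 4 * r + 1 \<le> a + m \<longrightarrow> w a = l a * w (arc_end r a))"
    if "m \<le> 4 * r + 1" for m
    using that
  proof (induction m)
    case 0
    show ?case by (intro exI[of _ "\<lambda>_. 1"]) auto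
  next
    case (Suc m)
    then obtain w where w: "\<And>a. w a \<noteq> 0"
      "\<And>a. a \<le> 4 * r \<Longrightarrow> 4 * r + 1 \<le> a + m \<Longrightarrow> w a = l a * w (arc_end r a)" by auto
    define b where "b = 4 * r - m"
    let ?w = "w(b := l b * w (arc_end r b))"
    have "?w a \<noteq> 0" for a using w(1) l[of b] by (auto simp: b_def)
    moreover have "?w a = l a * ?w (arc_end r a)" if a: "a \<le> 4 * r" "4 * r + 1 \<le> a + Suc m" for a
    proof -
      have "b \<le> a" using a Suc.prems by (auto simp: b_def)
      then have "arc_end r a \<noteq> b" using arc_end_less[OF r, of a] by auto
      then show ?thesis using w(2)[of a] a Suc.prems by (cases "a = b") (auto simp: b_def)
    qed
    ultimately show ?case by blast
  qed
  from this[of "4 * r + 1"] show ?thesis by auto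
qed

text \<open>The coefficient on an arc is written as the quotient of the weights at its two ends, so
  the form becomes the plain sum of the rescaled entries over the arcs.\<close>

lemma exotic_shape_form:
  fixes \<phi> :: "'a::field mat \<Rightarrow> 'a"
  assumes qm: "quasi_monomial n \<phi>" and sh: "is_shape n \<phi> (exotic_partition r n)"
    and r: "2 \<le> r" and n: "6 * r < n"
  obtains w where "\<And>a. w a \<noteq> 0"
    "\<And>X. X \<in> strictly_upper n \<Longrightarrow> \<phi> X = (\<Sum>a\<le>4 * r. w a * X $$ (a, arc_end r a) / w (arc_end r a))"
proof -
  note supp = support_of_exotic_shape[OF qm sh r n]
  have \<phi>: "\<phi> \<in> dual n" using qm by (simp add: quasi_monomial_def)
  define l where "l a = coeff_of n \<phi> (Suc a) (Suc (arc_end r a))" for a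
  have "l a \<noteq> 0" if "a \<le> 4 * r" for a
  proof -
    have "(Suc a, Suc (arc_end r a)) \<in> support n \<phi>" using that supp by auto
    then show ?thesis by (simp add: support_def l_def)
  qed
  then obtain w where w: "\<And>a. w a \<noteq> 0" "\<And>a. a \<le> 4 * r \<Longrightarrow> w a = l a * w (arc_end r a)"
    using arc_weights_exist[OF _ r, of l] by blast
  have "\<phi> X = (\<Sum>a\<le>4 * r. w a * X $$ (a, arc_end r a) / w (arc_end r a))" if X: "X \<in> strictly_upper n" for X
  proof -
    let ?T = "{(a, b). a < b \<and> b < n}"
    let ?arcs = "(\<lambda>a. (a, arc_end r a)) ` {..4 * r}"
    have fin: "finite ?T" by (rule finite_subset[of _ "{..<n} \<times> {..<n}"]) auto
    have sub: "?arcs \<subseteq> ?T"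
      using arc_end_less[OF r] n by (auto simp: arc_end_def)
    have zero: "coeff_of n \<phi> (Suc a) (Suc b) = 0" if "(a, b) \<in> ?T - ?arcs" for a b
    proof (rule ccontr)
      assume "coeff_of n \<phi> (Suc a) (Suc b) \<noteq> 0"
      then have "(Suc a, Suc b) \<in> support n \<phi>" using that by (simp add: support_def)
      then show False using that supp by auto
    qed
    have "\<phi> X = (\<Sum>(a, b)\<in>?T. X $$ (a, b) * coeff_of n \<phi> (Suc a) (Suc b))"
      by (rule dual_expand[OF \<phi> X])
    also have "\<dots> = (\<Sum>(a, b)\<in>?arcs. X $$ (a, b) * coeff_of n \<phi> (Suc a) (Suc b))"
      using fin sub zero by (intro sum.mono_neutral_right) auto
    also have "\<dots> = (\<Sum>a\<le>4 * r. X $$ (a, arc_end r a) * l a)"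
      by (subst sum.reindex) (auto simp: inj_on_def l_def)
    also have "\<dots> = (\<Sum>a\<le>4 * r. w a * X $$ (a, arc_end r a) / w (arc_end r a))"
      using w by (intro sum.cong refl) simp
    finally show ?thesis .
  qed
  then show ?thesis using that w(1) by blast
qed

theorem theorem3p2:
  fixes G :: "'a::{field,finite} mat monoid" and p q r e n :: nat
  assumes "p = CHAR('a)" and "q = CARD('a)"
    and "e > 0" and "r = p ^ e" and "n > 6 * r"
    and "G = UT n"
  shows "(\<exists>\<psi>. irreducible_character G \<psi>
            \<and> character_degree G \<psi> = of_nat (q ^ (5 * r\<^sup>2 - 2 * r))
            \<and> \<psi> ` carrier G \<subseteq> cyclotomic_field (p * r)
            \<and> \<not> \<psi> ` carrier G \<subseteq> cyclotomic_field r)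
    \<and> (\<forall>\<theta> \<chi>. nontrivial_additive_hom (\<theta> :: 'a \<Rightarrow> complex)
            \<longrightarrow> supercharacter_of_shape \<theta> n \<chi> (exotic_partition r n)
            \<longrightarrow> (\<exists>\<psi>. irreducible_constituent G \<chi> \<psi>
                  \<and> character_degree G \<psi> = of_nat (q ^ (5 * r\<^sup>2 - 2 * r))
                  \<and> \<psi> ` carrier G \<subseteq> cyclotomic_field (p * r)
                  \<and> \<not> \<psi> ` carrier G \<subseteq> cyclotomic_field r))"
proof (intro conjI allI impI)
  note defs = assms(1,2,4,6)
  have r: "r = CHAR('a) ^ e" using assms by simp
  obtain \<theta> :: "'a \<Rightarrow> complex" where "nontrivial_additive_hom \<theta>"
    using nontrivial_additive_hom_exists by blast
  \<comment> \<open>With no form prescribed, all weights are taken to be 1.\<close>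
  then interpret exotic_data n r e "\<lambda>_. 1 :: 'a" \<theta>
    using assms r by unfold_locales auto
  show "\<exists>\<psi>. irreducible_character G \<psi>
            \<and> character_degree G \<psi> = of_nat (q ^ (5 * r\<^sup>2 - 2 * r))
            \<and> \<psi> ` carrier G \<subseteq> cyclotomic_field (p * r)
            \<and> \<not> \<psi> ` carrier G \<subseteq> cyclotomic_field r"
    using exotic_character psi_values psi_exotic unfolding defs by blast
next
  fix \<theta> :: "'a \<Rightarrow> complex" and \<chi>
  assume \<theta>: "nontrivial_additive_hom \<theta>"
    and "supercharacter_of_shape \<theta> n \<chi> (exotic_partition r n)"
  then obtain \<phi> where \<phi>: "quasi_monomial n \<phi>" "is_shape n \<phi> (exotic_partition r n)"
    and \<chi>: "\<chi> = supercharacter \<theta> n \<phi>"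
    by (auto simp: supercharacter_of_shape_def)
  note defs = assms(1,2,4,6)
  have r: "r = CHAR('a) ^ e" using assms by simp
  have r2: "2 \<le> r"
    using CHAR_power_ge_2[OF assms(3), where 'a = 'a] by (simp add: r)
  obtain w where wt: "\<And>a. w a \<noteq> 0"
    "\<And>X. X \<in> strictly_upper n \<Longrightarrow> \<phi> X = (\<Sum>a\<le>4 * r. w a * X $$ (a, arc_end r a) / w (arc_end r a))"
    using exotic_shape_form[OF \<phi> r2 assms(5)] by blast
  \<comment> \<open>The weights, and with them \<open>P\<close> and \<open>tau\<close>, depend on
    the form, so the induced character is chosen separately for each supercharacter.\<close>
  interpret exotic_data n r e w \<theta>
    using assms r wt(1) \<theta> by unfold_locales auto
  let ?\<psi> = "mackey_pair.psi (UT n) P tau"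
  have "\<phi> \<in> dual n" using \<phi>(1) by (simp add: quasi_monomial_def)
  then have "character_inner (UT n) \<chi> ?\<psi> \<noteq> 0"
    unfolding \<chi> by (rule psi_constituent) (simp add: wt(2) E_def)
  then have "irreducible_constituent (UT n) \<chi> ?\<psi>"
    using exotic_character(1) by (simp add: irreducible_constituent_def)
  then show "\<exists>\<psi>. irreducible_constituent G \<chi> \<psi>
                  \<and> character_degree G \<psi> = of_nat (q ^ (5 * r\<^sup>2 - 2 * r))
                  \<and> \<psi> ` carrier G \<subseteq> cyclotomic_field (p * r)
                  \<and> \<not> \<psi> ` carrier G \<subseteq> cyclotomic_field r"
    using exotic_character(2) psi_values psi_exotic unfolding defs by blast
qed

end
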